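(* Let $d\ge 1$, let $\alpha\in\mathbb{T}^d$ be rationally independent and let $\lambda\in\mathbb{C}$. Let $V\in C(\mathbb{T}^d,\mathbb{C})$ be Hölder continuous and such that $\log|z-V(\cdot)|\in L^1(\mathbb{T}^d)$ for all $z\in\mathbb{C}$. Then $$\sigma(H^V_{\alpha}(\lambda,\omega))=S_\lambda\qquad\text{for all }\omega\in\mathbb{T}.$$
   Context: $\mathbb{T}=\mathbb{R}/\mathbb{Z}$. A vector $\alpha\in\mathbb{T}^d$ is rationally independent if $(1,\alpha)=(1,\alpha_1,\dots,\alpha_d)$ is linearly independent over $\mathbb{Q}$. Write $V(\theta)=\sum_{k\in\mathbb{Z}^d}v_k e^{2\pi i\langle k,\theta\rangle}$ (Fourier series, $v_k$ the Fourier coefficients of $V$). The operator $H^V_\alpha(\lambda,\omega)$ acts on $\ell^2(\mathbb{Z}^d)$ by $$(H^V_\alpha(\lambda,\omega)u)(n)=\sum_{k\in\mathbb{Z}^d}v_k u(n-k)+\lambda e^{2\pi i(\omega+\langle n,\alpha\rangle)}u(n),\quad n\in\mathbb{Z}^d,$$ and $\sigma(\cdot)$ denotes its spectrum. Put $G_d(z)=\int_{\mathbb{T}^d}\log|z-V(\theta)|\,d\theta$ and let $R(V)$ be the range of $V$. For $\lambda\in\mathbb{C}\setminus\{0\}$ put $$P_\lambda=\{z\in\mathbb{C}: G_d(z)=\log|\lambda|\},\quad C_\lambda=\{z\in\mathbb{C}: G_d(z)>\log|\lambda|\}\cap R(V),\quad S_\lambda=P_\lambda\cup C_\lambda,$$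 and put $S_0=R(V)$. *)

theory Defs
  imports "HOL-Analysis.Analysis"
begin

text \<open>
  The torus \<open>\<real>\<^sup>d / \<int>\<^sup>d\<close> is represented by its universal cover: points are vectors in
  \<open>real ^ 'd\<close>, functions are the \<open>\<int>\<^sup>d\<close>-periodic functions on \<open>real ^ 'd\<close>, and integrals are taken
  over the unit cube, which is a fundamental domain of volume 1. The dimension is
  \<open>d = CARD('d)\<close>, which is at least 1.
\<close>

definition torus_periodic :: "(real ^ 'd \<Rightarrow> 'b) \<Rightarrow> bool" where
  "torus_periodic f \<longleftrightarrow> (\<forall>\<theta>. \<forall>k :: int ^ 'd. f (\<theta> + (\<chi> i. of_int (k $ i))) = f \<theta>)"

definition unit_cube :: "(real ^ 'd) set" where
  "unit_cube = cbox 0 1"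

definition pairing :: "int ^ 'd \<Rightarrow> real ^ 'd \<Rightarrow> real" where
  "pairing k \<theta> = (\<Sum>i\<in>UNIV. of_int (k $ i) * \<theta> $ i)"

text \<open>
  Linear independence over the rationals of the family \<open>(1, \<alpha>\<^sub>1, \<dots>, \<alpha>\<^sub>d)\<close>; stated for a family and
  not for the set of its values, so that repeated entries count as dependent.
\<close>

definition rationally_independent :: "real ^ 'd \<Rightarrow> bool" where
  "rationally_independent \<alpha> \<longleftrightarrow>
     (\<forall>(q\<^sub>0 :: rat) (q :: 'd \<Rightarrow> rat).
        of_rat q\<^sub>0 * 1 + (\<Sum>i\<in>UNIV. of_rat (q i) * \<alpha> $ i) = (0 :: real)
        \<longrightarrow> q\<^sub>0 = 0 \<and> (\<forall>i. q i = 0))"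

text \<open>
  For periodic functions this is Hoelder continuity with respect to the quotient distance on the
  torus, since that distance is the minimum of \<open>dist x y\<close> over all representatives.
\<close>

definition hoelder_continuous :: "('a::metric_space \<Rightarrow> 'b::metric_space) \<Rightarrow> bool" where
  "hoelder_continuous f \<longleftrightarrow>
     (\<exists>C \<gamma>. 0 < \<gamma> \<and> \<gamma> \<le> 1 \<and> (\<forall>x y. dist (f x) (f y) \<le> C * dist x y powr \<gamma>))"

definition fourier_coeff :: "(real ^ 'd \<Rightarrow> complex) \<Rightarrow> int ^ 'd \<Rightarrow> complex" where
  "fourier_coeff V k =
     (LINT \<theta>:unit_cube|lborel. V \<theta> * exp (- (2 * of_real pi * \<i> * of_real (pairing k \<theta>))))"

text \<open>
  \<open>log |z - V|\<close> is \<open>-\<infinity>\<close> where \<open>V\<close> takes the value \<open>z\<close>, whereas \<open>ln 0 = 0\<close> here. Membership in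
  \<open>L\<^sup>1\<close> therefore includes that \<open>V\<close> takes the value \<open>z\<close> on a null set only; the integral defining
  \<open>G\<close> then does not depend on the value of \<open>ln 0\<close>.
\<close>

definition log_dist_in_L1 :: "(real ^ 'd \<Rightarrow> complex) \<Rightarrow> complex \<Rightarrow> bool" where
  "log_dist_in_L1 V z \<longleftrightarrow>
     (AE \<theta>\<in>unit_cube in lborel. V \<theta> \<noteq> z) \<and>
     set_integrable lborel unit_cube (\<lambda>\<theta>. ln (cmod (z - V \<theta>)))"

definition G :: "(real ^ 'd \<Rightarrow> complex) \<Rightarrow> complex \<Rightarrow> real" where
  "G V z = (LINT \<theta>:unit_cube|lborel. ln (cmod (z - V \<theta>)))"

definition P_set :: "(real ^ 'd \<Rightarrow> complex) \<Rightarrow> complex \<Rightarrow> complex set" where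
  "P_set V lam = {z. G V z = ln (cmod lam)}"

definition C_set :: "(real ^ 'd \<Rightarrow> complex) \<Rightarrow> complex \<Rightarrow> complex set" where
  "C_set V lam = {z. G V z > ln (cmod lam)} \<inter> range V"

definition S_set :: "(real ^ 'd \<Rightarrow> complex) \<Rightarrow> complex \<Rightarrow> complex set" where
  "S_set V lam = (if lam = 0 then range V else P_set V lam \<union> C_set V lam)"

definition ell2 :: "('n \<Rightarrow> complex) set" where
  "ell2 = {u. (\<lambda>n. (cmod (u n))\<^sup>2) summable_on UNIV}"

definition ell2_norm :: "('n \<Rightarrow> complex) \<Rightarrow> real" where
  "ell2_norm u = sqrt (\<Sum>\<^sub>\<infinity>n. (cmod (u n))\<^sup>2)"

text \<open>
  Linear operators on \<open>\<ell>\<^sup>2\<close> are represented by maps on all functions \<open>'n \<Rightarrow> complex\<close>, of which only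
  the restriction to \<^const>\<open>ell2\<close> matters.
\<close>

definition ell2_bounded_operator :: "(('n \<Rightarrow> complex) \<Rightarrow> ('n \<Rightarrow> complex)) \<Rightarrow> bool" where
  "ell2_bounded_operator A \<longleftrightarrow>
     (\<forall>u\<in>ell2. A u \<in> ell2) \<and>
     (\<forall>u\<in>ell2. \<forall>w\<in>ell2. A (\<lambda>n. u n + w n) = (\<lambda>n. A u n + A w n)) \<and>
     (\<forall>c. \<forall>u\<in>ell2. A (\<lambda>n. c * u n) = (\<lambda>n. c * A u n)) \<and>
     (\<exists>K. \<forall>u\<in>ell2. ell2_norm (A u) \<le> K * ell2_norm u)"

definition ell2_resolvent_set :: "(('n \<Rightarrow> complex) \<Rightarrow> ('n \<Rightarrow> complex)) \<Rightarrow> complex set" where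
  "ell2_resolvent_set A =
     {z. (\<forall>u\<in>ell2. (\<lambda>n. A u n - z * u n) \<in> ell2) \<and>
         (\<exists>R. ell2_bounded_operator R \<and>
              (\<forall>u\<in>ell2. R (\<lambda>n. A u n - z * u n) = u) \<and>
              (\<forall>u\<in>ell2. (\<lambda>n. A (R u) n - z * R u n) = u))}"

definition ell2_spectrum :: "(('n \<Rightarrow> complex) \<Rightarrow> ('n \<Rightarrow> complex)) \<Rightarrow> complex set" where
  "ell2_spectrum A = - ell2_resolvent_set A"

text \<open>
  For continuous \<open>V\<close> and \<open>u \<in> \<ell>\<^sup>2\<close> the convolution sum converges absolutely by Cauchy-Schwarz, the
  Fourier coefficients of \<open>V\<close> being square summable.
\<close>

definition H_op ::
  "(real ^ 'd \<Rightarrow> complex) \<Rightarrow> real ^ 'd \<Rightarrow> complex \<Rightarrow> real \<Rightarrow>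
     (int ^ 'd \<Rightarrow> complex) \<Rightarrow> (int ^ 'd \<Rightarrow> complex)" where
  "H_op V \<alpha> lam \<omega> u n =
     (\<Sum>\<^sub>\<infinity>k. fourier_coeff V k * u (n - k))
     + lam * exp (2 * of_real pi * \<i> * of_real (\<omega> + pairing n \<alpha>)) * u n"

end

theory Submission
  imports Defs
begin

text \<open>
  Fourier series identify \<open>\<ell>\<^sup>2(\<int>\<^sup>d)\<close> with \<open>L\<^sup>2\<close> of the torus. Convolution with the coefficients of
  \<open>V\<close> becomes multiplication by \<open>V\<close>, and multiplication by the phase \<open>exp(2\<pi>i\<langle>n, \<alpha>\<rangle>)\<close> becomes the
  translation by \<open>\<alpha>\<close>. With \<open>v = V - z\<close> and \<open>\<mu> = \<lambda> exp(2\<pi>i\<omega>)\<close>, the operator minus \<open>z\<close> is therefore the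
  weighted translation \<open>D F(\<theta>) = v(\<theta>) F(\<theta>) + \<mu> F(\<theta> + \<alpha>)\<close>, and the question is when it is invertible.
  The competition is between \<open>\<bar>\<mu>\<bar> = \<bar>\<lambda>\<bar>\<close> and the geometric mean \<open>exp (G z)\<close> of \<open>\<bar>v\<bar>\<close>.

  \<^bold>\<open>Resolvent set.\<close> If \<open>G z < log \<bar>\<lambda>\<bar>\<close>, factor out the translation; if \<open>G z > log \<bar>\<lambda>\<bar>\<close> and \<open>v\<close> has no
  zero, factor out the multiplication by \<open>v\<close>. What remains is the identity minus a weighted shift,
  whose \<open>m\<close>-th power is a unimodular phase times convolution with the product of \<open>m\<close> consecutive
  translates of the weight. The rotation by \<open>\<alpha>\<close> is uniquely ergodic, so the averages of the
  logarithm of a continuous majorant of the weight converge uniformly to its mean, which is negative.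
  The products thus decay exponentially (\<open>orbit_products_decay\<close>) and the Neumann series converges
  (\<open>weighted_shift_invertible\<close>). In the first case \<open>v\<close> may have zeros, and the majorant is
  \<open>log max(t, \<bar>v\<bar>) - log \<bar>\<lambda>\<bar>\<close>, whose mean tends to \<open>G z - log \<bar>\<lambda>\<bar>\<close> as \<open>t \<rightarrow> 0\<close>.

  \<^bold>\<open>Spectrum.\<close> If the operator is invertible, then \<open>D\<close> and its adjoint are bounded below on \<open>L\<^sup>2\<close>.
  Testing with sums of translates of one function, and averaging over its products with characters
  to make the translates orthogonal, transfers the bound to the sequence space over every single
  orbit of the rotation (\<open>orbit_lower_bound\<close>). There it fails, for one of two reasons.

  \<^item> On the critical curve \<open>G z = log \<bar>\<lambda>\<bar>\<close>, if \<open>v\<close> has no zero, the formal solution of \<open>D f = 0\<close> along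
    an orbit neither grows nor decays exponentially. Damping it by \<open>exp(- \<delta> \<bar>j - N\<bar>)\<close> with small \<open>\<delta>\<close>
    gives an approximate eigenvector (\<open>critical_orbit_contradiction\<close>).

  \<^item> If \<open>v(\<theta>\<^sub>0) = 0\<close>, the adjoint along the orbit of \<open>\<theta>\<^sub>0\<close> splits at \<open>\<theta>\<^sub>0\<close>, and the recursion for its kernel
    can be started there. The lower bound, which survives a small change of \<open>\<mu>\<close>, then bounds the
    products of \<open>\<bar>v\<bar>\<close> along the orbit by \<open>C r\<^sup>N\<close> for some \<open>r < \<bar>\<lambda>\<bar>\<close>; the orbit is equidistributed, so the
    bound holds everywhere (\<open>zero_of_symbol_imp_products_bounded\<close>), and taking the mean of the
    logarithm gives \<open>G z \<le> log r < log \<bar>\<lambda>\<bar>\<close> (\<open>products_bounded_imp_G_le\<close>).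
\<close>

section \<open>Square-summable functions and bounded operators\<close>

lemma L2_set_le_ell2_norm:
  assumes "u \<in> ell2" "finite A"
  shows "L2_set (\<lambda>n. cmod (u n)) A \<le> ell2_norm u"
  unfolding L2_set_def ell2_norm_def using assms
  by (intro real_sqrt_le_mono finite_sum_le_infsum) (auto simp: ell2_def)

text \<open>
  Everything about \<^const>\<open>ell2\<close> is reduced to the finite Euclidean norms \<^const>\<open>L2_set\<close>, of which
  \<^const>\<open>ell2_norm\<close> is the supremum.
\<close>

lemma
  assumes "\<And>A. finite A \<Longrightarrow> L2_set (\<lambda>n. cmod (u n)) A \<le> K"
  shows ell2I: "u \<in> ell2" and ell2_norm_le: "ell2_norm u \<le> K"
proof -
  have K: "K \<ge> 0" using assms[of "{}"] by simp
  have *: "(\<Sum>n\<in>A. (cmod (u n))\<^sup>2) \<le> K\<^sup>2" if "finite A" for A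
    using assms[OF that] K unfolding L2_set_def
    by (simp add: real_sqrt_le_iff' sqrt_le_D)
  have s: "(\<lambda>n. (cmod (u n))\<^sup>2) summable_on UNIV"
    by (rule nonneg_bdd_above_summable_on) (auto intro!: bdd_aboveI[of _ "K\<^sup>2"] *)
  then show "u \<in> ell2" by (simp add: ell2_def)
  have "(\<Sum>\<^sub>\<infinity>n. (cmod (u n))\<^sup>2) \<le> K\<^sup>2"
    by (rule infsum_le_finite_sums[OF s]) (auto intro: *)
  then show "ell2_norm u \<le> K"
    unfolding ell2_norm_def using K by (simp add: real_le_lsqrt)
qed

lemma ell2_norm_nonneg [simp]: "0 \<le> ell2_norm u"
  by (simp add: ell2_norm_def infsum_nonneg)

lemma ell2_zero [simp]: "(\<lambda>n. 0) \<in> ell2"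
  by (simp add: ell2_def)

lemma ell2_norm_zero [simp]: "ell2_norm (\<lambda>n. 0) = 0"
  by (simp add: ell2_norm_def)

lemma cmod_le_ell2_norm:
  assumes "u \<in> ell2" shows "cmod (u n) \<le> ell2_norm u"
  using L2_set_le_ell2_norm[OF assms, of "{n}"] by simp

lemma
  assumes "u \<in> ell2" "w \<in> ell2"
  shows ell2_add: "(\<lambda>n. u n + w n) \<in> ell2"
    and ell2_norm_triangle: "ell2_norm (\<lambda>n. u n + w n) \<le> ell2_norm u + ell2_norm w"
proof -
  have *: "L2_set (\<lambda>n. cmod (u n + w n)) A \<le> ell2_norm u + ell2_norm w" if "finite A" for A
  proof -
    have "L2_set (\<lambda>n. cmod (u n + w n)) A \<le> L2_set (\<lambda>n. cmod (u n) + cmod (w n)) A"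
      by (intro L2_set_mono) (auto intro: norm_triangle_ineq)
    also have "\<dots> \<le> L2_set (\<lambda>n. cmod (u n)) A + L2_set (\<lambda>n. cmod (w n)) A"
      by (rule L2_set_triangle_ineq)
    also have "\<dots> \<le> ell2_norm u + ell2_norm w"
      by (intro add_mono L2_set_le_ell2_norm assms that)
    finally show ?thesis .
  qed
  show "(\<lambda>n. u n + w n) \<in> ell2" by (rule ell2I) (rule *)
  show "ell2_norm (\<lambda>n. u n + w n) \<le> ell2_norm u + ell2_norm w" by (rule ell2_norm_le) (rule *)
qed

lemma ell2_norm_mult: "ell2_norm (\<lambda>n. c * u n) = cmod c * ell2_norm u"
  by (simp add: ell2_norm_def norm_mult power_mult_distrib infsum_cmult_right' real_sqrt_mult)

lemma ell2_mult: "u \<in> ell2 \<Longrightarrow> (\<lambda>n. c * u n) \<in> ell2"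
  unfolding ell2_def by (auto simp: norm_mult power_mult_distrib intro: summable_on_cmult_right)

lemma
  assumes "\<And>n. cmod (p n) = 1"
  shows ell2_phase_iff: "(\<lambda>n. p n * u n) \<in> ell2 \<longleftrightarrow> u \<in> ell2"
    and ell2_norm_phase: "ell2_norm (\<lambda>n. p n * u n) = ell2_norm u"
  using assms by (simp_all add: ell2_def ell2_norm_def norm_mult)

lemma ell2_diff:
  assumes "u \<in> ell2" "w \<in> ell2" shows "(\<lambda>n. u n - w n) \<in> ell2"
  using ell2_add[OF assms(1) ell2_mult[OF assms(2), of "-1"]] by simp

lemma ell2_norm_diff_commute: "ell2_norm (\<lambda>n. u n - w n) = ell2_norm (\<lambda>n. w n - u n)"
  by (simp add: ell2_norm_def norm_minus_commute)

lemma ell2_norm_triangle_diff: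
  assumes "u \<in> ell2" "w \<in> ell2"
  shows "ell2_norm u \<le> ell2_norm w + ell2_norm (\<lambda>n. u n - w n)"
  using ell2_norm_triangle[OF assms(2) ell2_diff[OF assms]] by simp

lemma
  assumes "\<And>k. k \<in> K \<Longrightarrow> f k \<in> ell2" "finite K"
  shows ell2_sum: "(\<lambda>n. \<Sum>k\<in>K. f k n) \<in> ell2"
    and ell2_norm_sum: "ell2_norm (\<lambda>n. \<Sum>k\<in>K. f k n) \<le> (\<Sum>k\<in>K. ell2_norm (f k))"
proof -
  have "(\<lambda>n. \<Sum>k\<in>K. f k n) \<in> ell2 \<and> ell2_norm (\<lambda>n. \<Sum>k\<in>K. f k n) \<le> (\<Sum>k\<in>K. ell2_norm (f k))"
    using assms(2,1)
  proof (induction K rule: finite_induct)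
    case (insert k K)
    then show ?case
      using ell2_add[of "f k" "\<lambda>n. \<Sum>k\<in>K. f k n"]
            ell2_norm_triangle[of "f k" "\<lambda>n. \<Sum>k\<in>K. f k n"] by force
  qed simp
  then show "(\<lambda>n. \<Sum>k\<in>K. f k n) \<in> ell2"
    "ell2_norm (\<lambda>n. \<Sum>k\<in>K. f k n) \<le> (\<Sum>k\<in>K. ell2_norm (f k))" by auto
qed

text \<open>Fatou's lemma for counting measure; it serves as the completeness of \<^const>\<open>ell2\<close>.\<close>

lemma
  fixes u :: "'n \<Rightarrow> complex"
  assumes "\<And>n. ((\<lambda>i. f i n) \<longlongrightarrow> u n) F" "F \<noteq> bot"
    and "\<And>i. f i \<in> ell2" "\<And>i. ell2_norm (f i) \<le> K"
  shows ell2_limit: "u \<in> ell2" and ell2_norm_limit: "ell2_norm u \<le> K"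
proof -
  have *: "L2_set (\<lambda>n. cmod (u n)) A \<le> K" if "finite A" for A
  proof (rule tendsto_upperbound[OF _ _ assms(2)])
    show "((\<lambda>i. L2_set (\<lambda>n. cmod (f i n)) A) \<longlongrightarrow> L2_set (\<lambda>n. cmod (u n)) A) F"
      unfolding L2_set_def by (intro tendsto_intros assms)
    show "\<forall>\<^sub>F i in F. L2_set (\<lambda>n. cmod (f i n)) A \<le> K"
      using L2_set_le_ell2_norm[OF assms(3) that] assms(4) order_trans by (blast intro: always_eventually)
  qed
  show "u \<in> ell2" by (rule ell2I) (rule *)
  show "ell2_norm u \<le> K" by (rule ell2_norm_le) (rule *)
qed

lemma ell2_prod_abs_summable:
  assumes "u \<in> ell2" "w \<in> ell2"
  shows "(\<lambda>n. cmod (u n * w n)) summable_on UNIV"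
proof -
  have "(\<Sum>n\<in>A. cmod (u n * w n)) \<le> ell2_norm u * ell2_norm w" if "finite A" for A
  proof -
    have "(\<Sum>n\<in>A. cmod (u n * w n)) = (\<Sum>n\<in>A. \<bar>cmod (u n)\<bar> * \<bar>cmod (w n)\<bar>)"
      by (simp add: norm_mult)
    also have "\<dots> \<le> L2_set (\<lambda>n. cmod (u n)) A * L2_set (\<lambda>n. cmod (w n)) A"
      by (rule L2_set_mult_ineq)
    also have "\<dots> \<le> ell2_norm u * ell2_norm w"
      by (intro mult_mono L2_set_le_ell2_norm assms that) auto
    finally show ?thesis .
  qed
  then show ?thesis
    by (intro nonneg_bdd_above_summable_on)
      (auto intro!: bdd_aboveI[of _ "ell2_norm u * ell2_norm w"])
qed

lemma
  assumes "ell2_bounded_operator B" "u \<in> ell2" 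
  shows ell2_op_closed: "B u \<in> ell2"
    and ell2_op_mult: "B (\<lambda>n. c * u n) = (\<lambda>n. c * B u n)"
    and ell2_op_add: "w \<in> ell2 \<Longrightarrow> B (\<lambda>n. u n + w n) = (\<lambda>n. B u n + B w n)"
  using assms unfolding ell2_bounded_operator_def by auto

lemma ell2_op_diff:
  assumes "ell2_bounded_operator B" "u \<in> ell2" "w \<in> ell2"
  shows "B (\<lambda>n. u n - w n) = (\<lambda>n. B u n - B w n)"
  using ell2_op_add[OF assms(1,2) ell2_mult[OF assms(3), of "-1"]] ell2_op_mult[OF assms(1,3), of "-1"]
  by simp

lemma ell2_op_bound:
  assumes "ell2_bounded_operator B"
  obtains K where "K > 0" "\<And>u. u \<in> ell2 \<Longrightarrow> ell2_norm (B u) \<le> K * ell2_norm u"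
proof -
  obtain K where K: "\<And>u. u \<in> ell2 \<Longrightarrow> ell2_norm (B u) \<le> K * ell2_norm u"
    using assms unfolding ell2_bounded_operator_def by blast
  have "ell2_norm (B u) \<le> (\<bar>K\<bar> + 1) * ell2_norm u" if "u \<in> ell2" for u
    using K[OF that] by (rule order_trans) (auto intro!: mult_right_mono)
  then show ?thesis using that[of "\<bar>K\<bar> + 1"] by auto
qed

lemma ell2_bounded_operator_compose:
  assumes "ell2_bounded_operator B" "ell2_bounded_operator C"
  shows "ell2_bounded_operator (\<lambda>u. B (C u))"
proof -
  obtain K where K: "K > 0" "\<And>u. u \<in> ell2 \<Longrightarrow> ell2_norm (B u) \<le> K * ell2_norm u"
    using ell2_op_bound[OF assms(1)] by blast
  obtain L where L: "L > 0" "\<And>u. u \<in> ell2 \<Longrightarrow> ell2_norm (C u) \<le> L * ell2_norm u"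
    using ell2_op_bound[OF assms(2)] by blast
  have "ell2_norm (B (C u)) \<le> (K * L) * ell2_norm u" if "u \<in> ell2" for u
  proof -
    have "ell2_norm (B (C u)) \<le> K * ell2_norm (C u)"
      by (intro K ell2_op_closed[OF assms(2)] that)
    also have "\<dots> \<le> K * (L * ell2_norm u)"
      using K L that by (intro mult_left_mono) auto
    finally show ?thesis by simp
  qed
  then show ?thesis
    using assms unfolding ell2_bounded_operator_def by (auto intro: exI[of _ "K * L"])
qed

definition ell2_invertible :: "(('n \<Rightarrow> complex) \<Rightarrow> ('n \<Rightarrow> complex)) \<Rightarrow> bool" where
  "ell2_invertible A \<longleftrightarrow> (\<forall>u\<in>ell2. A u \<in> ell2) \<and>
     (\<exists>R. ell2_bounded_operator R \<and> (\<forall>u\<in>ell2. R (A u) = u) \<and> (\<forall>u\<in>ell2. A (R u) = u))"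

lemma ell2_spectrum_iff:
  "z \<in> ell2_spectrum A \<longleftrightarrow> \<not> ell2_invertible (\<lambda>u n. A u n - z * u n)"
  by (simp add: ell2_spectrum_def ell2_resolvent_set_def ell2_invertible_def)

lemma ell2_invertible_compose:
  assumes "ell2_invertible A" "ell2_invertible B" "\<And>u. u \<in> ell2 \<Longrightarrow> C u = A (B u)"
  shows "ell2_invertible C"
proof -
  obtain R where R: "ell2_bounded_operator R" "\<forall>u\<in>ell2. R (A u) = u" "\<forall>u\<in>ell2. A (R u) = u"
    using assms(1) by (auto simp: ell2_invertible_def)
  obtain S where S: "ell2_bounded_operator S" "\<forall>u\<in>ell2. S (B u) = u" "\<forall>u\<in>ell2. B (S u) = u"
    using assms(2) by (auto simp: ell2_invertible_def)
  have cl: "A u \<in> ell2" "B u \<in> ell2" "R u \<in> ell2" "S u \<in> ell2" if "u \<in> ell2" for u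
    using assms(1,2) that R(1) S(1) ell2_op_closed by (auto simp: ell2_invertible_def)
  show ?thesis unfolding ell2_invertible_def
    using R S cl assms(3) ell2_bounded_operator_compose[OF S(1) R(1)]
    by (intro conjI ballI exI[of _ "\<lambda>u. S (R u)"]) auto
qed

lemma ell2_invertible_cong:
  assumes "\<And>u. u \<in> ell2 \<Longrightarrow> A u = C u"
  shows "ell2_invertible A \<longleftrightarrow> ell2_invertible C"
proof -
  have "ell2_invertible (\<lambda>u. u)"
    unfolding ell2_invertible_def ell2_bounded_operator_def
    by (intro conjI exI[of _ "\<lambda>u. u"]) (auto intro: ell2_add ell2_mult exI[of _ 1])
  from ell2_invertible_compose[OF _ this, of A C] ell2_invertible_compose[OF _ this, of C A] assms
  show ?thesis by metis
qed

lemma ell2_op_funpow_closed: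
  "ell2_bounded_operator B \<Longrightarrow> u \<in> ell2 \<Longrightarrow> (B ^^ k) u \<in> ell2"
  by (induction k) (auto intro: ell2_op_closed)

lemma ell2_op_funpow_linear:
  assumes "ell2_bounded_operator B" "u \<in> ell2" "w \<in> ell2"
  shows "(B ^^ k) (\<lambda>n. u n + w n) = (\<lambda>n. (B ^^ k) u n + (B ^^ k) w n)"
    and "(B ^^ k) (\<lambda>n. c * u n) = (\<lambda>n. c * (B ^^ k) u n)"
  using assms
  by (induction k) (simp_all add: ell2_op_add ell2_op_mult ell2_op_funpow_closed)

lemma ell2_op_sum:
  assumes "ell2_bounded_operator B" "\<And>k. k \<in> K \<Longrightarrow> f k \<in> ell2" "finite K"
  shows "B (\<lambda>n. \<Sum>k\<in>K. f k n) = (\<lambda>n. \<Sum>k\<in>K. B (f k) n)"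
  using assms(3,2)
proof (induction K rule: finite_induct)
  case empty
  then show ?case using ell2_op_mult[OF assms(1) ell2_zero, of 0] by simp
next
  case (insert k K)
  then show ?case
    using ell2_op_add[OF assms(1), of "f k" "\<lambda>n. \<Sum>k\<in>K. f k n"] by (simp add: ell2_sum)
qed

text \<open>
  The Neumann series. Only the summability of the norms of the powers is asked for, since the
  weighted shifts below have spectral radius less than 1 without being contractions.
\<close>

lemma ell2_Neumann_series:
  assumes B: "ell2_bounded_operator B"
    and b: "\<And>k u. u \<in> ell2 \<Longrightarrow> ell2_norm ((B ^^ k) u) \<le> b k * ell2_norm u"
    and "summable b" and b0: "\<And>k. 0 \<le> b k"
  shows "ell2_invertible (\<lambda>u n. u n - B u n)"
proof -
  define R where "R u = (\<lambda>n. \<Sum>k. (B ^^ k) u n)" for u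
  define s where "s N u = (\<lambda>n. \<Sum>k<N. (B ^^ k) u n)" for N u
  note cl = ell2_op_funpow_closed[OF B]
  have sm: "summable (\<lambda>k. (B ^^ k) u n)" if "u \<in> ell2" for u n
  proof (rule summable_comparison_test)
    show "\<exists>N. \<forall>k\<ge>N. cmod ((B ^^ k) u n) \<le> b k * ell2_norm u"
      using cmod_le_ell2_norm[OF cl[OF that]] b[OF that] order_trans by blast
    show "summable (\<lambda>k. b k * ell2_norm u)" using \<open>summable b\<close> by (rule summable_mult2)
  qed
  have lim: "(\<lambda>N. s N u n) \<longlonglongrightarrow> R u n" if "u \<in> ell2" for u n
    unfolding s_def R_def using summable_LIMSEQ[OF sm[OF that]] .
  have scl: "s N u \<in> ell2" if "u \<in> ell2" for N u
    unfolding s_def by (intro ell2_sum cl that) auto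
  have tail: "ell2_norm (\<lambda>n. s (M + N) u n - s N u n) \<le> (suminf b - sum b {..<N}) * ell2_norm u"
    if u: "u \<in> ell2" for M N u
  proof -
    have eq: "s (M + N) u n - s N u n = (\<Sum>k\<in>{N..<M + N}. (B ^^ k) u n)" for n
    proof -
      have "{..<M + N} - {..<N} = {N..<M + N}" by auto
      then show ?thesis unfolding s_def
        by (metis (no_types, lifting) finite_lessThan le_add2 lessThan_subset_iff sum_diff)
    qed
    have "ell2_norm (\<lambda>n. s (M + N) u n - s N u n) \<le> (\<Sum>k\<in>{N..<M + N}. ell2_norm ((B ^^ k) u))"
      unfolding eq by (intro ell2_norm_sum cl u) auto
    also have "\<dots> \<le> (\<Sum>k\<in>{N..<M + N}. b k) * ell2_norm u"
      unfolding sum_distrib_right by (intro sum_mono b u)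
    also have "(\<Sum>k\<in>{N..<M + N}. b k) = sum b {..<M + N} - sum b {..<N}"
    proof -
      have "{..<M + N} - {..<N} = {N..<M + N}" by auto
      then show ?thesis by (metis finite_lessThan le_add2 lessThan_subset_iff sum_diff)
    qed
    also have "(\<dots>) * ell2_norm u \<le> (suminf b - sum b {..<N}) * ell2_norm u"
      using sum_le_suminf[OF \<open>summable b\<close>, of "{..<M + N}"] b0 by (intro mult_right_mono) auto
    finally show ?thesis .
  qed
  \<comment> \<open>The series converges pointwise; \<open>ell2_limit\<close> upgrades this to convergence in norm.\<close>
  have tail_cl: "(\<lambda>n. R u n - s N u n) \<in> ell2"
    and tail_le: "ell2_norm (\<lambda>n. R u n - s N u n) \<le> (suminf b - sum b {..<N}) * ell2_norm u"
    if u: "u \<in> ell2" for N u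
  proof -
    have l: "(\<lambda>M. s (M + N) u n - s N u n) \<longlonglongrightarrow> R u n - s N u n" for n
      by (intro tendsto_intros LIMSEQ_ignore_initial_segment lim u)
    show "(\<lambda>n. R u n - s N u n) \<in> ell2"
      by (rule ell2_limit[OF l _ _ tail[OF u]]) (auto intro!: ell2_diff scl u)
    show "ell2_norm (\<lambda>n. R u n - s N u n) \<le> (suminf b - sum b {..<N}) * ell2_norm u"
      by (rule ell2_norm_limit[OF l _ _ tail[OF u]]) (auto intro!: ell2_diff scl u)
  qed
  have s0: "s 0 u = (\<lambda>n. 0)" for u by (simp add: s_def)
  have Rcl: "R u \<in> ell2" and Rle: "ell2_norm (R u) \<le> suminf b * ell2_norm u" if "u \<in> ell2" for u
    using tail_cl[OF that, of 0] tail_le[OF that, of 0] by (simp_all add: s0)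
  have Rop: "ell2_bounded_operator R"
    unfolding ell2_bounded_operator_def
  proof (intro conjI ballI allI)
    show "\<exists>K. \<forall>u\<in>ell2. ell2_norm (R u) \<le> K * ell2_norm u" using Rle by auto
    show "R (\<lambda>n. u n + w n) = (\<lambda>n. R u n + R w n)" if "u \<in> ell2" "w \<in> ell2" for u w
      unfolding R_def ell2_op_funpow_linear[OF B that] using that
      by (intro ext suminf_add[symmetric] sm)
    show "R (\<lambda>n. c * u n) = (\<lambda>n. c * R u n)" if "u \<in> ell2" for u c
      unfolding R_def ell2_op_funpow_linear(2)[OF B that that] using that
      by (intro ext suminf_mult sm)
  qed (rule Rcl)
  obtain K where K: "K > 0" "\<And>u. u \<in> ell2 \<Longrightarrow> ell2_norm (B u) \<le> K * ell2_norm u"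
    using ell2_op_bound[OF B] by blast
  have shift: "(\<lambda>N. \<Sum>k<N. (B ^^ Suc k) u n) \<longlonglongrightarrow> R u n - u n" if u: "u \<in> ell2" for u n
  proof -
    have "(\<lambda>N. s (Suc N) u n - u n) \<longlonglongrightarrow> R u n - u n"
      by (intro tendsto_intros LIMSEQ_Suc lim u)
    moreover have "s (Suc N) u n - u n = (\<Sum>k<N. (B ^^ Suc k) u n)" for N
      unfolding s_def sum.lessThan_Suc_shift by simp
    ultimately show ?thesis by simp
  qed
  have BR: "B (R u) n = R u n - u n" if u: "u \<in> ell2" for u n
  proof -
    have eq: "(\<Sum>k<N. (B ^^ Suc k) u n) = B (s N u) n" for N
      unfolding s_def by (subst ell2_op_sum[OF B cl[OF u]]) auto
    have "(\<lambda>N. B (R u) n - B (s N u) n) \<longlonglongrightarrow> 0"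
    proof (rule Lim_null_comparison[OF always_eventually])
      show "\<forall>N. cmod (B (R u) n - B (s N u) n) \<le> K * ((suminf b - sum b {..<N}) * ell2_norm u)"
      proof
        fix N
        have "cmod (B (R u) n - B (s N u) n) = cmod (B (\<lambda>n. R u n - s N u n) n)"
          by (subst ell2_op_diff[OF B Rcl[OF u] scl[OF u]]) simp
        also have "\<dots> \<le> ell2_norm (B (\<lambda>n. R u n - s N u n))"
          by (intro cmod_le_ell2_norm ell2_op_closed[OF B] tail_cl u)
        also have "\<dots> \<le> K * ell2_norm (\<lambda>n. R u n - s N u n)" by (intro K tail_cl u)
        also have "\<dots> \<le> K * ((suminf b - sum b {..<N}) * ell2_norm u)"
          using K(1) by (intro mult_left_mono tail_le u) auto
        finally show "cmod (B (R u) n - B (s N u) n) \<le> K * ((suminf b - sum b {..<N}) * ell2_norm u)" .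
      qed
      have "(\<lambda>N. K * ((suminf b - sum b {..<N}) * ell2_norm u)) \<longlonglongrightarrow> K * ((suminf b - suminf b) * ell2_norm u)"
        by (intro tendsto_intros summable_LIMSEQ \<open>summable b\<close>)
      then show "(\<lambda>N. K * ((suminf b - sum b {..<N}) * ell2_norm u)) \<longlonglongrightarrow> 0" by simp
    qed
    from tendsto_diff[OF tendsto_const this, of "B (R u) n"]
    have "(\<lambda>N. B (s N u) n) \<longlonglongrightarrow> B (R u) n" by simp
    from LIMSEQ_unique[OF this shift[OF u, of n, unfolded eq]] show ?thesis .
  qed
  have RB: "R (\<lambda>n. u n - B u n) = u" if u: "u \<in> ell2" for u
  proof
    fix n
    have "(\<lambda>N. s N (B u) n) \<longlonglongrightarrow> R u n - u n"
      using shift[OF u] unfolding s_def by (simp add: funpow_swap1)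
    then have "R (B u) n = R u n - u n"
      using LIMSEQ_unique[OF lim[OF ell2_op_closed[OF B u]]] by blast
    then show "R (\<lambda>n. u n - B u n) n = u n"
      by (subst ell2_op_diff[OF Rop u ell2_op_closed[OF B u]]) simp
  qed
  show ?thesis
    unfolding ell2_invertible_def
    using Rop RB by (intro conjI ballI exI[of _ R]) (auto simp: BR ell2_diff ell2_op_closed[OF B])
qed

section \<open>Continuous functions on the torus\<close>

definition torus_char :: "int ^ 'd \<Rightarrow> real ^ 'd \<Rightarrow> complex" where
  "torus_char k \<theta> = exp (2 * of_real pi * \<i> * of_real (pairing k \<theta>))"

text \<open>
  The codomain is arbitrary because real weights, complex symbols and the embedding of the torus
  into \<open>\<complex>\<^sup>d\<close> are all treated in this form.
\<close>

definition torus_continuous :: "(real ^ 'd \<Rightarrow> 'b::topological_space) \<Rightarrow> bool" where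
  "torus_continuous F \<longleftrightarrow> torus_periodic F \<and> continuous_on UNIV F"

definition torus_int :: "(real ^ 'd \<Rightarrow> 'b::{banach, second_countable_topology}) \<Rightarrow> 'b" where
  "torus_int F = (LINT \<theta>:unit_cube|lborel. F \<theta>)"

lemma pairing_add_left: "pairing (k + l) \<theta> = pairing k \<theta> + pairing l \<theta>"
  and pairing_add_right: "pairing k (\<theta> + \<beta>) = pairing k \<theta> + pairing k \<beta>"
  and pairing_uminus_left: "pairing (- k) \<theta> = - pairing k \<theta>"
  and pairing_uminus_right: "pairing k (- \<theta>) = - pairing k \<theta>"
  and pairing_zero_left [simp]: "pairing 0 \<theta> = 0"
  and pairing_zero_right [simp]: "pairing k 0 = 0"
  and pairing_scaleR_right: "pairing k (r *\<^sub>R \<theta>) = r * pairing k \<theta>"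
  by (simp_all add: pairing_def algebra_simps sum.distrib sum_negf sum_distrib_left)

lemma pairing_int: "pairing k (\<chi> i. of_int (m $ i)) = of_int (\<Sum>i\<in>UNIV. k $ i * m $ i)"
  by (simp add: pairing_def)

lemma torus_char_add_left: "torus_char (k + l) \<theta> = torus_char k \<theta> * torus_char l \<theta>"
  and torus_char_add_right: "torus_char k (\<theta> + \<beta>) = torus_char k \<theta> * torus_char k \<beta>"
  and torus_char_zero_left [simp]: "torus_char 0 \<theta> = 1"
  and torus_char_zero_right [simp]: "torus_char k 0 = 1"
  by (simp_all add: torus_char_def pairing_add_left pairing_add_right exp_add [symmetric] algebra_simps)

lemma norm_torus_char [simp]: "cmod (torus_char k \<theta>) = 1"
  unfolding torus_char_def by (simp add: norm_exp_eq_Re)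

lemma torus_char_nonzero [simp]: "torus_char k \<theta> \<noteq> 0"
  by (simp add: torus_char_def)

lemma cnj_torus_char: "cnj (torus_char k \<theta>) = torus_char (- k) \<theta>"
  unfolding torus_char_def by (simp add: exp_cnj pairing_uminus_left)

lemma torus_char_uminus_right: "torus_char k (- \<theta>) = torus_char (- k) \<theta>"
  unfolding torus_char_def by (simp add: pairing_uminus_left pairing_uminus_right)

lemma torus_char_uminus_left: "torus_char (- k) \<theta> = inverse (torus_char k \<theta>)"
  unfolding torus_char_def by (simp add: pairing_uminus_left exp_minus)

lemma torus_char_eq_1_iff: "torus_char k \<theta> = 1 \<longleftrightarrow> pairing k \<theta> \<in> \<int>"
proof -
  have "torus_char k \<theta> = 1 \<longleftrightarrow> (\<exists>n::int. 2 * pi * pairing k \<theta> = of_int (2 * n) * pi)"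
    unfolding torus_char_def exp_eq_1 by simp
  also have "\<dots> \<longleftrightarrow> (\<exists>n::int. pairing k \<theta> = of_int n)" by simp
  finally show ?thesis by (auto elim: Ints_cases)
qed

lemma torus_continuous_char [simp]:
  fixes k :: "int ^ 'd" shows "torus_continuous (torus_char k)"
proof -
  have "torus_char k (\<chi> i. of_int (m $ i)) = 1" for m :: "int ^ 'd"
    by (simp add: torus_char_eq_1_iff pairing_int del: of_int_sum of_int_mult)
  moreover have "continuous_on UNIV (torus_char k)"
    unfolding torus_char_def pairing_def by (intro continuous_intros)
  ultimately show ?thesis
    by (simp add: torus_continuous_def torus_periodic_def torus_char_add_right)
qed

lemma torus_continuousD: "torus_continuous F \<Longrightarrow> continuous_on UNIV F"
  by (simp add: torus_continuous_def)

lemma torus_continuous_periodic: "torus_continuous F \<Longrightarrow> torus_periodic F"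
  by (simp add: torus_continuous_def)

lemma torus_continuous_const [simp]: "torus_continuous (\<lambda>\<theta>. c)"
  by (simp add: torus_continuous_def torus_periodic_def)

lemma torus_continuous_compose:
  assumes "torus_continuous F" "continuous_on (range F) g"
  shows "torus_continuous (\<lambda>\<theta>. g (F \<theta>))"
  using assms continuous_on_compose2[OF assms(2), of UNIV F]
  unfolding torus_continuous_def torus_periodic_def by auto

lemma torus_continuous_shift:
  fixes F :: "real ^ 'd \<Rightarrow> 'b::topological_space"
  assumes "torus_continuous F" shows "torus_continuous (\<lambda>\<theta>. F (\<theta> + \<beta>))"
  unfolding torus_continuous_def torus_periodic_def
proof (intro conjI allI)
  show "F (\<theta> + (\<chi> i. of_int (k $ i)) + \<beta>) = F (\<theta> + \<beta>)" for \<theta> and k :: "int ^ 'd"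
    using assms unfolding torus_continuous_def torus_periodic_def
    by (simp only: add.assoc add.commute[of "\<chi> i. of_int (k $ i)" \<beta>]) (simp only: add.assoc[symmetric])
  show "continuous_on UNIV (\<lambda>\<theta>. F (\<theta> + \<beta>))"
    by (rule continuous_on_compose2[OF torus_continuousD[OF assms]]) (auto intro!: continuous_intros)
qed

named_theorems torus_continuous_intros
lemmas [torus_continuous_intros] = torus_continuous_const torus_continuous_char torus_continuous_shift

lemma torus_continuous_arith [torus_continuous_intros]:
  fixes F H :: "real ^ 'd \<Rightarrow> 'b::real_normed_algebra"
  assumes "torus_continuous F" "torus_continuous H"
  shows "torus_continuous (\<lambda>\<theta>. F \<theta> + H \<theta>)" "torus_continuous (\<lambda>\<theta>. F \<theta> - H \<theta>)"
    "torus_continuous (\<lambda>\<theta>. F \<theta> * H \<theta>)"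
  using assms by (auto simp: torus_continuous_def torus_periodic_def intro!: continuous_intros)

lemma torus_continuous_misc [torus_continuous_intros]:
  shows "torus_continuous F \<Longrightarrow> torus_continuous (\<lambda>\<theta>. cmod (F \<theta>))"
    "torus_continuous F \<Longrightarrow> torus_continuous (\<lambda>\<theta>. cnj (F \<theta>))"
    "torus_continuous h \<Longrightarrow> torus_continuous (\<lambda>\<theta>. (h \<theta> :: real) ^ n)"
    "torus_continuous h \<Longrightarrow> torus_continuous (\<lambda>\<theta>. complex_of_real (h \<theta>))"
    "torus_continuous h \<Longrightarrow> torus_continuous (\<lambda>\<theta>. max c (h \<theta>))"
  by (auto simp: torus_continuous_def torus_periodic_def intro!: continuous_intros)

lemma torus_continuous_sum_prod [torus_continuous_intros]:
  fixes F :: "'i \<Rightarrow> real ^ 'd \<Rightarrow> 'b::real_normed_field"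
  assumes "\<And>i. i \<in> A \<Longrightarrow> torus_continuous (F i)"
  shows "torus_continuous (\<lambda>\<theta>. \<Sum>i\<in>A. F i \<theta>)" "torus_continuous (\<lambda>\<theta>. \<Prod>i\<in>A. F i \<theta>)"
  using assms by (auto simp: torus_continuous_def torus_periodic_def intro!: continuous_intros)

lemma torus_continuous_ln [torus_continuous_intros]:
  assumes "torus_continuous h" "\<And>\<theta>. 0 < h \<theta>"
  shows "torus_continuous (\<lambda>\<theta>. ln (h \<theta> :: real))"
  using assms by (auto simp: torus_continuous_def torus_periodic_def less_imp_neq intro!: continuous_intros)
     (metis less_irrefl)

lemma torus_continuous_divide [torus_continuous_intros]:
  assumes "torus_continuous F" "torus_continuous H" "\<And>\<theta>. H \<theta> \<noteq> (0 :: complex)"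
  shows "torus_continuous (\<lambda>\<theta>. F \<theta> / H \<theta>)"
  using assms by (auto simp: torus_continuous_def torus_periodic_def intro!: continuous_intros)

lemma torus_periodic_fundamental_domain:
  assumes "torus_periodic F"
  obtains \<theta>' where "\<theta>' \<in> unit_cube" "F \<theta>' = F \<theta>"
proof
  let ?\<theta>' = "\<theta> + (\<chi> i. of_int ((\<chi> i. - \<lfloor>\<theta> $ i\<rfloor>) $ i))"
  show "F ?\<theta>' = F \<theta>" using assms unfolding torus_periodic_def by blast
  show "?\<theta>' \<in> unit_cube"
    unfolding unit_cube_def mem_box_cart by (auto simp: le_diff_eq) linarith
qed

lemma torus_continuous_bounded:
  fixes F :: "real ^ 'd \<Rightarrow> 'b::real_normed_vector"
  assumes "torus_continuous F"
  obtains B where "B > 0" "\<And>\<theta>. norm (F \<theta>) \<le> B"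
proof -
  have "compact (F ` unit_cube)"
    using assms unfolding torus_continuous_def unit_cube_def
    by (intro compact_continuous_image) (auto intro: continuous_on_subset)
  then obtain B where "B > 0" and B: "\<And>x. x \<in> F ` unit_cube \<Longrightarrow> norm x \<le> B"
    using compact_imp_bounded[of "F ` unit_cube"] unfolding bounded_pos by auto
  have "norm (F \<theta>) \<le> B" for \<theta>
  proof -
    obtain \<theta>' where "\<theta>' \<in> unit_cube" "F \<theta>' = F \<theta>"
      by (rule torus_periodic_fundamental_domain[OF torus_continuous_periodic[OF assms]])
    then show ?thesis using B[OF imageI] by metis
  qed
  then show ?thesis using that \<open>B > 0\<close> by blast
qed

lemma measure_unit_cube: "measure lborel (unit_cube :: (real ^ 'd) set) = 1"
  and emeasure_unit_cube: "emeasure lborel (unit_cube :: (real ^ 'd) set) = 1"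
proof -
  have "(\<Prod>b\<in>Basis. (1 - 0 :: real ^ 'd) \<bullet> b) = 1"
    by (intro prod.neutral) (auto simp: Basis_vec_def inner_axis)
  moreover have "(0 :: real ^ 'd) \<bullet> b \<le> 1 \<bullet> b" if "b \<in> Basis" for b
    using that by (auto simp: Basis_vec_def inner_axis)
  ultimately show "emeasure lborel (unit_cube :: (real ^ 'd) set) = 1"
    unfolding unit_cube_def by (subst emeasure_lborel_cbox) auto
  then show "measure lborel (unit_cube :: (real ^ 'd) set) = 1"
    by (simp add: measure_def)
qed

lemma unit_cube_sets [simp, measurable]: "unit_cube \<in> sets lborel" "unit_cube \<in> sets borel"
  by (auto simp: unit_cube_def)

lemma torus_integrable:
  fixes F :: "real ^ 'd \<Rightarrow> 'b::{banach, second_countable_topology}"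
  assumes "torus_continuous F" shows "set_integrable lborel unit_cube F"
  unfolding set_integrable_def unit_cube_def
  using borel_integrable_compact[of "cbox 0 1" F] continuous_on_subset[OF torus_continuousD[OF assms]]
  by auto

lemma torus_int_const: "torus_int (\<lambda>\<theta> :: real ^ 'd. c) = c"
  unfolding torus_int_def set_lebesgue_integral_def by (simp add: measure_unit_cube emeasure_unit_cube)

lemma torus_int_add:
  fixes F H :: "real ^ 'd \<Rightarrow> 'b::{banach, second_countable_topology}"
  assumes "torus_continuous F" "torus_continuous H"
  shows "torus_int (\<lambda>\<theta>. F \<theta> + H \<theta>) = torus_int F + torus_int H"
    and "torus_int (\<lambda>\<theta>. F \<theta> - H \<theta>) = torus_int F - torus_int H"
  unfolding torus_int_def using assms torus_integrable
  by (auto intro!: set_integral_add set_integral_diff)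

lemma torus_int_mult:
  fixes F :: "real ^ 'd \<Rightarrow> 'b::{real_normed_field, banach, second_countable_topology}"
  shows "torus_int (\<lambda>\<theta>. c * F \<theta>) = c * torus_int F"
  unfolding torus_int_def by simp

lemma torus_int_sum:
  fixes F :: "'i \<Rightarrow> real ^ 'd \<Rightarrow> 'b::{real_normed_field, banach, second_countable_topology}"
  assumes "\<And>i. i \<in> A \<Longrightarrow> torus_continuous (F i)"
  shows "torus_int (\<lambda>\<theta>. \<Sum>i\<in>A. F i \<theta>) = (\<Sum>i\<in>A. torus_int (F i))"
  using assms
proof (induction A rule: infinite_finite_induct)
  case (insert i A)
  then show ?case by (simp add: torus_int_add torus_continuous_intros)
qed (simp_all add: torus_int_const)

lemma torus_int_Re:
  assumes "torus_continuous F"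
  shows "torus_int (\<lambda>\<theta>. Re (F \<theta>)) = Re (torus_int F)"
  using torus_integrable[OF assms]
  unfolding torus_int_def set_lebesgue_integral_def set_integrable_def
  by (subst integral_Re[symmetric]) auto

lemma torus_int_of_real: "torus_int (\<lambda>\<theta>. complex_of_real (f \<theta>)) = complex_of_real (torus_int f)"
  unfolding torus_int_def by (rule set_integral_complex_of_real)

lemma torus_int_mono:
  fixes f g :: "real ^ 'd \<Rightarrow> real"
  assumes "torus_continuous f" "torus_continuous g" "\<And>\<theta>. f \<theta> \<le> g \<theta>"
  shows "torus_int f \<le> torus_int g"
  unfolding torus_int_def using assms by (intro set_integral_mono torus_integrable)

lemma norm_torus_int_le:
  fixes F :: "real ^ 'd \<Rightarrow> complex"
  assumes "torus_continuous F" "\<And>\<theta>. cmod (F \<theta>) \<le> B"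
  shows "cmod (torus_int F) \<le> B"
proof -
  have "cmod (torus_int F) \<le> torus_int (\<lambda>\<theta>. cmod (F \<theta>))"
    unfolding torus_int_def using torus_integrable[OF assms(1)] by (rule set_integral_norm_bound)
  also have "\<dots> \<le> torus_int (\<lambda>\<theta> :: real ^ 'd. B)"
    using assms by (intro torus_int_mono torus_continuous_intros) auto
  finally show ?thesis by (simp add: torus_int_const)
qed

lemma torus_int_zero_imp_zero:
  fixes f :: "real ^ 'd \<Rightarrow> real"
  assumes "torus_continuous f" "\<And>\<theta>. 0 \<le> f \<theta>" "torus_int f \<le> 0"
  shows "f \<theta> = 0"
proof -
  obtain \<theta>' where \<theta>': "\<theta>' \<in> unit_cube" "f \<theta>' = f \<theta>"
    by (rule torus_periodic_fundamental_domain[OF torus_continuous_periodic[OF assms(1)]])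
  have "torus_int f = 0"
    using torus_int_mono[OF _ assms(1), of "\<lambda>_. 0"] assms(2,3) by (simp add: torus_int_const)
  then have "(f has_integral 0) (cbox 0 1)"
    using set_borel_integral_eq_integral[OF torus_integrable[OF assms(1)]]
    unfolding torus_int_def unit_cube_def by (metis has_integral_integrable_integral)
  moreover have "(1/2) *\<^sub>R (1 :: real ^ 'd) \<in> box 0 1"
    by (auto simp: mem_box_cart)
  ultimately have "f \<theta>' = 0"
    using \<theta>'(1) assms(1,2) unfolding unit_cube_def
    by (intro has_integral_0_cbox_imp_0[of 0 1 f])
       (auto simp: continuous_on_subset[OF torus_continuousD])
  then show ?thesis using \<theta>'(2) by simp
qed

section \<open>Orthogonality of the characters\<close>

lemma integral_lborel_prod:
  fixes f :: "'a::euclidean_space \<Rightarrow> real \<Rightarrow> complex"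
  assumes "\<And>b. b \<in> Basis \<Longrightarrow> integrable lborel (f b)"
  shows "(\<integral>x. (\<Prod>b\<in>Basis. f b (x \<bullet> b)) \<partial>lborel) = (\<Prod>b\<in>Basis. (\<integral>x. f b x \<partial>lborel))"
proof -
  interpret product_sigma_finite "\<lambda>b :: 'a. lborel :: real measure" ..
  have [measurable]: "f b \<in> borel_measurable borel" if "b \<in> Basis" for b
    using borel_measurable_integrable[OF assms[OF that]] by simp
  have [measurable]: "(\<lambda>x. f b (x \<bullet> b)) \<in> borel_measurable (borel :: 'a measure)" if "b \<in> Basis" for b
    using that by measurable
  have "(\<integral>x. (\<Prod>b\<in>Basis. f b (x \<bullet> b)) \<partial>(lborel :: 'a measure))
      = (\<integral>x. (\<Prod>b\<in>Basis. f b ((\<Sum>b\<in>Basis. x b *\<^sub>R b) \<bullet> b)) \<partial>(\<Pi>\<^sub>M b\<in>Basis. lborel))"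
    by (subst lborel_eq) (subst integral_distr; simp)
  also have "\<dots> = (\<integral>x. (\<Prod>b\<in>Basis. f b (x b)) \<partial>(\<Pi>\<^sub>M b\<in>(Basis :: 'a set). lborel))"
    by (intro Bochner_Integration.integral_cong prod.cong) (auto simp: inner_sum_left_Basis)
  also have "\<dots> = (\<Prod>b\<in>Basis. (\<integral>x. f b x \<partial>lborel))"
    by (rule product_integral_prod) (use assms in auto)
  finally show ?thesis .
qed

lemma integral_exp_unit_interval:
  assumes "m \<noteq> 0"
  shows "(\<integral>t. indicator {0..1} t *\<^sub>R exp (2 * of_real pi * \<i> * of_real (of_int m * t)) \<partial>lborel) = 0"
proof -
  define c where "c = 2 * of_real pi * \<i> * of_int m"
  have "c \<noteq> 0" using assms by (simp add: c_def)
  have d: "((\<lambda>t. exp (c * of_real t) / c) has_vector_derivative exp (c * of_real t)) (at t within {0..1})" for t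
  proof -
    have "((\<lambda>z. exp (c * z) / c) has_field_derivative exp (c * of_real t)) (at (of_real t))"
      using \<open>c \<noteq> 0\<close> by (auto intro!: derivative_eq_intros)
    from has_vector_derivative_real_field[OF this] show ?thesis
      by (rule has_vector_derivative_at_within)
  qed
  have "(\<integral>t. indicator {0..1} t *\<^sub>R exp (c * of_real t) \<partial>lborel) = exp (c * of_real 1) / c - exp (c * of_real 0) / c"
    by (rule integral_FTC_Icc[OF _ d]) (auto intro!: continuous_intros)
  also have "exp (c * of_real 1) = 1"
    unfolding c_def by (simp add: exp_eq_1)
  finally show ?thesis by (simp add: c_def mult.assoc)
qed

lemma torus_int_char:
  fixes k :: "int ^ 'd"
  shows "torus_int (torus_char k) = (if k = 0 then 1 else 0)"
proof (cases "k = 0")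
  case True
  then show ?thesis using torus_int_const[of "1::complex"]
    by (simp add: torus_char_zero_left[abs_def])
next
  case False
  define K :: "real ^ 'd" where "K = (\<chi> i. of_int (k $ i))"
  define h where "h b t = indicator {0..1} t *\<^sub>R exp (2 * of_real pi * \<i> * of_real ((K \<bullet> b) * t))"
    for b and t :: real
  have "pairing k \<theta> = (\<Sum>b\<in>Basis. (K \<bullet> b) * (\<theta> \<bullet> b))" for \<theta>
    by (subst euclidean_inner[symmetric]) (simp add: inner_vec_def K_def pairing_def)
  then have char: "torus_char k \<theta> = (\<Prod>b\<in>Basis. exp (2 * of_real pi * \<i> * of_real ((K \<bullet> b) * (\<theta> \<bullet> b))))" for \<theta>
    unfolding torus_char_def by (simp add: sum_distrib_left exp_sum)
  have ind: "indicator unit_cube \<theta> = (\<Prod>b\<in>Basis. indicator {0..1} (\<theta> \<bullet> b) :: real)" for \<theta> :: "real ^ 'd"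
  proof -
    have "\<theta> \<in> unit_cube \<longleftrightarrow> (\<forall>b\<in>Basis. \<theta> \<bullet> b \<in> {0..1})"
      unfolding unit_cube_def mem_box by (auto simp: Basis_vec_def inner_axis)
    then show ?thesis by (auto simp: indicator_def prod.neutral)
  qed
  have "indicator unit_cube \<theta> *\<^sub>R torus_char k \<theta> = (\<Prod>b\<in>Basis. h b (\<theta> \<bullet> b))" for \<theta>
    unfolding h_def char ind scaleR_conv_of_real prod.distrib of_real_prod ..
  then have "torus_int (torus_char k) = (\<Prod>b\<in>Basis. \<integral>t. h b t \<partial>lborel)"
    unfolding torus_int_def set_lebesgue_integral_def
    by simp (rule integral_lborel_prod, unfold h_def, rule borel_integrable_compact, auto intro!: continuous_intros)
  also have "\<dots> = 0"
  proof -
    obtain i where i: "k $ i \<noteq> 0" using False by (auto simp: vec_eq_iff)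
    have "(\<integral>t. h (axis i 1) t \<partial>lborel) = 0"
      using integral_exp_unit_interval[OF i] by (simp add: h_def K_def inner_axis)
    moreover have "axis i 1 \<in> (Basis :: (real ^ 'd) set)" by (auto simp: Basis_vec_def)
    ultimately show ?thesis by (auto simp: prod_zero_iff)
  qed
  finally show ?thesis using False by simp
qed

inductive trig_poly :: "(real ^ 'd \<Rightarrow> complex) \<Rightarrow> bool" where
  char: "trig_poly (torus_char k)"
| scale: "trig_poly P \<Longrightarrow> trig_poly (\<lambda>\<theta>. c * P \<theta>)"
| add: "trig_poly P \<Longrightarrow> trig_poly Q \<Longrightarrow> trig_poly (\<lambda>\<theta>. P \<theta> + Q \<theta>)"

lemma trig_poly_continuous: "trig_poly P \<Longrightarrow> torus_continuous P"
  by (induction rule: trig_poly.induct) (intro torus_continuous_intros; assumption)+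

lemma trig_poly_const: "trig_poly (\<lambda>\<theta>. c)"
  using trig_poly.scale[OF trig_poly.char[of 0], of c] by simp

lemma trig_poly_sum:
  "(\<And>i. i \<in> A \<Longrightarrow> trig_poly (P i)) \<Longrightarrow> trig_poly (\<lambda>\<theta>. \<Sum>i\<in>A. P i \<theta>)"
  by (induction A rule: infinite_finite_induct) (auto intro: trig_poly_const trig_poly.add)

lemma trig_poly_mult:
  assumes "trig_poly P" "trig_poly Q"
  shows "trig_poly (\<lambda>\<theta>. P \<theta> * Q \<theta>)"
  using assms(1)
proof (induction rule: trig_poly.induct)
  case (char k)
  show ?case using assms(2)
  proof (induction rule: trig_poly.induct)
    case (char l)
    show ?case using trig_poly.char[of "k + l"] by (simp add: torus_char_add_left[abs_def])
  next
    case (scale P c)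
    from trig_poly.scale[OF scale(2), of c] show ?case by (simp add: mult_ac)
  next
    case (add P Q)
    from trig_poly.add[OF add(3,4)] show ?case by (simp add: distrib_left)
  qed
next
  case (scale P c)
  from trig_poly.scale[OF scale(2), of c] show ?case by (simp add: mult_ac)
next
  case (add P Q)
  from trig_poly.add[OF add(3,4)] show ?case by (simp add: distrib_right)
qed

section \<open>Density of the trigonometric polynomials\<close>

text \<open>
  The torus as the product of unit circles. The closed cube is not a model of the torus, since
  periodic functions do not separate its opposite faces, so Stone-Weierstrass is applied to the image
  of this map.
\<close>

definition torus_embed :: "real ^ 'd \<Rightarrow> complex ^ 'd" where
  "torus_embed \<theta> = (\<chi> i. torus_char (axis i 1) \<theta>)"

lemma torus_continuous_embed: 
  "torus_continuous (torus_embed :: real ^ 'd \<Rightarrow> complex ^ 'd)"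
proof -
  have "torus_periodic (torus_char k)" "continuous_on UNIV (torus_char k)" for k :: "int ^ 'd"
    using torus_continuous_char[of k] by (auto simp: torus_continuous_def simp del: torus_continuous_char)
  then show ?thesis
    unfolding torus_continuous_def torus_embed_def torus_periodic_def
    by (auto simp: vec_eq_iff intro!: continuous_on_vec_lambda)
qed

lemma pairing_axis: "pairing (axis i 1) \<theta> = \<theta> $ i"
  unfolding pairing_def axis_def by (simp add: if_distrib[of of_int] if_distrib[of "\<lambda>x. x * _"] cong: if_cong)

lemma torus_embed_eq_imp:
  fixes F :: "real ^ 'd \<Rightarrow> 'b"
  assumes "torus_embed \<theta> = torus_embed \<theta>'" "torus_periodic F"
  shows "F \<theta> = F \<theta>'"
proof -
  have "\<exists>m :: int. \<theta> $ i = \<theta>' $ i + of_int m" for i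
  proof -
    have "torus_char (axis i 1) \<theta> = torus_char (axis i 1) \<theta>'"
      using assms(1) by (simp add: torus_embed_def vec_eq_iff)
    then have "torus_char (axis i 1) (\<theta> + - \<theta>') = 1"
      unfolding torus_char_add_right torus_char_uminus_right torus_char_uminus_left by simp
    then have "\<theta> $ i - \<theta>' $ i \<in> \<int>"
      unfolding torus_char_eq_1_iff pairing_axis by simp
    then show ?thesis by (metis Ints_cases add.commute diff_add_cancel)
  qed
  then obtain m :: "'d \<Rightarrow> int" where "\<And>i. \<theta> $ i = \<theta>' $ i + of_int (m i)" by metis
  then have "\<theta> = \<theta>' + (\<chi> i. of_int ((\<chi> i. m i) $ i))" by (simp add: vec_eq_iff)
  then show ?thesis using assms(2) unfolding torus_periodic_def by metis
qed

lemma trig_poly_dense_real: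
  fixes f :: "real ^ 'd \<Rightarrow> real"
  assumes f: "torus_continuous f" and "\<epsilon> > 0"
  shows "\<exists>P. trig_poly P \<and> (\<forall>\<theta>. cmod (complex_of_real (f \<theta>) - P \<theta>) < \<epsilon>)"
proof -
  define S where "S = range (torus_embed :: real ^ 'd \<Rightarrow> complex ^ 'd)"
  note emb = torus_continuous_embed[where 'd = 'd]
  have cont: "continuous_on A torus_embed" for A :: "(real ^ 'd) set"
    using continuous_on_subset[OF torus_continuousD[OF emb]] by blast
  have S: "S = torus_embed ` unit_cube"
  proof
    show "S \<subseteq> torus_embed ` unit_cube"
      unfolding S_def using torus_periodic_fundamental_domain[OF torus_continuous_periodic[OF emb]]
      by (metis image_subset_iff rev_image_eqI)
  qed (auto simp: S_def)
  have "compact S"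
    unfolding S unit_cube_def by (intro compact_continuous_image cont) auto
  define g where "g x = f (SOME \<theta>. torus_embed \<theta> = x)" for x
  have g: "g (torus_embed \<theta>) = f \<theta>" for \<theta>
    unfolding g_def
    by (rule torus_embed_eq_imp[OF _ torus_continuous_periodic[OF f]]) (rule someI, rule refl)
  \<comment> \<open>Preimages of closed sets are images of compact subsets of the cube, hence closed.\<close>
  have "continuous_on S g"
    unfolding continuous_on_closed_invariant
  proof (intro allI impI)
    fix B :: "real set" assume "closed B"
    let ?A = "torus_embed ` (unit_cube \<inter> f -` B) :: (complex ^ 'd) set"
    have "closed (f -` B)"
      using continuous_on_closed_vimage[of UNIV f] torus_continuousD[OF f] \<open>closed B\<close> by auto
    then have "compact ?A"
      unfolding unit_cube_def by (intro compact_continuous_image cont compact_Int_closed) auto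
    moreover have "?A = g -` B \<inter> S"
      unfolding S by (auto simp: g image_iff)
    then have "?A \<inter> S = g -` B \<inter> S" by blast
    ultimately show "\<exists>A. closed A \<and> A \<inter> S = g -` B \<inter> S"
      using compact_imp_closed by blast
  qed
  define Q where "Q r \<longleftrightarrow> continuous_on S r \<and> trig_poly (\<lambda>\<theta>. complex_of_real (r (torus_embed \<theta>)))" for r
  have ReIm: "Q (\<lambda>x. Re (x $ i))" "Q (\<lambda>x. Im (x $ i))" for i
  proof -
    have "trig_poly (\<lambda>\<theta>. (1/2) * (torus_char (axis i 1) \<theta> + torus_char (- axis i 1) \<theta>))"
         "trig_poly (\<lambda>\<theta>. (- \<i>/2) * (torus_char (axis i 1) \<theta> + (-1) * torus_char (- axis i 1) \<theta>))"
      by (intro trig_poly.intros)+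
    moreover have eq: "complex_of_real (Re z) = (1/2) * (z + cnj z)"
       "complex_of_real (Im z) = (- \<i>/2) * (z + (-1) * cnj z)" for z
      by (simp_all add: complex_eq_iff)
    ultimately have "trig_poly (\<lambda>\<theta>. complex_of_real (Re (torus_char (axis i 1) \<theta>)))"
      "trig_poly (\<lambda>\<theta>. complex_of_real (Im (torus_char (axis i 1) \<theta>)))"
      unfolding eq cnj_torus_char by blast+
    then show "Q (\<lambda>x. Re (x $ i))" "Q (\<lambda>x. Im (x $ i))"
      unfolding Q_def torus_embed_def by (auto intro!: continuous_intros)
  qed
  have "\<exists>r. Q r \<and> (\<forall>x\<in>S. \<bar>g x - r x\<bar> < \<epsilon>)"
  proof (rule Stone_Weierstrass_HOL[OF \<open>compact S\<close>, where P = Q])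
    fix x y assume "x \<in> S \<and> y \<in> S \<and> x \<noteq> y"
    then obtain i where "x $ i \<noteq> y $ i" by (auto simp: vec_eq_iff)
    then have "Re (x $ i) \<noteq> Re (y $ i) \<or> Im (x $ i) \<noteq> Im (y $ i)" by (auto simp: complex_eq_iff)
    then show "\<exists>r. Q r \<and> r x \<noteq> r y" using ReIm by blast
  qed (use \<open>continuous_on S g\<close> \<open>\<epsilon> > 0\<close> in \<open>auto simp: Q_def intro!: continuous_intros 
         intro: trig_poly_const trig_poly.add trig_poly_mult\<close>)
  then obtain r where "Q r" and r: "\<And>x. x \<in> S \<Longrightarrow> \<bar>g x - r x\<bar> < \<epsilon>" by blast
  have "cmod (complex_of_real (f \<theta>) - complex_of_real (r (torus_embed \<theta>))) < \<epsilon>" for \<theta>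
    using r[of "torus_embed \<theta>"] unfolding of_real_diff[symmetric] norm_of_real by (simp add: g S_def)
  then show ?thesis using \<open>Q r\<close> unfolding Q_def by blast
qed

lemma trig_poly_dense:
  fixes F :: "real ^ 'd \<Rightarrow> complex"
  assumes F: "torus_continuous F" and "\<epsilon> > 0"
  obtains P where "trig_poly P" "\<And>\<theta>. cmod (F \<theta> - P \<theta>) < \<epsilon>"
proof -
  have "torus_continuous (\<lambda>\<theta>. Re (F \<theta>))" "torus_continuous (\<lambda>\<theta>. Im (F \<theta>))"
    by (rule torus_continuous_compose[OF F]; intro continuous_intros)+
  with trig_poly_dense_real[of _ "\<epsilon> / 2"] \<open>\<epsilon> > 0\<close> obtain P Q
    where P: "trig_poly P" "\<And>\<theta>. cmod (complex_of_real (Re (F \<theta>)) - P \<theta>) < \<epsilon> / 2"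
      and Q: "trig_poly Q" "\<And>\<theta>. cmod (complex_of_real (Im (F \<theta>)) - Q \<theta>) < \<epsilon> / 2"
    by (metis half_gt_zero)
  have "cmod (F \<theta> - (P \<theta> + \<i> * Q \<theta>)) < \<epsilon>" for \<theta>
  proof -
    have "F \<theta> - (P \<theta> + \<i> * Q \<theta>)
        = (complex_of_real (Re (F \<theta>)) - P \<theta>) + \<i> * (complex_of_real (Im (F \<theta>)) - Q \<theta>)"
      by (simp add: complex_eq_iff)
    also have "cmod \<dots> \<le> cmod (complex_of_real (Re (F \<theta>)) - P \<theta>) + cmod (complex_of_real (Im (F \<theta>)) - Q \<theta>)"
      by (rule order_trans[OF norm_triangle_ineq]) (simp add: norm_mult)
    also have "\<dots> < \<epsilon>" using P(2)[of \<theta>] Q(2)[of \<theta>] by simp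
    finally show ?thesis .
  qed
  then show ?thesis using that P(1) Q(1) by (metis (mono_tags) trig_poly.add trig_poly.scale)
qed

text \<open>
  Density of the trigonometric polynomials as an induction rule: a property of continuous functions
  that is linear and closed under uniform limits needs to be checked on characters only.
\<close>

lemma torus_continuous_induct [consumes 1, case_names char scale add limit]:
  assumes "torus_continuous F"
    and "\<And>k. Q (torus_char k)"
    and "\<And>F c. torus_continuous F \<Longrightarrow> Q F \<Longrightarrow> Q (\<lambda>\<theta>. c * F \<theta>)"
    and "\<And>F H. torus_continuous F \<Longrightarrow> torus_continuous H \<Longrightarrow> Q F \<Longrightarrow> Q H \<Longrightarrow> Q (\<lambda>\<theta>. F \<theta> + H \<theta>)"
    and limit: "\<And>F. torus_continuous F \<Longrightarrow>
       (\<And>\<epsilon>. \<epsilon> > 0 \<Longrightarrow> \<exists>H. torus_continuous H \<and> Q H \<and> (\<forall>\<theta>. cmod (F \<theta> - H \<theta>) < \<epsilon>)) \<Longrightarrow> Q F"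
  shows "Q F"
proof -
  have Q: "Q P" if "trig_poly P" for P
    using that by (induction rule: trig_poly.induct) (simp_all add: assms(2-4) trig_poly_continuous)
  show ?thesis
  proof (rule limit[OF assms(1)])
    fix \<epsilon> :: real assume "\<epsilon> > 0"
    then obtain P where "trig_poly P" "\<And>\<theta>. cmod (F \<theta> - P \<theta>) < \<epsilon>"
      using trig_poly_dense[OF assms(1)] by blast
    then show "\<exists>H. torus_continuous H \<and> Q H \<and> (\<forall>\<theta>. cmod (F \<theta> - H \<theta>) < \<epsilon>)"
      using Q trig_poly_continuous by blast
  qed
qed

text \<open>
  The cube is not invariant under translations; for characters the invariance is immediate from
  orthogonality, and the general case follows by density.
\<close>

lemma torus_int_shift:
  fixes F :: "real ^ 'd \<Rightarrow> complex"
  assumes "torus_continuous F"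
  shows "torus_int (\<lambda>\<theta>. F (\<theta> + \<beta>)) = torus_int F"
  using assms
proof (induction rule: torus_continuous_induct)
  case (char k)
  then show ?case
    by (simp add: torus_char_add_right mult.commute[of _ "torus_char k \<beta>"] torus_int_mult torus_int_char)
next
  case (scale F c)
  then show ?case by (simp add: torus_int_mult)
next
  case (add F H)
  then show ?case by (simp add: torus_int_add torus_continuous_shift)
next
  case (limit F)
  have "cmod (torus_int (\<lambda>\<theta>. F (\<theta> + \<beta>)) - torus_int F) \<le> 0 + \<epsilon>" if e: "\<epsilon> > 0" for \<epsilon>
  proof -
    obtain H where H: "torus_continuous H" "torus_int (\<lambda>\<theta>. H (\<theta> + \<beta>)) = torus_int H"
      "\<And>\<theta>. cmod (F \<theta> - H \<theta>) < \<epsilon> / 2" using limit(2)[OF half_gt_zero[OF e]] by blast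
    have "torus_int (\<lambda>\<theta>. F (\<theta> + \<beta>)) - torus_int F
        = torus_int (\<lambda>\<theta>. (F (\<theta> + \<beta>) - H (\<theta> + \<beta>)) - (F \<theta> - H \<theta>))"
      by (simp add: torus_int_add torus_continuous_intros limit(1) H(1,2))
    also have "cmod \<dots> \<le> \<epsilon>"
    proof (rule norm_torus_int_le)
      show "cmod ((F (\<theta> + \<beta>) - H (\<theta> + \<beta>)) - (F \<theta> - H \<theta>)) \<le> \<epsilon>" for \<theta>
        using H(3)[of \<theta>] H(3)[of "\<theta> + \<beta>"] norm_triangle_ineq4[of "F (\<theta> + \<beta>) - H (\<theta> + \<beta>)" "F \<theta> - H \<theta>"]
        by simp
    qed (intro torus_continuous_intros limit(1) H(1))
    finally show ?thesis by simp
  qed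
  from field_le_epsilon[OF this] show ?case by simp
qed

lemma torus_int_shift_real:
  fixes f :: "real ^ 'd \<Rightarrow> real"
  assumes "torus_continuous f"
  shows "torus_int (\<lambda>\<theta>. f (\<theta> + \<beta>)) = torus_int f"
  using torus_int_shift[of "\<lambda>\<theta>. complex_of_real (f \<theta>)"] assms
  by (simp add: torus_int_of_real torus_continuous_intros)

section \<open>Unique ergodicity of irrational rotations\<close>

lemma torus_char_scaleR: "torus_char k (of_nat j *\<^sub>R \<beta>) = torus_char k \<beta> ^ j"
  unfolding torus_char_def pairing_scaleR_right exp_of_nat_mult[symmetric] by (simp add: mult_ac)

text \<open>
  Rational independence in the form in which Fourier analysis uses it: no nontrivial character is
  invariant under the rotation.
\<close>

definition totally_irrational :: "real ^ 'd \<Rightarrow> bool" where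
  "totally_irrational \<beta> \<longleftrightarrow> (\<forall>k. k \<noteq> 0 \<longrightarrow> torus_char k \<beta> \<noteq> 1)"

lemma geometric_averages_tendsto_zero:
  fixes w :: complex
  assumes "cmod w = 1" "w \<noteq> 1"
  shows "(\<lambda>n. (\<Sum>j<n. w ^ j) / of_nat n) \<longlonglongrightarrow> 0"
proof (rule Lim_null_comparison)
  show "\<forall>\<^sub>F n in sequentially. cmod ((\<Sum>j<n. w ^ j) / of_nat n) \<le> (2 / cmod (1 - w)) / real n"
  proof (rule always_eventually, rule allI)
    fix n
    have "cmod ((1 - w ^ n) / (1 - w)) \<le> 2 / cmod (1 - w)"
      using norm_triangle_ineq4[of 1 "w ^ n"] assms
      by (auto simp: norm_divide norm_power intro!: divide_right_mono)
    then show "cmod ((\<Sum>j<n. w ^ j) / of_nat n) \<le> (2 / cmod (1 - w)) / real n"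
      unfolding sum_gp_strict norm_divide[of _ "of_nat n"] norm_of_nat using assms(2)
      by (simp only: if_False) (rule divide_right_mono, simp_all)
  qed
  show "(\<lambda>n. (2 / cmod (1 - w)) / real n) \<longlonglongrightarrow> 0"
    by (rule lim_const_over_n)
qed

text \<open>
  Weyl's argument: the averages of a nontrivial character form a geometric series whose ratio is
  unimodular and not 1.
\<close>

theorem irrational_rotation_uniquely_ergodic:
  fixes F :: "real ^ 'd \<Rightarrow> complex"
  assumes "torus_continuous F" and \<beta>: "totally_irrational \<beta>"
  shows "uniform_limit UNIV (\<lambda>n \<theta>. (\<Sum>j<n. F (\<theta> + of_nat j *\<^sub>R \<beta>)) / of_nat n) (\<lambda>_. torus_int F) sequentially"
  using assms(1)
proof (induction rule: torus_continuous_induct)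
  case (char k)
  have char: "torus_char k (\<theta> + of_nat j *\<^sub>R \<beta>) = torus_char k \<theta> * torus_char k \<beta> ^ j" for \<theta> j
    by (simp only: torus_char_add_right torus_char_scaleR)
  have "(\<lambda>n. (\<Sum>j<n. torus_char k \<beta> ^ j) / of_nat n) \<longlonglongrightarrow> (if k = 0 then 1 else 0)"
  proof (cases "k = 0")
    case True
    have "(\<lambda>n. (\<Sum>j<n. 1 :: complex) / of_nat n) \<longlonglongrightarrow> 1"
      by (rule tendsto_eventually) (auto intro: eventually_sequentiallyI[of 1])
    then show ?thesis using True by simp
  next
    case False
    then show ?thesis using \<beta> geometric_averages_tendsto_zero by (simp add: totally_irrational_def)
  qed
  then have lim: "uniform_limit UNIV (\<lambda>n (\<theta> :: real ^ 'd). (\<Sum>j<n. torus_char k \<beta> ^ j) / of_nat n)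
      (\<lambda>_. if k = 0 then 1 else 0) sequentially"
    unfolding uniform_limit_iff tendsto_iff by simp
  have "uniform_limit UNIV (\<lambda>n \<theta>. torus_char k \<theta> * ((\<Sum>j<n. torus_char k \<beta> ^ j) / of_nat n))
      (\<lambda>\<theta>. torus_char k \<theta> * (if k = 0 then 1 else 0)) sequentially"
    by (rule uniform_lim_mult[OF uniform_limit_const lim]) 
       (auto intro!: boundedI[of _ 1])
  then show ?case
    by (simp add: char torus_int_char sum_distrib_left[symmetric] if_distrib cong: if_cong)
next
  case (scale F c)
  have "uniform_limit UNIV (\<lambda>n \<theta>. c * ((\<Sum>j<n. F (\<theta> + of_nat j *\<^sub>R \<beta>)) / of_nat n)) (\<lambda>_. c * torus_int F) sequentially"
    by (rule bounded_linear.uniform_limit[OF bounded_linear_mult_right scale(2)])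
  then show ?case by (simp add: torus_int_mult sum_distrib_left)
next
  case (add F H)
  from uniform_limit_add[OF add(3,4)] show ?case
    by (simp add: torus_int_add add sum.distrib add_divide_distrib)
next
  case (limit F)
  show ?case
  proof (rule uniform_limitI)
    fix \<epsilon> :: real assume "\<epsilon> > 0"
    then have "\<epsilon> / 3 > 0" by simp
    from limit(2)[OF this] obtain H where H: "torus_continuous H" "\<And>\<theta>. cmod (F \<theta> - H \<theta>) < \<epsilon> / 3"
      "uniform_limit UNIV (\<lambda>n \<theta>. (\<Sum>j<n. H (\<theta> + of_nat j *\<^sub>R \<beta>)) / of_nat n) (\<lambda>_. torus_int H) sequentially"
      by blast
    have int: "cmod (torus_int F - torus_int H) \<le> \<epsilon> / 3"
      unfolding torus_int_add(2)[OF limit(1) H(1), symmetric]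
      by (intro norm_torus_int_le torus_continuous_intros limit(1) H(1) less_imp_le[OF H(2)])
    have "\<forall>\<^sub>F n in sequentially. \<forall>\<theta>. dist ((\<Sum>j<n. H (\<theta> + of_nat j *\<^sub>R \<beta>)) / of_nat n) (torus_int H) < \<epsilon> / 3"
      using uniform_limitD[OF H(3), of "\<epsilon> / 3"] \<open>\<epsilon> > 0\<close> by simp
    then show "\<forall>\<^sub>F n in sequentially. \<forall>\<theta>\<in>UNIV.
        dist ((\<Sum>j<n. F (\<theta> + of_nat j *\<^sub>R \<beta>)) / of_nat n) (torus_int F) < \<epsilon>"
    proof (rule eventually_mono, intro ballI)
      fix n and \<theta> :: "real ^ 'd"
      assume n: "\<forall>\<theta>. dist ((\<Sum>j<n. H (\<theta> + of_nat j *\<^sub>R \<beta>)) / of_nat n) (torus_int H) < \<epsilon> / 3"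
      define a where "a = (\<Sum>j<n. F (\<theta> + of_nat j *\<^sub>R \<beta>)) / of_nat n"
      define b where "b = (\<Sum>j<n. H (\<theta> + of_nat j *\<^sub>R \<beta>)) / of_nat n"
      have "cmod (a - b) \<le> (\<Sum>j<n. \<epsilon> / 3) / real n"
        unfolding a_def b_def diff_divide_distrib[symmetric] sum_subtractf[symmetric] norm_divide norm_of_nat
        by (intro divide_right_mono sum_norm_le less_imp_le[OF H(2)]) auto
      also have "\<dots> \<le> \<epsilon> / 3" using \<open>\<epsilon> > 0\<close> by simp
      finally have "cmod (a - b) \<le> \<epsilon> / 3" .
      moreover have "cmod (b - torus_int H) < \<epsilon> / 3" using n by (simp add: b_def dist_norm)
      moreover have "cmod (a - torus_int F) = cmod ((a - b) + (b - torus_int H) - (torus_int F - torus_int H))" by simp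
      ultimately show "dist a (torus_int F) < \<epsilon>"
        unfolding dist_norm using int norm_triangle_ineq4[of "(a - b) + (b - torus_int H)" "torus_int F - torus_int H"]
          norm_triangle_ineq[of "a - b" "b - torus_int H"] by linarith
    qed
  qed
qed

corollary irrational_rotation_real_averages:
  fixes h :: "real ^ 'd \<Rightarrow> real"
  assumes "torus_continuous h" "totally_irrational \<beta>" "\<eta> > 0"
  obtains N where "\<And>n \<theta>. n \<ge> N \<Longrightarrow> \<bar>(\<Sum>j<n. h (\<theta> + of_nat j *\<^sub>R \<beta>)) - n * torus_int h\<bar> \<le> n * \<eta>"
proof -
  have "uniform_limit UNIV (\<lambda>n \<theta>. (\<Sum>j<n. complex_of_real (h (\<theta> + of_nat j *\<^sub>R \<beta>))) / of_nat n)
      (\<lambda>_. complex_of_real (torus_int h)) sequentially"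
    using irrational_rotation_uniquely_ergodic[of "\<lambda>\<theta>. complex_of_real (h \<theta>)" \<beta>] assms
    by (simp add: torus_int_of_real torus_continuous_intros)
  from uniform_limitD[OF this \<open>\<eta> > 0\<close>] obtain N where
    N: "\<And>n \<theta>. n \<ge> N \<Longrightarrow> dist ((\<Sum>j<n. complex_of_real (h (\<theta> + of_nat j *\<^sub>R \<beta>))) / of_nat n) (complex_of_real (torus_int h)) < \<eta>"
    unfolding eventually_sequentially by auto
  have "\<bar>(\<Sum>j<n. h (\<theta> + of_nat j *\<^sub>R \<beta>)) - n * torus_int h\<bar> \<le> n * \<eta>" if "n \<ge> N" for n \<theta>
  proof (cases "n = 0")
    case False
    have "(\<Sum>j<n. complex_of_real (h (\<theta> + of_nat j *\<^sub>R \<beta>))) / of_nat n - complex_of_real (torus_int h)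
       = complex_of_real ((\<Sum>j<n. h (\<theta> + of_nat j *\<^sub>R \<beta>)) / n - torus_int h)" by simp
    then have "\<bar>(\<Sum>j<n. h (\<theta> + of_nat j *\<^sub>R \<beta>)) / n - torus_int h\<bar> < \<eta>"
      using N[OF that, of \<theta>] unfolding dist_norm by (metis norm_of_real)
    also have "(\<Sum>j<n. h (\<theta> + of_nat j *\<^sub>R \<beta>)) / n - torus_int h = ((\<Sum>j<n. h (\<theta> + of_nat j *\<^sub>R \<beta>)) - n * torus_int h) / n"
      using False by (simp add: field_simps)
    finally show ?thesis using False by (simp add: abs_divide pos_divide_less_eq mult.commute)
  qed simp
  then show ?thesis using that by blast
qed

section \<open>Fourier coefficients\<close>

lemma fourier_coeff_eq: "fourier_coeff F k = torus_int (\<lambda>\<theta>. F \<theta> * cnj (torus_char k \<theta>))"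
  unfolding fourier_coeff_def torus_int_def torus_char_def by (simp add: exp_cnj)

lemma
  assumes "torus_continuous F" "torus_continuous H"
  shows fourier_coeff_add: "fourier_coeff (\<lambda>\<theta>. F \<theta> + H \<theta>) k = fourier_coeff F k + fourier_coeff H k"
    and fourier_coeff_diff: "fourier_coeff (\<lambda>\<theta>. F \<theta> - H \<theta>) k = fourier_coeff F k - fourier_coeff H k"
  unfolding fourier_coeff_eq distrib_right left_diff_distrib using assms
  by (simp_all add: torus_int_add torus_continuous_intros)

lemma fourier_coeff_mult: "fourier_coeff (\<lambda>\<theta>. c * F \<theta>) k = c * fourier_coeff F k"
  unfolding fourier_coeff_eq by (simp add: mult.assoc torus_int_mult)

lemma fourier_coeff_mult_char:
  "fourier_coeff (\<lambda>\<theta>. torus_char l \<theta> * F \<theta>) k = fourier_coeff F (k - l)"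
proof -
  have "torus_char l \<theta> * F \<theta> * cnj (torus_char k \<theta>) = F \<theta> * cnj (torus_char (k - l) \<theta>)" for \<theta>
    unfolding cnj_torus_char using torus_char_add_left[of l "- k" \<theta>] by (simp add: mult_ac)
  then show ?thesis unfolding fourier_coeff_eq by (simp only:)
qed

lemma fourier_coeff_const: "fourier_coeff (\<lambda>\<theta>. c) k = (if k = 0 then c else 0)"
  unfolding fourier_coeff_eq cnj_torus_char
  by (simp add: torus_int_mult torus_int_char)

lemma fourier_coeff_char: "fourier_coeff (torus_char l) k = (if k = l then 1 else 0)"
  using fourier_coeff_mult_char[of l "\<lambda>_. 1" k] by (simp add: fourier_coeff_const)

lemma fourier_coeff_sum:
  "(\<And>i. i \<in> A \<Longrightarrow> torus_continuous (F i)) \<Longrightarrow>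
    fourier_coeff (\<lambda>\<theta>. \<Sum>i\<in>A. F i \<theta>) k = (\<Sum>i\<in>A. fourier_coeff (F i) k)"
  by (induction A rule: infinite_finite_induct)
     (simp_all add: fourier_coeff_const fourier_coeff_add torus_continuous_intros)

lemma fourier_coeff_shift:
  assumes "torus_continuous F"
  shows "fourier_coeff (\<lambda>\<theta>. F (\<theta> + \<beta>)) k = torus_char k \<beta> * fourier_coeff F k"
proof -
  have "torus_continuous (\<lambda>\<theta>. F \<theta> * cnj (torus_char k \<theta>))"
    by (intro torus_continuous_intros assms)
  from torus_int_shift[OF this, of \<beta>]
  have "fourier_coeff F k = torus_int (\<lambda>\<theta>. cnj (torus_char k \<beta>) * (F (\<theta> + \<beta>) * cnj (torus_char k \<theta>)))"
    unfolding fourier_coeff_eq by (simp add: torus_char_add_right mult_ac)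
  also have "\<dots> = cnj (torus_char k \<beta>) * fourier_coeff (\<lambda>\<theta>. F (\<theta> + \<beta>)) k"
    unfolding torus_int_mult fourier_coeff_eq ..
  finally show ?thesis by (simp add: cnj_torus_char torus_char_uminus_left field_simps)
qed

definition torus_sq :: "(real ^ 'd \<Rightarrow> complex) \<Rightarrow> real" where
  "torus_sq F = torus_int (\<lambda>\<theta>. (cmod (F \<theta>))\<^sup>2)"

lemma torus_sq_nonneg: "torus_continuous F \<Longrightarrow> 0 \<le> torus_sq F"
  unfolding torus_sq_def using torus_int_mono[of "\<lambda>_. 0" "\<lambda>\<theta>. (cmod (F \<theta>))\<^sup>2"]
  by (simp add: torus_int_const torus_continuous_intros)

lemma torus_sq_le:
  assumes "torus_continuous F" "\<And>\<theta>. cmod (F \<theta>) \<le> B"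
  shows "torus_sq F \<le> B\<^sup>2"
  unfolding torus_sq_def
  using torus_int_mono[of "\<lambda>\<theta>. (cmod (F \<theta>))\<^sup>2" "\<lambda>_. B\<^sup>2"] assms
  by (simp add: torus_int_const torus_continuous_intros power_mono)

text \<open>
  The distance of \<open>F\<close> to a trigonometric polynomial splits by Pythagoras. With \<open>c\<close> the Fourier
  coefficients of \<open>F\<close> this is Bessel's inequality, and with \<open>c\<close> arbitrary it says that the partial
  sums of the Fourier series are the best approximations.
\<close>

lemma torus_sq_diff_trig_poly:
  assumes "torus_continuous F" "finite A"
  shows "torus_sq (\<lambda>\<theta>. F \<theta> - (\<Sum>k\<in>A. c k * torus_char k \<theta>))
    = torus_sq F - (\<Sum>k\<in>A. (cmod (fourier_coeff F k))\<^sup>2) + (\<Sum>k\<in>A. (cmod (fourier_coeff F k - c k))\<^sup>2)"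
  using assms(2,1)
proof (induction A arbitrary: F rule: finite_induct)
  case (insert k A F)
  let ?H = "\<lambda>\<theta>. F \<theta> - c k * torus_char k \<theta>"
  have H: "torus_continuous ?H" by (intro torus_continuous_intros insert.prems)
  have coeff: "fourier_coeff ?H l = fourier_coeff F l - (if l = k then c k else 0)" for l
    by (simp add: fourier_coeff_diff insert.prems torus_continuous_intros fourier_coeff_mult fourier_coeff_char)
  have "(cmod (?H \<theta>))\<^sup>2 = (cmod (F \<theta>))\<^sup>2 - 2 * Re (cnj (c k) * (F \<theta> * cnj (torus_char k \<theta>))) + (cmod (c k))\<^sup>2" for \<theta>
  proof -
    have "(cmod (a - b))\<^sup>2 = (cmod a)\<^sup>2 - 2 * Re (cnj b * a) + (cmod b)\<^sup>2" for a b
      unfolding cmod_power2 by (simp add: power2_eq_square algebra_simps)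
    from this[of "F \<theta>" "c k * torus_char k \<theta>"] show ?thesis by (simp add: norm_mult mult_ac)
  qed
  then have "torus_sq ?H = torus_int (\<lambda>\<theta>. (cmod (F \<theta>))\<^sup>2 - 2 * Re (cnj (c k) * (F \<theta> * cnj (torus_char k \<theta>))) + (cmod (c k))\<^sup>2)"
    unfolding torus_sq_def by simp
  also have "\<dots> = torus_sq F - 2 * torus_int (\<lambda>\<theta>. Re (cnj (c k) * (F \<theta> * cnj (torus_char k \<theta>)))) + (cmod (c k))\<^sup>2"
  proof -
    have "torus_continuous (\<lambda>\<theta>. cnj (c k) * (F \<theta> * cnj (torus_char k \<theta>)))"
      by (intro torus_continuous_intros insert.prems)
    then have "torus_continuous (\<lambda>\<theta>. Re (cnj (c k) * (F \<theta> * cnj (torus_char k \<theta>))))"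
      by (rule torus_continuous_compose) (intro continuous_intros)
    then show ?thesis unfolding torus_sq_def
      by (subst torus_int_add torus_int_mult torus_int_const
          | intro torus_continuous_intros insert.prems | assumption)+ simp
  qed
  also have "torus_int (\<lambda>\<theta>. Re (cnj (c k) * (F \<theta> * cnj (torus_char k \<theta>)))) = Re (cnj (c k) * fourier_coeff F k)"
    by (subst torus_int_Re) (auto intro!: torus_continuous_intros insert.prems simp: torus_int_mult fourier_coeff_eq)
  also have "torus_sq F - 2 * Re (cnj (c k) * fourier_coeff F k) + (cmod (c k))\<^sup>2
      = torus_sq F - (cmod (fourier_coeff F k))\<^sup>2 + (cmod (fourier_coeff F k - c k))\<^sup>2"
    unfolding cmod_power2 by (simp add: power2_eq_square algebra_simps)
  finally have sq: "torus_sq ?H = torus_sq F - (cmod (fourier_coeff F k))\<^sup>2 + (cmod (fourier_coeff F k - c k))\<^sup>2" .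
  have "F \<theta> - (\<Sum>k\<in>insert k A. c k * torus_char k \<theta>) = ?H \<theta> - (\<Sum>k\<in>A. c k * torus_char k \<theta>)" for \<theta>
    using insert.hyps by simp
  then have "torus_sq (\<lambda>\<theta>. F \<theta> - (\<Sum>k\<in>insert k A. c k * torus_char k \<theta>))
    = torus_sq ?H - (\<Sum>l\<in>A. (cmod (fourier_coeff ?H l))\<^sup>2) + (\<Sum>l\<in>A. (cmod (fourier_coeff ?H l - c l))\<^sup>2)"
    using insert.IH[OF H] by (simp only:)
  moreover have "fourier_coeff ?H l = fourier_coeff F l" if "l \<in> A" for l
    using that insert.hyps coeff[of l] by auto
  ultimately show ?case using insert.hyps sq by (simp add: algebra_simps)
qed simp

lemma trig_poly_expansion:
  assumes "trig_poly P"
  obtains A c where "finite A" "P = (\<lambda>\<theta>. \<Sum>k\<in>A. c k * torus_char k \<theta>)"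
proof -
  have "\<exists>A c. finite A \<and> (\<forall>k. k \<notin> A \<longrightarrow> c k = 0) \<and> P = (\<lambda>\<theta>. \<Sum>k\<in>A. c k * torus_char k \<theta>)"
    using assms
  proof (induction rule: trig_poly.induct)
    case (char k)
    show ?case by (rule exI[of _ "{k}"], rule exI[of _ "\<lambda>l. if l = k then 1 else 0"]) auto
  next
    case (scale P c)
    then obtain A d where "finite A" "\<forall>k. k \<notin> A \<longrightarrow> d k = 0" "P = (\<lambda>\<theta>. \<Sum>k\<in>A. d k * torus_char k \<theta>)" by blast
    then show ?case
      by (intro exI[of _ A] exI[of _ "\<lambda>k. c * d k"]) (auto simp: sum_distrib_left mult.assoc)
  next
    case (add P Q)
    obtain A c where A: "finite A" "\<forall>k. k \<notin> A \<longrightarrow> c k = 0" "P = (\<lambda>\<theta>. \<Sum>k\<in>A. c k * torus_char k \<theta>)"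
      using add by blast
    obtain B d where B: "finite B" "\<forall>k. k \<notin> B \<longrightarrow> d k = 0" "Q = (\<lambda>\<theta>. \<Sum>k\<in>B. d k * torus_char k \<theta>)"
      using add by blast
    have "(\<Sum>k\<in>A. c k * torus_char k \<theta>) = (\<Sum>k\<in>A \<union> B. c k * torus_char k \<theta>)"
      "(\<Sum>k\<in>B. d k * torus_char k \<theta>) = (\<Sum>k\<in>A \<union> B. d k * torus_char k \<theta>)" for \<theta>
      using A B by (intro sum.mono_neutral_left; auto)+
    then show ?case
      using A B by (intro exI[of _ "A \<union> B"] exI[of _ "\<lambda>k. c k + d k"]) (auto simp: distrib_right sum.distrib)
  qed
  then show ?thesis using that by blast
qed

lemma Bessel:
  assumes "torus_continuous F"
  shows "L2_set (\<lambda>k. cmod (fourier_coeff F k)) A \<le> sqrt (torus_sq F)"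
proof (cases "finite A")
  case True
  have "0 \<le> torus_sq (\<lambda>\<theta>. F \<theta> - (\<Sum>k\<in>A. fourier_coeff F k * torus_char k \<theta>))"
    by (intro torus_sq_nonneg torus_continuous_intros assms)
  then show ?thesis
    unfolding torus_sq_diff_trig_poly[OF assms True] L2_set_def by simp
qed (simp add: torus_sq_nonneg assms)

lemma fourier_coeff_ell2: "torus_continuous F \<Longrightarrow> fourier_coeff F \<in> ell2"
  by (rule ell2I) (rule Bessel)

text \<open>
  Bessel's inequality gives one direction. For the other, a trigonometric polynomial uniformly close to
  \<open>F\<close> is no better an approximation in \<open>L\<^sup>2\<close> than the partial sum of the Fourier series over the same
  frequencies.
\<close>

theorem Parseval:
  assumes "torus_continuous F"
  shows "ell2_norm (fourier_coeff F) = sqrt (torus_sq F)"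
proof (rule antisym)
  show "ell2_norm (fourier_coeff F) \<le> sqrt (torus_sq F)"
    by (rule ell2_norm_le) (rule Bessel[OF assms])
  have "torus_sq F \<le> (ell2_norm (fourier_coeff F))\<^sup>2 + \<epsilon>" if "\<epsilon> > 0" for \<epsilon>
  proof -
    have "sqrt \<epsilon> > 0" using that by simp
    then obtain P where P: "trig_poly P" "\<And>\<theta>. cmod (F \<theta> - P \<theta>) < sqrt \<epsilon>"
      using trig_poly_dense[OF assms] by blast
    obtain A c where A: "finite A" "P = (\<lambda>\<theta>. \<Sum>k\<in>A. c k * torus_char k \<theta>)"
      using trig_poly_expansion[OF P(1)] .
    have "torus_sq F - (\<Sum>k\<in>A. (cmod (fourier_coeff F k))\<^sup>2) \<le> torus_sq (\<lambda>\<theta>. F \<theta> - P \<theta>)"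
      unfolding A(2) torus_sq_diff_trig_poly[OF assms A(1)] by (simp add: sum_nonneg)
    also have "\<dots> \<le> (sqrt \<epsilon>)\<^sup>2"
      by (intro torus_sq_le torus_continuous_intros assms trig_poly_continuous P(1) less_imp_le[OF P(2)])
    also have "\<dots> = \<epsilon>" using that by simp
    finally have "torus_sq F \<le> (\<Sum>k\<in>A. (cmod (fourier_coeff F k))\<^sup>2) + \<epsilon>" by simp
    also have "(\<Sum>k\<in>A. (cmod (fourier_coeff F k))\<^sup>2) = (L2_set (\<lambda>k. cmod (fourier_coeff F k)) A)\<^sup>2"
      unfolding L2_set_def by (simp add: sum_nonneg)
    also have "\<dots> \<le> (ell2_norm (fourier_coeff F))\<^sup>2"
      by (intro power_mono L2_set_le_ell2_norm fourier_coeff_ell2 assms A(1)) (simp add: L2_set_nonneg)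
    finally show ?thesis by simp
  qed
  then have "torus_sq F \<le> (ell2_norm (fourier_coeff F))\<^sup>2" by (rule field_le_epsilon)
  then show "sqrt (torus_sq F) \<le> ell2_norm (fourier_coeff F)" by (simp add: real_le_lsqrt)
qed

text \<open>
  Finitely supported sequences are the coefficient sequences of trigonometric polynomials.
\<close>

lemma ell2_trig_poly_dense:
  fixes u :: "int ^ 'd \<Rightarrow> complex"
  assumes "u \<in> ell2" "\<epsilon> > 0"
  obtains P where "trig_poly P" "ell2_norm (\<lambda>n. u n - fourier_coeff P n) \<le> \<epsilon>"
proof -
  have s: "(\<lambda>n. (cmod (u n))\<^sup>2) summable_on UNIV" using assms(1) by (simp add: ell2_def)
  define T where "T = (\<Sum>\<^sub>\<infinity>n. (cmod (u n))\<^sup>2)"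
  have "((\<lambda>A. \<Sum>n\<in>A. (cmod (u n))\<^sup>2) \<longlongrightarrow> T) (finite_subsets_at_top UNIV)"
    unfolding T_def by (rule infsum_tendsto[OF s])
  then have "\<forall>\<^sub>F A in finite_subsets_at_top UNIV. dist (\<Sum>n\<in>A. (cmod (u n))\<^sup>2) T < \<epsilon>\<^sup>2"
    by (rule tendstoD) (use assms(2) in simp)
  then obtain A where A: "finite A" "dist (\<Sum>n\<in>A. (cmod (u n))\<^sup>2) T < \<epsilon>\<^sup>2"
    unfolding eventually_finite_subsets_at_top by blast
  define P where "P = (\<lambda>\<theta>. \<Sum>k\<in>A. u k * torus_char k \<theta>)"
  have "trig_poly P" unfolding P_def by (intro trig_poly_sum trig_poly.intros)
  have "fourier_coeff P n = (if n \<in> A then u n else 0)" for n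
    unfolding P_def using A(1)
    by (subst fourier_coeff_sum)
       (auto intro!: torus_continuous_intros
         simp: fourier_coeff_mult fourier_coeff_char if_distrib[of "\<lambda>x. _ * x"] cong: if_cong)
  then have diff: "u n - fourier_coeff P n = (if n \<in> A then 0 else u n)" for n by simp
  have "L2_set (\<lambda>n. cmod (u n - fourier_coeff P n)) B \<le> \<epsilon>" if "finite B" for B
  proof -
    have "(\<Sum>n\<in>B. (cmod (u n - fourier_coeff P n))\<^sup>2) = (\<Sum>n\<in>B - A. (cmod (u n))\<^sup>2)"
      unfolding diff using that by (intro sum.mono_neutral_cong_right) auto
    also have "\<dots> = (\<Sum>n\<in>A \<union> B. (cmod (u n))\<^sup>2) - (\<Sum>n\<in>A. (cmod (u n))\<^sup>2)"
    proof -
      have "A \<union> B - A = B - A" by auto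
      then show ?thesis using sum_diff[of "A \<union> B" A "\<lambda>n. (cmod (u n))\<^sup>2"] A(1) that by simp
    qed
    also have "\<dots> \<le> T - (\<Sum>n\<in>A. (cmod (u n))\<^sup>2)"
      unfolding T_def using A(1) that by (intro diff_right_mono finite_sum_le_infsum s) auto
    also have "\<dots> \<le> \<epsilon>\<^sup>2" using A(2) by (simp add: dist_real_def)
    finally show ?thesis unfolding L2_set_def using assms(2) by (simp add: real_le_lsqrt)
  qed
  then have "ell2_norm (\<lambda>n. u n - fourier_coeff P n) \<le> \<epsilon>" by (rule ell2_norm_le)
  then show ?thesis using that \<open>trig_poly P\<close> by blast
qed

section \<open>Convolution operators\<close>

definition conv_op :: "(real ^ 'd \<Rightarrow> complex) \<Rightarrow> (int ^ 'd \<Rightarrow> complex) \<Rightarrow> int ^ 'd \<Rightarrow> complex" where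
  "conv_op F u n = (\<Sum>\<^sub>\<infinity>k. fourier_coeff F k * u (n - k))"

lemma bij_reflect: "bij (\<lambda>k :: 'a::ab_group_add. n - k)"
  by (rule o_bij[of "\<lambda>k. n - k"]) (auto simp: fun_eq_iff)

lemma ell2_reflect:
  fixes u :: "int ^ 'd \<Rightarrow> complex"
  assumes "u \<in> ell2"
  shows "(\<lambda>k. u (n - k)) \<in> ell2"
  using assms summable_on_reindex_bij_betw[OF bij_reflect[of n], of "\<lambda>k. (cmod (u k))\<^sup>2"]
  unfolding ell2_def by simp

lemma conv_op_summable:
  assumes "torus_continuous F" "u \<in> ell2"
  shows "(\<lambda>k. fourier_coeff F k * u (n - k)) summable_on UNIV"
  by (rule abs_summable_summable, rule ell2_prod_abs_summable)
     (intro fourier_coeff_ell2 assms ell2_reflect)+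

lemma conv_op_reflect: "conv_op F u n = (\<Sum>\<^sub>\<infinity>m. fourier_coeff F (n - m) * u m)"
  unfolding conv_op_def
  using infsum_reindex_bij_betw[OF bij_reflect[of n], of "\<lambda>k. fourier_coeff F k * u (n - k)"] by simp

lemma conv_op_mult_left: "conv_op (\<lambda>\<theta>. c * F \<theta>) u n = c * conv_op F u n"
  and conv_op_mult_right: "conv_op F (\<lambda>n. c * u n) n = c * conv_op F u n"
  unfolding conv_op_def fourier_coeff_mult
  by (simp_all add: mult.assoc mult.left_commute[of _ c] infsum_cmult_right')

lemma conv_op_add_left:
  assumes "torus_continuous F" "torus_continuous H" "u \<in> ell2"
  shows "conv_op (\<lambda>\<theta>. F \<theta> + H \<theta>) u n = conv_op F u n + conv_op H u n"
    and "conv_op (\<lambda>\<theta>. F \<theta> - H \<theta>) u n = conv_op F u n - conv_op H u n"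
proof -
  have add: "conv_op (\<lambda>\<theta>. F \<theta> + K \<theta>) u n = conv_op F u n + conv_op K u n" if "torus_continuous K" for K
    unfolding conv_op_def
    by (simp add: fourier_coeff_add assms that distrib_right infsum_add conv_op_summable)
  show "conv_op (\<lambda>\<theta>. F \<theta> + H \<theta>) u n = conv_op F u n + conv_op H u n" by (rule add[OF assms(2)])
  have "torus_continuous (\<lambda>\<theta>. (- 1) * H \<theta>)" by (intro torus_continuous_intros assms)
  from add[OF this] show "conv_op (\<lambda>\<theta>. F \<theta> - H \<theta>) u n = conv_op F u n - conv_op H u n"
    unfolding conv_op_mult_left by simp
qed

lemma conv_op_add_right:
  assumes "torus_continuous F" "u \<in> ell2" "w \<in> ell2"
  shows "conv_op F (\<lambda>n. u n + w n) n = conv_op F u n + conv_op F w n"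
  unfolding conv_op_def
  by (simp add: assms distrib_left infsum_add conv_op_summable)

lemma conv_op_single:
  assumes "\<And>k. fourier_coeff F k = (if k = l then c else 0)"
  shows "conv_op F u n = c * u (n - l)"
proof -
  have "conv_op F u n = (\<Sum>\<^sub>\<infinity>k\<in>{l}. fourier_coeff F k * u (n - k))"
    unfolding conv_op_def by (rule infsum_cong_neutral) (auto simp: assms)
  then show ?thesis by (simp add: assms)
qed

lemma conv_op_char: "conv_op (torus_char l) u n = u (n - l)"
  using conv_op_single[of "torus_char l" l 1] by (simp add: fourier_coeff_char)

lemma conv_op_const: "conv_op (\<lambda>\<theta>. c) u n = c * u n"
  using conv_op_single[of "\<lambda>\<theta>. c" 0 c] by (simp add: fourier_coeff_const)

text \<open>
  For finitely supported \<open>u\<close> the convolution is the coefficient sequence of \<open>F\<close> times a trigonometric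
  polynomial, so that the bound is the pointwise bound of that product together with Parseval's
  identity; Fatou's lemma extends it to all of \<^const>\<open>ell2\<close>.
\<close>

lemma
  fixes F :: "real ^ 'd \<Rightarrow> complex"
  assumes F: "torus_continuous F" and B: "\<And>\<theta>. cmod (F \<theta>) \<le> B" and u: "u \<in> ell2"
  shows conv_op_ell2: "conv_op F u \<in> ell2"
    and conv_op_norm_le: "ell2_norm (conv_op F u) \<le> B * ell2_norm u"
proof -
  have "B \<ge> 0" using B[of 0] norm_ge_zero order_trans by blast
  define f where "f A n = (\<Sum>m\<in>A. fourier_coeff F (n - m) * u m)" for A n
  define P where "P A = (\<lambda>\<theta>. \<Sum>m\<in>A. u m * torus_char m \<theta>)" for A
  have P: "torus_continuous (P A)" for A unfolding P_def by (intro torus_continuous_intros)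
  have f: "f A = fourier_coeff (\<lambda>\<theta>. F \<theta> * P A \<theta>)" for A
  proof
    fix n
    have "fourier_coeff (\<lambda>\<theta>. F \<theta> * P A \<theta>) n = fourier_coeff (\<lambda>\<theta>. \<Sum>m\<in>A. u m * (torus_char m \<theta> * F \<theta>)) n"
      unfolding P_def sum_distrib_left by (simp only: mult_ac)
    also have "\<dots> = (\<Sum>m\<in>A. fourier_coeff (\<lambda>\<theta>. u m * (torus_char m \<theta> * F \<theta>)) n)"
      by (intro fourier_coeff_sum torus_continuous_intros F)
    also have "\<dots> = f A n" unfolding f_def fourier_coeff_mult fourier_coeff_mult_char
      by (simp only: mult_ac)
    finally show "f A n = fourier_coeff (\<lambda>\<theta>. F \<theta> * P A \<theta>) n" by simp
  qed
  have FP: "torus_continuous (\<lambda>\<theta>. F \<theta> * P A \<theta>)" for A by (intro torus_continuous_intros F P)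
  have bound: "ell2_norm (f A) \<le> B * ell2_norm u" for A
  proof (cases "finite A")
    case True
    have "torus_sq (\<lambda>\<theta>. F \<theta> * P A \<theta>) \<le> torus_int (\<lambda>\<theta>. B\<^sup>2 * (cmod (P A \<theta>))\<^sup>2)"
      unfolding torus_sq_def using B
      by (intro torus_int_mono torus_continuous_intros FP P)
         (auto simp: norm_mult power_mult_distrib intro!: mult_right_mono power_mono)
    also have "\<dots> = B\<^sup>2 * torus_sq (P A)" by (simp add: torus_int_mult torus_sq_def)
    also have "torus_sq (P A) = (\<Sum>m\<in>A. (cmod (u m))\<^sup>2)"
      using torus_sq_diff_trig_poly[of "\<lambda>\<theta>. 0" A "\<lambda>m. - u m"] True
      by (simp add: P_def sum_negf fourier_coeff_const) (simp add: torus_sq_def torus_int_const)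
    finally have "sqrt (torus_sq (\<lambda>\<theta>. F \<theta> * P A \<theta>)) \<le> sqrt (B\<^sup>2 * (\<Sum>m\<in>A. (cmod (u m))\<^sup>2))"
      by (rule real_sqrt_le_mono)
    also have "\<dots> = B * L2_set (\<lambda>m. cmod (u m)) A"
      using \<open>B \<ge> 0\<close> by (simp add: real_sqrt_mult L2_set_def)
    also have "\<dots> \<le> B * ell2_norm u"
      using \<open>B \<ge> 0\<close> by (intro mult_left_mono L2_set_le_ell2_norm u True)
    finally show ?thesis unfolding f Parseval[OF FP] .
  next
    case False
    then show ?thesis using \<open>B \<ge> 0\<close> unfolding f_def by simp
  qed
  have lim: "((\<lambda>A. f A n) \<longlongrightarrow> conv_op F u n) (finite_subsets_at_top UNIV)" for n
    unfolding conv_op_reflect f_def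
    using conv_op_summable[OF F u, of n]
      summable_on_reindex_bij_betw[OF bij_reflect[of n], of "\<lambda>k. fourier_coeff F k * u (n - k)"]
    by (intro infsum_tendsto) simp
  have "f A \<in> ell2" for A unfolding f by (rule fourier_coeff_ell2[OF FP])
  from ell2_limit[OF lim _ this bound] ell2_norm_limit[OF lim _ this bound]
  show "conv_op F u \<in> ell2" "ell2_norm (conv_op F u) \<le> B * ell2_norm u" by auto
qed

lemma conv_op_bounded: 
  assumes "torus_continuous F" shows "ell2_bounded_operator (conv_op F)"
proof -
  obtain B where B: "\<And>\<theta>. cmod (F \<theta>) \<le> B" using torus_continuous_bounded[OF assms] by blast
  show ?thesis unfolding ell2_bounded_operator_def
    using conv_op_ell2[OF assms B] conv_op_norm_le[OF assms B]
    by (intro conjI exI[of _ B]) (auto simp: conv_op_add_right[OF assms] conv_op_mult_right fun_eq_iff)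
qed

text \<open>
  Multiplicativity is exact when the left factor is a character, where convolution is a translation
  of the lattice; the general case follows from the bound of the norm by the supremum.
\<close>

lemma conv_op_mult:
  fixes F H :: "real ^ 'd \<Rightarrow> complex"
  assumes F: "torus_continuous F" and H: "torus_continuous H" and u: "u \<in> ell2"
  shows "conv_op (\<lambda>\<theta>. F \<theta> * H \<theta>) u n = conv_op F (conv_op H u) n"
  using F
proof (induction arbitrary: n rule: torus_continuous_induct)
  case (char l)
  have "bij (\<lambda>k. k + l)" by (rule o_bij[of "\<lambda>k. k - l"]) (auto simp: fun_eq_iff)
  from infsum_reindex_bij_betw[OF this, of "\<lambda>k. fourier_coeff H (k - l) * u (n - k)"]
  show ?case unfolding conv_op_char
    by (simp add: conv_op_def fourier_coeff_mult_char diff_diff_eq add.commute)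
next
  case (scale F c)
  then show ?case by (simp add: mult.assoc conv_op_mult_left)
next
  case (add F K)
  have "conv_op H u \<in> ell2" by (rule ell2_op_closed[OF conv_op_bounded[OF H] u])
  then show ?case
    by (simp add: distrib_right conv_op_add_left add torus_continuous_intros H u)
next
  case (limit F)
  obtain B where B: "B > 0" "\<And>\<theta>. cmod (H \<theta>) \<le> B" using torus_continuous_bounded[OF H] by blast
  define C where "C = B * ell2_norm u"
  have "C \<ge> 0" using B(1) by (simp add: C_def)
  have Hu: "conv_op H u \<in> ell2" "ell2_norm (conv_op H u) \<le> C"
    unfolding C_def by (rule conv_op_ell2[OF H B(2) u] conv_op_norm_le[OF H B(2) u])+
  have "cmod (conv_op (\<lambda>\<theta>. F \<theta> * H \<theta>) u n - conv_op F (conv_op H u) n) \<le> 0 + \<epsilon>" if e: "\<epsilon> > 0" for \<epsilon>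
  proof -
    define \<delta> where "\<delta> = \<epsilon> / (2 * C + 1)"
    have \<delta>: "\<delta> > 0" using e \<open>C \<ge> 0\<close> by (simp add: \<delta>_def)
    from limit(2)[OF this] obtain K where K: "torus_continuous K"
      "\<And>n. conv_op (\<lambda>\<theta>. K \<theta> * H \<theta>) u n = conv_op K (conv_op H u) n" "\<And>\<theta>. cmod (F \<theta> - K \<theta>) < \<delta>" by blast
    note intros = torus_continuous_intros limit(1) K(1) H
    have "conv_op (\<lambda>\<theta>. F \<theta> * H \<theta>) u n - conv_op F (conv_op H u) n
      = conv_op (\<lambda>\<theta>. (F \<theta> - K \<theta>) * H \<theta>) u n - conv_op (\<lambda>\<theta>. F \<theta> - K \<theta>) (conv_op H u) n"
      unfolding left_diff_distrib
      by (subst conv_op_add_left, (intro intros u Hu)+)+ (simp add: K(2))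
    also have "cmod \<dots> \<le> (\<delta> * B) * ell2_norm u + \<delta> * C"
    proof (rule order_trans[OF norm_triangle_ineq4 add_mono])
      have "cmod ((F \<theta> - K \<theta>) * H \<theta>) \<le> \<delta> * B" for \<theta>
        unfolding norm_mult using B \<delta> by (intro mult_mono less_imp_le[OF K(3)]) auto
      then show "cmod (conv_op (\<lambda>\<theta>. (F \<theta> - K \<theta>) * H \<theta>) u n) \<le> (\<delta> * B) * ell2_norm u"
        by (intro order_trans[OF cmod_le_ell2_norm conv_op_norm_le] conv_op_ell2 intros u)
      have "ell2_norm (conv_op (\<lambda>\<theta>. F \<theta> - K \<theta>) (conv_op H u)) \<le> \<delta> * ell2_norm (conv_op H u)"
        by (intro conv_op_norm_le intros Hu less_imp_le[OF K(3)])
      also have "\<dots> \<le> \<delta> * C" using \<delta> Hu(2) by (intro mult_left_mono) auto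
      finally show "cmod (conv_op (\<lambda>\<theta>. F \<theta> - K \<theta>) (conv_op H u) n) \<le> \<delta> * C"
        by (intro order_trans[OF cmod_le_ell2_norm] conv_op_ell2[where B = \<delta>] intros Hu less_imp_le[OF K(3)])
    qed
    also have "\<dots> = \<delta> * (2 * C)" by (simp add: C_def algebra_simps)
    also have "\<dots> \<le> \<epsilon>" using \<open>C \<ge> 0\<close> e by (simp add: \<delta>_def field_simps)
    finally show ?thesis by simp
  qed
  from field_le_epsilon[OF this] show ?case by simp
qed

lemma conv_op_fourier_coeff:
  assumes "torus_continuous F" "torus_continuous H"
  shows "conv_op F (fourier_coeff H) n = fourier_coeff (\<lambda>\<theta>. F \<theta> * H \<theta>) n"
proof -
  \<comment> \<open>Convolution with the coefficients of 1, the unit of convolution, turns this into multiplicativity.\<close>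
  define \<delta> :: "int ^ 'a \<Rightarrow> complex" where "\<delta> = fourier_coeff (\<lambda>_. 1)"
  have "\<delta> \<in> ell2" unfolding \<delta>_def by (intro fourier_coeff_ell2 torus_continuous_intros)
  have conv: "conv_op K \<delta> = fourier_coeff K" for K :: "real ^ 'a \<Rightarrow> complex"
  proof
    fix n
    have "conv_op K \<delta> n = (\<Sum>\<^sub>\<infinity>m\<in>{0}. fourier_coeff K (n - m) * \<delta> m)"
      unfolding conv_op_reflect by (rule infsum_cong_neutral) (auto simp: \<delta>_def fourier_coeff_const)
    then show "conv_op K \<delta> n = fourier_coeff K n" by (simp add: \<delta>_def fourier_coeff_const)
  qed
  show ?thesis
    using conv_op_mult[OF assms \<open>\<delta> \<in> ell2\<close>, of n] by (simp add: conv)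
qed

section \<open>The operator as a convolution plus a phase\<close>

text \<open>
  \<open>H - z\<close> has this form with \<open>v = V - z\<close>; on the torus it is \<open>F(\<theta>) \<mapsto> v(\<theta>) F(\<theta>) + \<mu> F(\<theta> + \<beta>)\<close>
  by \<open>twisted_conv_fourier_coeff\<close> below.
\<close>

definition twisted_conv :: "(real ^ 'd \<Rightarrow> complex) \<Rightarrow> complex \<Rightarrow> real ^ 'd \<Rightarrow> (int ^ 'd \<Rightarrow> complex) \<Rightarrow> int ^ 'd \<Rightarrow> complex" where
  "twisted_conv v \<mu> \<beta> u n = conv_op v u n + \<mu> * torus_char n \<beta> * u n"

lemma H_op_minus_eq_twisted_conv:
  assumes "torus_continuous V" "u \<in> ell2"
  shows "H_op V \<alpha> lam \<omega> u n - z * u n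
    = twisted_conv (\<lambda>\<theta>. V \<theta> - z) (lam * exp (2 * of_real pi * \<i> * of_real \<omega>)) \<alpha> u n"
  using assms
  by (simp add: H_op_def twisted_conv_def conv_op_def[symmetric] conv_op_add_left conv_op_const
      torus_char_def distrib_left exp_add)

lemma twisted_conv_bounded:
  assumes "torus_continuous v"
  shows "ell2_bounded_operator (twisted_conv v \<mu> \<beta>)"
proof -
  have diag: "ell2_bounded_operator (\<lambda>u n. \<mu> * torus_char n \<beta> * u n)"
    unfolding ell2_bounded_operator_def mult.assoc ell2_norm_mult
    by (intro conjI exI[of _ "cmod \<mu>"])
       (auto intro!: ell2_mult simp: ell2_phase_iff ell2_norm_phase distrib_left)
  note conv = conv_op_bounded[OF assms]
  obtain K where K: "K > 0" "\<And>u. u \<in> ell2 \<Longrightarrow> ell2_norm (conv_op v u) \<le> K * ell2_norm u"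
    using ell2_op_bound[OF conv] by blast
  obtain L where L: "L > 0" "\<And>u. u \<in> ell2 \<Longrightarrow> ell2_norm (\<lambda>n. \<mu> * torus_char n \<beta> * u n) \<le> L * ell2_norm u"
    using ell2_op_bound[OF diag] by blast
  show ?thesis unfolding ell2_bounded_operator_def
  proof (intro conjI ballI allI exI)
    fix u :: "int ^ 'a \<Rightarrow> complex" assume u: "u \<in> ell2"
    show "twisted_conv v \<mu> \<beta> u \<in> ell2"
      using ell2_add[OF ell2_op_closed[OF conv u] ell2_op_closed[OF diag u]]
      by (simp add: twisted_conv_def[abs_def])
    show "twisted_conv v \<mu> \<beta> (\<lambda>n. c * u n) = (\<lambda>n. c * twisted_conv v \<mu> \<beta> u n)" for c
      by (simp add: twisted_conv_def conv_op_mult_right fun_eq_iff algebra_simps)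
    show "ell2_norm (twisted_conv v \<mu> \<beta> u) \<le> (K + L) * ell2_norm u"
      using ell2_norm_triangle[OF ell2_op_closed[OF conv u] ell2_op_closed[OF diag u]] K(2)[OF u] L(2)[OF u]
      by (simp add: twisted_conv_def[abs_def] distrib_right)
    fix w :: "int ^ 'a \<Rightarrow> complex" assume w: "w \<in> ell2"
    show "twisted_conv v \<mu> \<beta> (\<lambda>n. u n + w n) = (\<lambda>n. twisted_conv v \<mu> \<beta> u n + twisted_conv v \<mu> \<beta> w n)"
      by (simp add: twisted_conv_def conv_op_add_right assms u w fun_eq_iff algebra_simps)
  qed
qed

text \<open>
  The commutation rule between multiplication and translation on the torus, read on the lattice.
\<close>

lemma conv_op_phase:
  assumes "torus_continuous F"
  shows "conv_op F (\<lambda>n. torus_char n \<beta> * u n) n = torus_char n \<beta> * conv_op (\<lambda>\<theta>. F (\<theta> + - \<beta>)) u n"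
proof -
  have "conv_op F (\<lambda>n. torus_char n \<beta> * u n) n
    = (\<Sum>\<^sub>\<infinity>k. torus_char n \<beta> * (fourier_coeff (\<lambda>\<theta>. F (\<theta> + - \<beta>)) k * u (n - k)))"
    unfolding conv_op_def fourier_coeff_shift[OF assms] torus_char_uminus_right
    using torus_char_add_left[of n "- k" \<beta> for k] by (simp add: mult_ac)
  then show ?thesis unfolding conv_op_def by (simp add: infsum_cmult_right')
qed

lemma twisted_conv_fourier_coeff:
  assumes "torus_continuous v" "torus_continuous F"
  shows "twisted_conv v \<mu> \<beta> (fourier_coeff F) = fourier_coeff (\<lambda>\<theta>. v \<theta> * F \<theta> + \<mu> * F (\<theta> + \<beta>))"
  using assms
  by (intro ext) (simp add: twisted_conv_def conv_op_fourier_coeff fourier_coeff_add fourier_coeff_mult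
      fourier_coeff_shift torus_continuous_intros)

section \<open>Weighted shifts of spectral radius less than one\<close>

lemma weighted_shift_funpow:
  assumes "torus_continuous w" "u \<in> ell2"
  shows "((\<lambda>u n. torus_char n \<beta> * conv_op w u n) ^^ m) u
    = (\<lambda>n. torus_char n (of_nat m *\<^sub>R \<beta>) * conv_op (\<lambda>\<theta>. \<Prod>j<m. w (\<theta> + of_nat j *\<^sub>R - \<beta>)) u n)"
proof (induction m)
  case 0
  then show ?case by (simp add: conv_op_const)
next
  case (Suc m)
  let ?P = "\<lambda>\<theta>. \<Prod>j<m. w (\<theta> + of_nat j *\<^sub>R - \<beta>)"
  have P: "torus_continuous ?P" by (intro torus_continuous_intros assms)
  have s: "torus_continuous (\<lambda>\<theta>. w (\<theta> + - (of_nat m *\<^sub>R \<beta>)))" by (intro torus_continuous_intros assms)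
  have "((\<lambda>u n. torus_char n \<beta> * conv_op w u n) ^^ Suc m) u
    = (\<lambda>n. torus_char n \<beta> * conv_op w (\<lambda>n. torus_char n (of_nat m *\<^sub>R \<beta>) * conv_op ?P u n) n)"
    using Suc by simp
  also have "\<dots> = (\<lambda>n. torus_char n \<beta> * torus_char n (of_nat m *\<^sub>R \<beta>)
      * conv_op (\<lambda>\<theta>. w (\<theta> + - (of_nat m *\<^sub>R \<beta>)) * ?P \<theta>) u n)"
    unfolding conv_op_phase[OF assms(1)] conv_op_mult[OF s P assms(2)] by (simp add: mult.assoc)
  also have "\<dots> = (\<lambda>n. torus_char n (of_nat (Suc m) *\<^sub>R \<beta>) * conv_op (\<lambda>\<theta>. \<Prod>j<Suc m. w (\<theta> + of_nat j *\<^sub>R - \<beta>)) u n)"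
    by (simp add: torus_char_add_right[symmetric] scaleR_add_left mult.commute)
  finally show ?case .
qed

lemma weighted_shift_invertible:
  fixes w :: "real ^ 'd \<Rightarrow> complex"
  assumes w: "torus_continuous w" and "0 \<le> C" "0 \<le> r" "r < 1"
    and decay: "\<And>m \<theta>. (\<Prod>j<m. cmod (w (\<theta> + of_nat j *\<^sub>R - \<beta>))) \<le> C * r ^ m"
  shows "ell2_invertible (\<lambda>u n. u n - torus_char n \<beta> * conv_op w u n)"
proof (rule ell2_Neumann_series)
  let ?B = "\<lambda>u n. torus_char n \<beta> * conv_op w u n"
  have cl: "conv_op w u \<in> ell2" if "u \<in> ell2" for u by (rule ell2_op_closed[OF conv_op_bounded[OF w] that])
  obtain K where K: "\<And>u. u \<in> ell2 \<Longrightarrow> ell2_norm (conv_op w u) \<le> K * ell2_norm u"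
    using ell2_op_bound[OF conv_op_bounded[OF w]] by blast
  show "ell2_bounded_operator ?B"
    unfolding ell2_bounded_operator_def using cl K
    by (intro conjI exI[of _ K])
       (auto simp: ell2_phase_iff ell2_norm_phase conv_op_add_right[OF w] conv_op_mult_right distrib_left)
  show "ell2_norm ((?B ^^ m) u) \<le> (C * r ^ m) * ell2_norm u" if "u \<in> ell2" for m u
    unfolding weighted_shift_funpow[OF w that] ell2_norm_phase[OF norm_torus_char]
    by (intro conv_op_norm_le torus_continuous_intros w that) (use decay in \<open>simp add: prod_norm[symmetric]\<close>)
  show "summable (\<lambda>m. C * r ^ m)" using assms by (intro summable_mult summable_geometric) auto
  show "0 \<le> C * r ^ m" for m using assms by simp
qed

text \<open>
  By unique ergodicity the products of a weight along orbits decay exponentially, and uniformly in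
  the base point, as soon as a continuous majorant of its logarithm has negative mean.
\<close>

lemma orbit_products_decay:
  fixes h :: "real ^ 'd \<Rightarrow> real"
  assumes h: "torus_continuous h" "\<And>\<theta>. cmod (w \<theta>) \<le> exp (h \<theta>)" "torus_int h < 0"
    and \<beta>: "totally_irrational \<beta>"
  obtains C r where "0 \<le> C" "0 \<le> r" "r < 1" "\<And>m \<theta>. (\<Prod>j<m. cmod (w (\<theta> + of_nat j *\<^sub>R \<beta>))) \<le> C * r ^ m"
proof -
  define \<eta> where "\<eta> = - torus_int h / 2"
  have \<eta>: "\<eta> > 0" "torus_int h = - 2 * \<eta>" using h(3) by (auto simp: \<eta>_def)
  obtain N where N: "\<And>n \<theta>. n \<ge> N \<Longrightarrow> \<bar>(\<Sum>j<n. h (\<theta> + of_nat j *\<^sub>R \<beta>)) - n * torus_int h\<bar> \<le> n * \<eta>"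
    using irrational_rotation_real_averages[OF h(1) \<beta> \<eta>(1)] by blast
  obtain B0 where "B0 > 0" and B0: "\<And>\<theta>. norm (h \<theta>) \<le> B0" using torus_continuous_bounded[OF h(1)] by blast
  define B where "B = exp B0"
  define r where "r = exp (- \<eta>)"
  have B: "B \<ge> 1" using \<open>B0 > 0\<close> by (simp add: B_def)
  have r: "0 < r" "r < 1" using \<eta> by (auto simp: r_def)
  have wB: "cmod (w \<theta>) \<le> B" for \<theta>
    using h(2)[of \<theta>] B0[of \<theta>] unfolding B_def by (auto intro: order_trans simp: abs_le_iff)
  \<comment> \<open>Unique ergodicity gives the rate from \<open>N\<close> on; the constant \<open>(B/r)\<^sup>N\<close> absorbs the shorter products.\<close>
  have C1: "B ^ N / r ^ N \<ge> 1" using B r by (simp add: le_divide_eq) (metis power_le_one one_le_power order_trans less_imp_le)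
  have "(\<Prod>j<m. cmod (w (\<theta> + of_nat j *\<^sub>R \<beta>))) \<le> B ^ N / r ^ N * r ^ m" for m \<theta>
  proof (cases "m \<ge> N")
    case True
    have "(\<Prod>j<m. cmod (w (\<theta> + of_nat j *\<^sub>R \<beta>))) \<le> (\<Prod>j<m. exp (h (\<theta> + of_nat j *\<^sub>R \<beta>)))"
      by (intro prod_mono) (auto intro: h(2))
    also have "\<dots> = exp (\<Sum>j<m. h (\<theta> + of_nat j *\<^sub>R \<beta>))" by (simp add: exp_sum)
    also have "\<dots> \<le> exp (real m * - \<eta>)"
      using N[OF True, of \<theta>] unfolding \<eta>(2) by (simp add: abs_le_iff algebra_simps)
    also have "\<dots> = r ^ m" unfolding r_def by (rule exp_of_nat_mult)
    also have "\<dots> \<le> B ^ N / r ^ N * r ^ m" using mult_right_mono[OF C1, of "r ^ m"] r by simp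
    finally show ?thesis .
  next
    case False
    have "(\<Prod>j<m. cmod (w (\<theta> + of_nat j *\<^sub>R \<beta>))) \<le> (\<Prod>j<m. B)"
      by (intro prod_mono) (auto intro: wB)
    also have "\<dots> \<le> B ^ N" using B False by (simp add: power_increasing)
    also have "\<dots> \<le> B ^ N * (r ^ m / r ^ N)"
      using B r False by (simp add: le_divide_eq power_decreasing)
    finally show ?thesis by simp
  qed
  then show ?thesis using that[of "B ^ N / r ^ N" r] C1 r by (meson less_imp_le order_trans zero_le_one)
qed

section \<open>Truncated logarithms\<close>

lemma log_dist_in_L1D:
  fixes V :: "real ^ 'd \<Rightarrow> complex"
  assumes "log_dist_in_L1 V z"
  shows "AE \<theta> in lborel. \<theta> \<in> unit_cube \<longrightarrow> V \<theta> \<noteq> z"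
    "set_integrable lborel unit_cube (\<lambda>\<theta>. ln (cmod (V \<theta> - z)))"
    "G V z = torus_int (\<lambda>\<theta>. ln (cmod (V \<theta> - z)))"
  using assms by (auto simp: log_dist_in_L1_def G_def torus_int_def norm_minus_commute)

lemma torus_continuous_ln_max:
  assumes "torus_continuous v" "t > 0"
  shows "torus_continuous (\<lambda>\<theta>. ln (max t (cmod (v \<theta>))))"
  using assms by (intro torus_continuous_intros) (auto simp: less_max_iff_disj)

lemma G_le_truncated:
  assumes "torus_continuous V" "log_dist_in_L1 V z" "t > 0"
  shows "G V z \<le> torus_int (\<lambda>\<theta>. ln (max t (cmod (V \<theta> - z))))"
  unfolding log_dist_in_L1D(3)[OF assms(2)] torus_int_def
proof (rule set_integral_mono_AE)
  show "set_integrable lborel unit_cube (\<lambda>\<theta>. ln (cmod (V \<theta> - z)))"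
    by (rule log_dist_in_L1D[OF assms(2)])
  show "set_integrable lborel unit_cube (\<lambda>\<theta>. ln (max t (cmod (V \<theta> - z))))"
    by (intro torus_integrable torus_continuous_ln_max torus_continuous_intros assms)
  show "AE \<theta>\<in>unit_cube in lborel. ln (cmod (V \<theta> - z)) \<le> ln (max t (cmod (V \<theta> - z)))"
    using log_dist_in_L1D(1)[OF assms(2)] by eventually_elim (auto intro: ln_mono)
qed

text \<open>
  Raising \<open>\<bar>V - z\<bar>\<close> to at least \<open>t \<le> 1\<close> can only decrease the absolute value of its logarithm, hence
  dominated convergence applies.
\<close>

lemma truncated_tendsto_G:
  fixes V :: "real ^ 'd \<Rightarrow> complex"
  assumes V: "torus_continuous V" and L1: "log_dist_in_L1 V z" and "\<delta> > 0"
  obtains t where "t > 0" "torus_int (\<lambda>\<theta>. ln (max t (cmod (V \<theta> - z)))) < G V z + \<delta>"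
proof -
  note log = log_dist_in_L1D[OF L1]
  define f where "f m \<theta> = indicator unit_cube \<theta> *\<^sub>R ln (max (inverse (Suc m)) (cmod (V \<theta> - z)))" for m \<theta>
  have cont: "torus_continuous (\<lambda>\<theta>. ln (max (inverse (Suc m)) (cmod (V \<theta> - z))))" for m
    by (intro torus_continuous_ln_max torus_continuous_intros V) simp
  have "(\<lambda>m. \<integral>\<theta>. f m \<theta> \<partial>lborel) \<longlonglongrightarrow> (\<integral>\<theta>. indicator unit_cube \<theta> *\<^sub>R ln (cmod (V \<theta> - z)) \<partial>lborel)"
  proof (rule integral_dominated_convergence)
    show "(\<lambda>\<theta>. indicator unit_cube \<theta> *\<^sub>R ln (cmod (V \<theta> - z))) \<in> borel_measurable lborel"
      using log(2) unfolding set_integrable_def by (rule borel_measurable_integrable)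
    show "f m \<in> borel_measurable lborel" for m
      using torus_integrable[OF cont[of m]] unfolding set_integrable_def f_def[abs_def]
      by (rule borel_measurable_integrable)
    show "integrable lborel (\<lambda>\<theta>. \<bar>indicator unit_cube \<theta> *\<^sub>R ln (cmod (V \<theta> - z))\<bar>)"
      using log(2) unfolding set_integrable_def by (rule integrable_abs)
    show "AE \<theta> in lborel. (\<lambda>m. f m \<theta>) \<longlonglongrightarrow> indicator unit_cube \<theta> *\<^sub>R ln (cmod (V \<theta> - z))"
      using log(1)
    proof eventually_elim
      case (elim \<theta>)
      have "(\<lambda>m. ln (max (inverse (real (Suc m))) (cmod (V \<theta> - z)))) \<longlonglongrightarrow> ln (max 0 (cmod (V \<theta> - z)))"
        if "V \<theta> \<noteq> z" using that
        by (intro tendsto_intros LIMSEQ_inverse_real_of_nat) (auto simp: max_def)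
      then show ?case using elim by (cases "\<theta> \<in> unit_cube") (auto simp: f_def max_absorb2)
    qed
    show "AE \<theta> in lborel. norm (f m \<theta>) \<le> \<bar>indicator unit_cube \<theta> *\<^sub>R ln (cmod (V \<theta> - z))\<bar>" for m
      using log(1)
    proof eventually_elim
      case (elim \<theta>)
      have "\<bar>ln (max \<epsilon> x)\<bar> \<le> \<bar>ln x\<bar>" if "0 < x" "0 < \<epsilon>" "\<epsilon> \<le> 1" for x \<epsilon> :: real
      proof (cases "\<epsilon> \<le> x")
        case False
        then have "ln x \<le> ln \<epsilon>" "ln \<epsilon> \<le> 0" using that by auto
        then show ?thesis using False by (simp add: max_def)
      qed (simp add: max_def)
      from this[of "cmod (V \<theta> - z)" "inverse (Suc m)"] show ?case
        using elim by (cases "\<theta> \<in> unit_cube") (auto simp: f_def inverse_le_1_iff)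
    qed
  qed
  then have "(\<lambda>m. torus_int (\<lambda>\<theta>. ln (max (inverse (Suc m)) (cmod (V \<theta> - z))))) \<longlonglongrightarrow> G V z"
    unfolding log(3) f_def torus_int_def set_lebesgue_integral_def .
  then have "\<forall>\<^sub>F m in sequentially. torus_int (\<lambda>\<theta>. ln (max (inverse (Suc m)) (cmod (V \<theta> - z)))) < G V z + \<delta>"
    using \<open>\<delta> > 0\<close> by (intro order_tendstoD(2)) auto
  then obtain m where "torus_int (\<lambda>\<theta>. ln (max (inverse (Suc m)) (cmod (V \<theta> - z)))) < G V z + \<delta>"
    using eventually_happens sequentially_bot by blast
  then show ?thesis using that[of "inverse (Suc m)"] by simp
qed

section \<open>The resolvent set\<close>

lemma totally_irrational_uminus: "totally_irrational \<beta> \<Longrightarrow> totally_irrational (- \<beta>)"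
  unfolding totally_irrational_def torus_char_uminus_right by (metis neg_equal_0_iff_equal)

lemma conv_op_invertible:
  assumes v: "torus_continuous v" and nz: "\<And>\<theta>. v \<theta> \<noteq> 0"
  shows "ell2_invertible (conv_op v)"
proof -
  have i: "torus_continuous (\<lambda>\<theta>. 1 / v \<theta>)" using v nz by (intro torus_continuous_intros)
  have "conv_op (\<lambda>\<theta>. 1 / v \<theta>) (conv_op v u) = u" "conv_op v (conv_op (\<lambda>\<theta>. 1 / v \<theta>) u) = u" if "u \<in> ell2" for u
    using conv_op_mult[OF i v that] conv_op_mult[OF v i that] nz by (auto simp: fun_eq_iff conv_op_const)
  then show ?thesis unfolding ell2_invertible_def
    using conv_op_bounded[OF v] conv_op_bounded[OF i] ell2_op_closed by blast
qed

lemma phase_invertible: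
  assumes "\<mu> \<noteq> 0" shows "ell2_invertible (\<lambda>u n. \<mu> * torus_char n \<beta> * u n)"
  unfolding ell2_invertible_def
proof (intro conjI ballI exI)
  have *: "inverse \<mu> * torus_char n (- \<beta>) * (\<mu> * torus_char n \<beta> * x) = x"
      "\<mu> * torus_char n \<beta> * (inverse \<mu> * torus_char n (- \<beta>) * x) = x" for n x
    using assms by (simp_all add: torus_char_uminus_right torus_char_uminus_left field_simps)
  show "ell2_bounded_operator (\<lambda>u n. inverse \<mu> * torus_char n (- \<beta>) * u n)"
    using twisted_conv_bounded[of "\<lambda>_. 0" "inverse \<mu>" "- \<beta>"]
    by (simp add: twisted_conv_def[abs_def] conv_op_const)
  fix u :: "int ^ 'a \<Rightarrow> complex" assume u: "u \<in> ell2"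
  show "(\<lambda>n. \<mu> * torus_char n \<beta> * u n) \<in> ell2"
    unfolding mult.assoc using u by (intro ell2_mult) (simp add: ell2_phase_iff)
  show "(\<lambda>n. inverse \<mu> * torus_char n (- \<beta>) * (\<mu> * torus_char n \<beta> * u n)) = u"
    "(\<lambda>n. \<mu> * torus_char n \<beta> * (inverse \<mu> * torus_char n (- \<beta>) * u n)) = u"
    by (simp_all only: *)
qed

text \<open>
  Here the translation dominates: the operator is \<open>\<mu>\<close> times a phase times the identity minus a
  weighted shift with weight \<open>- v / \<mu>\<close> over the inverse rotation.
\<close>

lemma twisted_conv_invertible_subcritical:
  fixes V :: "real ^ 'd \<Rightarrow> complex"
  assumes V: "torus_continuous V" and L1: "log_dist_in_L1 V z" and \<alpha>: "totally_irrational \<alpha>"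
    and \<mu>: "\<mu> \<noteq> 0" "G V z < ln (cmod \<mu>)"
  shows "ell2_invertible (twisted_conv (\<lambda>\<theta>. V \<theta> - z) \<mu> \<alpha>)"
proof -
  define v where "v \<theta> = V \<theta> - z" for \<theta>
  define w where "w \<theta> = (- 1 / \<mu>) * v \<theta>" for \<theta>
  have v: "torus_continuous v" unfolding v_def by (intro torus_continuous_intros V)
  have w: "torus_continuous w" unfolding w_def by (intro torus_continuous_intros v)
  obtain t where t: "t > 0" "torus_int (\<lambda>\<theta>. ln (max t (cmod (v \<theta>)))) < ln (cmod \<mu>)"
    using truncated_tendsto_G[OF V L1, of "ln (cmod \<mu>) - G V z"] \<mu>(2) unfolding v_def by auto
  define h where "h \<theta> = ln (max t (cmod (v \<theta>))) - ln (cmod \<mu>)" for \<theta>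
  have h: "torus_continuous h" unfolding h_def by (intro torus_continuous_intros torus_continuous_ln_max v t)
  have "cmod (w \<theta>) \<le> exp (h \<theta>)" for \<theta>
    using \<mu> t by (simp add: h_def w_def exp_diff norm_mult norm_divide less_max_iff_disj divide_right_mono)
  moreover have "torus_int h < 0"
    unfolding h_def using t
    by (subst torus_int_add) (auto intro!: torus_continuous_intros torus_continuous_ln_max v simp: torus_int_const)
  ultimately obtain C r where "0 \<le> C" "0 \<le> r" "r < 1"
    "\<And>m \<theta>. (\<Prod>j<m. cmod (w (\<theta> + of_nat j *\<^sub>R \<alpha>))) \<le> C * r ^ m"
    using orbit_products_decay[OF h _ _ \<alpha>] by blast
  then have I: "ell2_invertible (\<lambda>u n. u n - torus_char n (- \<alpha>) * conv_op w u n)"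
    by (intro weighted_shift_invertible[OF w]) simp_all
  have "ell2_invertible (twisted_conv v \<mu> \<alpha>)"
  proof (rule ell2_invertible_compose[OF phase_invertible[OF \<mu>(1), of \<alpha>] I])
    show "twisted_conv v \<mu> \<alpha> u = (\<lambda>n. \<mu> * torus_char n \<alpha> * (u n - torus_char n (- \<alpha>) * conv_op w u n))" for u
      unfolding twisted_conv_def w_def conv_op_mult_left torus_char_uminus_right torus_char_uminus_left
      using \<mu> by (simp add: fun_eq_iff field_simps)
  qed
  then show ?thesis by (simp add: v_def[abs_def])
qed

text \<open>
  Here the multiplication by \<open>v\<close> dominates, and it is invertible because \<open>v\<close> has no zero. Moving the
  phase to the left of the convolution translates the weight \<open>- \<mu> / v\<close> by \<open>- \<alpha>\<close>.
\<close>

lemma twisted_conv_invertible_supercritical: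
  fixes V :: "real ^ 'd \<Rightarrow> complex"
  assumes V: "torus_continuous V" and L1: "log_dist_in_L1 V z" and \<alpha>: "totally_irrational \<alpha>"
    and \<mu>: "\<mu> \<noteq> 0" "ln (cmod \<mu>) < G V z" and z: "z \<notin> range V"
  shows "ell2_invertible (twisted_conv (\<lambda>\<theta>. V \<theta> - z) \<mu> \<alpha>)"
proof -
  define v where "v \<theta> = V \<theta> - z" for \<theta>
  have v: "torus_continuous v" unfolding v_def by (intro torus_continuous_intros V)
  have nz: "v \<theta> \<noteq> 0" for \<theta> using z by (auto simp: v_def)
  define w where "w \<theta> = - \<mu> / v (\<theta> + - \<alpha>)" for \<theta>
  have w: "torus_continuous w" unfolding w_def using nz by (intro torus_continuous_intros v)
  define h where "h \<theta> = ln (cmod \<mu>) - ln (cmod (v (\<theta> + - \<alpha>)))" for \<theta>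
  have l: "torus_continuous (\<lambda>\<theta>. ln (cmod (v \<theta>)))" using nz by (intro torus_continuous_intros v) auto
  have h: "torus_continuous h"
    unfolding h_def by (rule torus_continuous_arith(2)[OF torus_continuous_const torus_continuous_shift[OF l]])
  have "cmod (w \<theta>) \<le> exp (h \<theta>)" for \<theta>
    using \<mu> nz by (simp add: h_def w_def exp_diff norm_divide)
  moreover have "torus_int h < 0"
    unfolding h_def using \<mu>(2) log_dist_in_L1D(3)[OF L1] torus_int_shift_real[OF l, of "- \<alpha>"]
    by (subst torus_int_add(2)[OF torus_continuous_const torus_continuous_shift[OF l]])
       (simp add: torus_int_const v_def)
  ultimately obtain C r where "0 \<le> C" "0 \<le> r" "r < 1"
    "\<And>m \<theta>. (\<Prod>j<m. cmod (w (\<theta> + of_nat j *\<^sub>R - \<alpha>))) \<le> C * r ^ m"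
    using orbit_products_decay[OF h _ _ totally_irrational_uminus[OF \<alpha>]] by blast
  then have I: "ell2_invertible (\<lambda>u n. u n - torus_char n \<alpha> * conv_op w u n)"
    by (intro weighted_shift_invertible[OF w]) simp_all
  have "ell2_invertible (twisted_conv v \<mu> \<alpha>)"
  proof (rule ell2_invertible_compose[OF conv_op_invertible[OF v nz] I])
    fix u :: "int ^ 'd \<Rightarrow> complex" assume u: "u \<in> ell2"
    define u' where "u' n = torus_char n \<alpha> * u n" for n
    have u': "u' \<in> ell2" using u by (simp add: u'_def[abs_def] ell2_phase_iff)
    have i: "torus_continuous (\<lambda>\<theta>. (- \<mu>) / v \<theta>)" using nz by (intro torus_continuous_intros v)
    have wu: "torus_char n \<alpha> * conv_op w u n = conv_op (\<lambda>\<theta>. (- \<mu>) / v \<theta>) u' n" for n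
      unfolding u'_def[abs_def] conv_op_phase[OF i] w_def ..
    show "twisted_conv v \<mu> \<alpha> u = conv_op v (\<lambda>n. u n - torus_char n \<alpha> * conv_op w u n)"
      unfolding wu ell2_op_diff[OF conv_op_bounded[OF v] u ell2_op_closed[OF conv_op_bounded[OF i] u']]
        conv_op_mult[OF v i u', symmetric]
      using nz by (simp add: fun_eq_iff twisted_conv_def conv_op_const u'_def mult.assoc)
  qed
  then show ?thesis by (simp add: v_def[abs_def])
qed

section \<open>Lower bounds on the torus\<close>

definition torus_inner :: "(real ^ 'd \<Rightarrow> complex) \<Rightarrow> (real ^ 'd \<Rightarrow> complex) \<Rightarrow> complex" where
  "torus_inner F H = torus_int (\<lambda>\<theta>. F \<theta> * cnj (H \<theta>))"

lemma torus_inner_self: "torus_inner F F = complex_of_real (torus_sq F)"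
  unfolding torus_inner_def torus_sq_def torus_int_of_real[symmetric]
  by (simp only: complex_norm_square)

lemma torus_sq_diff:
  assumes "torus_continuous F" "torus_continuous H"
  shows "torus_sq (\<lambda>\<theta>. F \<theta> - c * H \<theta>) = torus_sq F - 2 * Re (cnj c * torus_inner F H) + (cmod c)\<^sup>2 * torus_sq H"
proof -
  have "(cmod (a - c * b))\<^sup>2 = (cmod a)\<^sup>2 - 2 * Re (cnj c * (a * cnj b)) + (cmod c)\<^sup>2 * (cmod b)\<^sup>2" for a b
  proof -
    have "(cmod (x - y))\<^sup>2 = (cmod x)\<^sup>2 - 2 * Re (cnj y * x) + (cmod y)\<^sup>2" for x y
      unfolding cmod_power2 by (simp add: power2_eq_square algebra_simps)
    from this[of a "c * b"] show ?thesis by (simp add: norm_mult power_mult_distrib mult_ac)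
  qed
  then have "torus_sq (\<lambda>\<theta>. F \<theta> - c * H \<theta>)
    = torus_int (\<lambda>\<theta>. (cmod (F \<theta>))\<^sup>2 - 2 * Re (cnj c * (F \<theta> * cnj (H \<theta>))) + (cmod c)\<^sup>2 * (cmod (H \<theta>))\<^sup>2)"
    unfolding torus_sq_def by (simp only:)
  also have "\<dots> = torus_sq F - 2 * torus_int (\<lambda>\<theta>. Re (cnj c * (F \<theta> * cnj (H \<theta>)))) + (cmod c)\<^sup>2 * torus_sq H"
  proof -
    have p: "torus_continuous (\<lambda>\<theta>. cnj c * (F \<theta> * cnj (H \<theta>)))"
      by (intro torus_continuous_intros assms)
    have p: "torus_continuous (\<lambda>\<theta>. Re (cnj c * (F \<theta> * cnj (H \<theta>))))"
      by (rule torus_continuous_compose[OF p]) (intro continuous_intros)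
    then show ?thesis unfolding torus_sq_def
      by (subst torus_int_add torus_int_mult | intro torus_continuous_intros p assms | assumption)+ simp
  qed
  also have "torus_int (\<lambda>\<theta>. Re (cnj c * (F \<theta> * cnj (H \<theta>)))) = Re (cnj c * torus_inner F H)"
    by (subst torus_int_Re) (auto intro!: torus_continuous_intros assms simp: torus_int_mult torus_inner_def)
  finally show ?thesis .
qed

lemma torus_Cauchy_Schwarz:
  assumes "torus_continuous F" "torus_continuous H"
  shows "cmod (torus_inner F H) \<le> sqrt (torus_sq F) * sqrt (torus_sq H)"
proof -
  define I where "I = torus_inner F H"
  have q: "0 \<le> torus_sq F - 2 * t * (cmod I)\<^sup>2 + t\<^sup>2 * (cmod I)\<^sup>2 * torus_sq H" for t :: real
  proof -
    have "0 \<le> torus_sq (\<lambda>\<theta>. F \<theta> - (complex_of_real t * I) * H \<theta>)"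
      by (intro torus_sq_nonneg torus_continuous_intros assms)
    moreover have "Re (cnj (complex_of_real t * I) * I) = t * (cmod I)\<^sup>2"
      by (simp add: cmod_power2) (simp add: power2_eq_square algebra_simps)
    ultimately show ?thesis unfolding torus_sq_diff[OF assms] I_def[symmetric]
      by (simp add: norm_mult power_mult_distrib)
  qed
  have "(cmod I)\<^sup>2 \<le> torus_sq F * torus_sq H"
  proof (cases "torus_sq H = 0")
    case True
    have "I = 0"
    proof (rule ccontr)
      assume "I \<noteq> 0"
      then have "(cmod I)\<^sup>2 > 0" by simp
      moreover have "0 \<le> torus_sq F - 2 * (torus_sq F + 1)"
        using q[of "(torus_sq F + 1) / (cmod I)\<^sup>2"] True \<open>I \<noteq> 0\<close> by simp
      ultimately show False using torus_sq_nonneg[OF assms(1)] by simp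
    qed
    then show ?thesis using True by simp
  next
    case False
    then have "torus_sq H > 0" using torus_sq_nonneg[OF assms(2)] by simp
    with q[of "1 / torus_sq H"] show ?thesis by (simp add: field_simps power2_eq_square)
  qed
  then show ?thesis unfolding I_def by (metis real_le_rsqrt real_sqrt_mult)
qed

lemma symbol_lower_bound:
  assumes v: "torus_continuous v" and inv: "ell2_invertible (twisted_conv v \<mu> \<alpha>)"
  obtains K where "K > 0"
    "\<And>F. torus_continuous F \<Longrightarrow> torus_sq F \<le> K * torus_sq (\<lambda>\<theta>. v \<theta> * F \<theta> + \<mu> * F (\<theta> + \<alpha>))"
proof -
  obtain R where R: "ell2_bounded_operator R" "\<And>u. u \<in> ell2 \<Longrightarrow> R (twisted_conv v \<mu> \<alpha> u) = u"
    using inv by (auto simp: ell2_invertible_def)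
  obtain K where K: "K > 0" "\<And>u. u \<in> ell2 \<Longrightarrow> ell2_norm (R u) \<le> K * ell2_norm u"
    using ell2_op_bound[OF R(1)] by blast
  have "torus_sq F \<le> K\<^sup>2 * torus_sq (\<lambda>\<theta>. v \<theta> * F \<theta> + \<mu> * F (\<theta> + \<alpha>))" (is "_ \<le> _ * torus_sq ?D")
    if F: "torus_continuous F" for F
  proof -
    have D: "torus_continuous ?D" by (intro torus_continuous_intros v F)
    have "ell2_norm (fourier_coeff F) \<le> K * ell2_norm (twisted_conv v \<mu> \<alpha> (fourier_coeff F))"
      using K(2)[OF ell2_op_closed[OF twisted_conv_bounded[OF v, of \<mu> \<alpha>] fourier_coeff_ell2[OF F]]]
      by (simp add: R(2) fourier_coeff_ell2 F)
    then have "sqrt (torus_sq F) \<le> K * sqrt (torus_sq ?D)"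
      by (simp add: twisted_conv_fourier_coeff[OF v F] Parseval F D)
    then have "(sqrt (torus_sq F))\<^sup>2 \<le> (K * sqrt (torus_sq ?D))\<^sup>2"
      using torus_sq_nonneg[OF F] by (intro power_mono) auto
    then show ?thesis using torus_sq_nonneg[OF F] torus_sq_nonneg[OF D] by (simp add: power_mult_distrib)
  qed
  then show ?thesis using that[of "K\<^sup>2"] K(1) by simp
qed

lemma symbol_adjoint:
  assumes "torus_continuous v" "torus_continuous F" "torus_continuous H"
  shows "torus_inner F (\<lambda>\<theta>. v \<theta> * H \<theta> + \<mu> * H (\<theta> + \<alpha>))
    = torus_inner (\<lambda>\<theta>. cnj (v \<theta>) * F \<theta> + cnj \<mu> * F (\<theta> + - \<alpha>)) H"
proof -
  have "torus_inner F (\<lambda>\<theta>. v \<theta> * H \<theta> + \<mu> * H (\<theta> + \<alpha>))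
    = torus_int (\<lambda>\<theta>. cnj (v \<theta>) * F \<theta> * cnj (H \<theta>) + cnj \<mu> * (F \<theta> * cnj (H (\<theta> + \<alpha>))))"
    unfolding torus_inner_def by (simp add: algebra_simps)
  also have "\<dots> = torus_int (\<lambda>\<theta>. cnj (v \<theta>) * F \<theta> * cnj (H \<theta>)) + cnj \<mu> * torus_int (\<lambda>\<theta>. F \<theta> * cnj (H (\<theta> + \<alpha>)))"
    by (subst torus_int_add) (auto intro!: torus_continuous_intros assms simp: torus_int_mult)
  also have "torus_int (\<lambda>\<theta>. F \<theta> * cnj (H (\<theta> + \<alpha>))) = torus_int (\<lambda>\<theta>. F (\<theta> + - \<alpha>) * cnj (H \<theta>))"
  proof -
    have "torus_continuous (\<lambda>\<theta>. F (\<theta> + - \<alpha>) * cnj (H \<theta>))" by (intro torus_continuous_intros assms)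
    from torus_int_shift[OF this, of \<alpha>] show ?thesis by simp
  qed
  also have "torus_int (\<lambda>\<theta>. cnj (v \<theta>) * F \<theta> * cnj (H \<theta>)) + cnj \<mu> * torus_int (\<lambda>\<theta>. F (\<theta> + - \<alpha>) * cnj (H \<theta>))
    = torus_int (\<lambda>\<theta>. cnj (v \<theta>) * F \<theta> * cnj (H \<theta>) + cnj \<mu> * (F (\<theta> + - \<alpha>) * cnj (H \<theta>)))"
    by (subst torus_int_add) (auto intro!: torus_continuous_intros torus_continuous_shift[OF assms(2), of "- \<alpha>", simplified] assms simp: torus_int_mult)
  also have "\<dots> = torus_inner (\<lambda>\<theta>. cnj (v \<theta>) * F \<theta> + cnj \<mu> * F (\<theta> + - \<alpha>)) H"
    unfolding torus_inner_def by (simp add: algebra_simps)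
  finally show ?thesis .
qed

text \<open>
  The adjoint of an invertible operator is bounded below since \<open>\<parallel>F\<parallel>\<^sup>2 = \<langle>F, A R F\<rangle> = \<langle>A\<^sup>* F, R F\<rangle>\<close>. The
  inverse \<open>R\<close> is only known on sequences, so \<open>R F\<close> is replaced by a trigonometric polynomial \<open>P\<close>
  close to it, for which the adjoint can be computed on the torus.
\<close>

lemma adjoint_symbol_lower_bound:
  fixes v :: "real ^ 'd \<Rightarrow> complex"
  assumes v: "torus_continuous v" and inv: "ell2_invertible (twisted_conv v \<mu> \<alpha>)"
  obtains K where "K > 0"
    "\<And>F. torus_continuous F \<Longrightarrow> torus_sq F \<le> K * torus_sq (\<lambda>\<theta>. cnj (v \<theta>) * F \<theta> + cnj \<mu> * F (\<theta> + - \<alpha>))"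
proof -
  let ?A = "twisted_conv v \<mu> \<alpha>"
  note A = twisted_conv_bounded[OF v, of \<mu> \<alpha>]
  obtain R where R: "ell2_bounded_operator R" "\<And>u. u \<in> ell2 \<Longrightarrow> ?A (R u) = u"
    using inv by (auto simp: ell2_invertible_def)
  obtain K where K: "K > 0" "\<And>u. u \<in> ell2 \<Longrightarrow> ell2_norm (R u) \<le> K * ell2_norm u"
    using ell2_op_bound[OF R(1)] by blast
  obtain L where L: "L > 0" "\<And>u. u \<in> ell2 \<Longrightarrow> ell2_norm (?A u) \<le> L * ell2_norm u"
    using ell2_op_bound[OF A] by blast
  have "torus_sq F \<le> K\<^sup>2 * torus_sq (\<lambda>\<theta>. cnj (v \<theta>) * F \<theta> + cnj \<mu> * F (\<theta> + - \<alpha>))" (is "_ \<le> _ * torus_sq ?D")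
    if F: "torus_continuous F" for F
  proof -
    have D: "torus_continuous ?D" by (intro torus_continuous_intros v F)
    define s where "s = sqrt (torus_sq F)"
    define t where "t = sqrt (torus_sq ?D)"
    have s: "s \<ge> 0" "torus_sq F = s\<^sup>2" using torus_sq_nonneg[OF F] by (auto simp: s_def)
    have t: "t \<ge> 0" "torus_sq ?D = t\<^sup>2" using torus_sq_nonneg[OF D] by (auto simp: t_def)
    note F2 = fourier_coeff_ell2[OF F]
    note RF = ell2_op_closed[OF R(1) F2]
    have bound: "s\<^sup>2 \<le> t * (K * s) + \<epsilon> * (s * L + t)" if "\<epsilon> > 0" for \<epsilon>
    proof -
      obtain P where P: "trig_poly P" "ell2_norm (\<lambda>n. R (fourier_coeff F) n - fourier_coeff P n) \<le> \<epsilon>"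
        using ell2_trig_poly_dense[OF RF \<open>\<epsilon> > 0\<close>] by blast
      note Pc = trig_poly_continuous[OF P(1)]
      note P2 = fourier_coeff_ell2[OF Pc]
      let ?E = "\<lambda>\<theta>. v \<theta> * P \<theta> + \<mu> * P (\<theta> + \<alpha>)"
      have E: "torus_continuous ?E" by (intro torus_continuous_intros v Pc)
      have FE: "torus_continuous (\<lambda>\<theta>. F \<theta> - ?E \<theta>)" by (intro torus_continuous_arith F E)
      have "sqrt (torus_sq P) \<le> ell2_norm (R (fourier_coeff F)) + \<epsilon>"
        using ell2_norm_triangle_diff[OF P2 RF] P(2) by (simp add: Parseval[OF Pc] ell2_norm_diff_commute)
      also have "\<dots> \<le> K * s + \<epsilon>" using K(2)[OF F2] by (simp add: Parseval[OF F] s_def)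
      finally have p: "sqrt (torus_sq P) \<le> K * s + \<epsilon>" .
      have "sqrt (torus_sq (\<lambda>\<theta>. F \<theta> - ?E \<theta>)) = ell2_norm (\<lambda>n. fourier_coeff F n - ?A (fourier_coeff P) n)"
        unfolding twisted_conv_fourier_coeff[OF v Pc] Parseval[OF FE, symmetric]
        by (simp add: fourier_coeff_diff[OF F E, abs_def])
      also have "\<dots> = ell2_norm (?A (\<lambda>n. R (fourier_coeff F) n - fourier_coeff P n))"
        unfolding ell2_op_diff[OF A RF P2] R(2)[OF F2] ..
      also have "\<dots> \<le> L * \<epsilon>"
        by (rule order_trans[OF L(2)[OF ell2_diff[OF RF P2]]]) (use P(2) L(1) in simp)
      finally have e: "sqrt (torus_sq (\<lambda>\<theta>. F \<theta> - ?E \<theta>)) \<le> L * \<epsilon>" .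
      have "torus_inner F F = torus_inner F (\<lambda>\<theta>. F \<theta> - ?E \<theta>) + torus_inner ?D P"
      proof -
        have "torus_inner F (\<lambda>\<theta>. F \<theta> - ?E \<theta>) = torus_inner F F - torus_inner F ?E"
          unfolding torus_inner_def complex_cnj_diff right_diff_distrib
          by (rule torus_int_add; intro torus_continuous_arith(3) torus_continuous_misc(2) F E)
        then show ?thesis unfolding symbol_adjoint[OF v F Pc, symmetric] by simp
      qed
      then have "s\<^sup>2 = cmod (torus_inner F (\<lambda>\<theta>. F \<theta> - ?E \<theta>) + torus_inner ?D P)"
        unfolding torus_inner_self s(2) by (metis abs_power2 norm_of_real)
      also have "\<dots> \<le> s * (L * \<epsilon>) + t * (K * s + \<epsilon>)"
        using torus_Cauchy_Schwarz[OF F FE] torus_Cauchy_Schwarz[OF D Pc]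
          mult_left_mono[OF e, of s] mult_left_mono[OF p, of t] s(1) t(1)
        unfolding s_def[symmetric] t_def[symmetric]
        by (intro order_trans[OF norm_triangle_ineq] add_mono) linarith+
      finally show ?thesis by (simp add: algebra_simps)
    qed
    have "s\<^sup>2 \<le> t * (K * s) + \<epsilon>" if "\<epsilon> > 0" for \<epsilon>
    proof -
      have c: "s * L + t \<ge> 0" using s t L by simp
      have "\<epsilon> / (s * L + t + 1) * (s * L + t) \<le> \<epsilon>"
        using c that by (simp add: field_simps)
      then show ?thesis using bound[of "\<epsilon> / (s * L + t + 1)"] that c by simp
    qed
    then have "s\<^sup>2 \<le> t * (K * s)" by (rule field_le_epsilon)
    then have "s * s \<le> (K * t) * s" by (simp add: power2_eq_square mult_ac)
    then have "s \<le> K * t" using s(1) t(1) K(1) by (cases "s = 0") auto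
    then have "s\<^sup>2 \<le> (K * t)\<^sup>2" using s(1) by (rule power_mono)
    then show ?thesis unfolding s(2) t(2) power_mult_distrib .
  qed
  then show ?thesis using that[of "K\<^sup>2"] K(1) by simp
qed

section \<open>From the torus to single orbits\<close>

text \<open>
  Averaging over the phases kills the mixed terms, as if the functions had disjoint supports.
\<close>

lemma phase_averages_orthogonalise:
  fixes g :: "nat \<Rightarrow> real ^ 'd \<Rightarrow> complex"
  assumes g: "\<And>j. torus_continuous (g j)" and w: "cmod w = 1" "\<And>j. j > 0 \<Longrightarrow> w ^ j \<noteq> 1"
  shows "(\<lambda>M. (\<Sum>m<M. torus_sq (\<lambda>\<theta>. \<Sum>j\<le>L. w ^ (m * j) * g j \<theta>)) / M) \<longlonglongrightarrow> (\<Sum>j\<le>L. torus_sq (g j))"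
proof -
  have cont: "torus_continuous (\<lambda>\<theta>. w ^ (m * j) * g j \<theta>)" for m j by (intro torus_continuous_intros g)
  have expand: "complex_of_real (torus_sq (\<lambda>\<theta>. \<Sum>j\<le>L. w ^ (m * j) * g j \<theta>))
    = (\<Sum>j\<le>L. \<Sum>l\<le>L. (w ^ j * cnj (w ^ l)) ^ m * torus_inner (g j) (g l))" for m
  proof -
    have "complex_of_real (torus_sq (\<lambda>\<theta>. \<Sum>j\<le>L. w ^ (m * j) * g j \<theta>))
      = torus_int (\<lambda>\<theta>. \<Sum>j\<le>L. \<Sum>l\<le>L. (w ^ j * cnj (w ^ l)) ^ m * (g j \<theta> * cnj (g l \<theta>)))"
      unfolding torus_inner_self[symmetric] torus_inner_def
      by (simp add: sum_product power_mult_distrib power_mult[symmetric] mult_ac)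
    then show ?thesis
      unfolding torus_inner_def by (simp add: torus_int_sum torus_int_mult torus_continuous_intros g)
  qed
  have lim: "(\<lambda>M. (\<Sum>m<M. (w ^ j * cnj (w ^ l)) ^ m) / of_nat M) \<longlonglongrightarrow> (if j = l then 1 else 0)" for j l
  proof (cases "j = l")
    case True
    have "w ^ j * cnj (w ^ j) = 1" using w(1) by (simp add: complex_norm_square[symmetric] norm_power del: complex_cnj_power)
    moreover have "(\<lambda>M. (\<Sum>m<M. 1 :: complex) / of_nat M) \<longlonglongrightarrow> 1"
      by (rule tendsto_eventually) (auto intro: eventually_sequentiallyI[of 1])
    ultimately show ?thesis using True by simp
  next
    case False
    have wc: "w * cnj w = 1" using w(1) by (simp add: complex_norm_square[symmetric])
    have *: "w ^ (i + k) * cnj (w ^ i) = w ^ k" for i k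
    proof -
      have "w ^ (i + k) * cnj (w ^ i) = w ^ k * (w * cnj w) ^ i" by (simp add: power_add power_mult_distrib)
      then show ?thesis using wc by simp
    qed
    have "w ^ j * cnj (w ^ l) \<noteq> 1"
    proof (cases "l < j")
      case True
      then show ?thesis using *[of l "j - l"] w(2)[of "j - l"] by simp
    next
      case F: False
      then have "w ^ l * cnj (w ^ j) \<noteq> 1" using False *[of j "l - j"] w(2)[of "l - j"] by simp
      moreover have "cnj (w ^ l * cnj (w ^ j)) = w ^ j * cnj (w ^ l)" by simp
      ultimately show ?thesis by (metis complex_cnj_cancel_iff complex_cnj_one)
    qed
    moreover have "cmod (w ^ j * cnj (w ^ l)) = 1" by (simp add: norm_mult norm_power w(1))
    ultimately show ?thesis using False geometric_averages_tendsto_zero by simp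
  qed
  have "(\<lambda>M. \<Sum>j\<le>L. \<Sum>l\<le>L. ((\<Sum>m<M. (w ^ j * cnj (w ^ l)) ^ m) / of_nat M) * torus_inner (g j) (g l))
    \<longlonglongrightarrow> (\<Sum>j\<le>L. \<Sum>l\<le>L. (if j = l then 1 else 0) * torus_inner (g j) (g l))"
    by (intro tendsto_sum tendsto_mult lim tendsto_const)
  also have "(\<Sum>j\<le>L. \<Sum>l\<le>L. (if j = l then 1 else 0) * torus_inner (g j) (g l)) = complex_of_real (\<Sum>j\<le>L. torus_sq (g j))"
    by (simp add: if_distrib[of "\<lambda>x. x * _"] torus_inner_self cong: if_cong)
  also have "(\<lambda>M. \<Sum>j\<le>L. \<Sum>l\<le>L. ((\<Sum>m<M. (w ^ j * cnj (w ^ l)) ^ m) / of_nat M) * torus_inner (g j) (g l))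
    = (\<lambda>M. complex_of_real ((\<Sum>m<M. torus_sq (\<lambda>\<theta>. \<Sum>j\<le>L. w ^ (m * j) * g j \<theta>)) / M))"
  proof
    fix M
    have "complex_of_real ((\<Sum>m<M. torus_sq (\<lambda>\<theta>. \<Sum>j\<le>L. w ^ (m * j) * g j \<theta>)) / M)
      = (\<Sum>m<M. \<Sum>j\<le>L. \<Sum>l\<le>L. (w ^ j * cnj (w ^ l)) ^ m * torus_inner (g j) (g l)) / of_nat M"
      by (simp add: expand)
    also have "(\<Sum>m<M. \<Sum>j\<le>L. \<Sum>l\<le>L. (w ^ j * cnj (w ^ l)) ^ m * torus_inner (g j) (g l))
      = (\<Sum>j\<le>L. \<Sum>l\<le>L. (\<Sum>m<M. (w ^ j * cnj (w ^ l)) ^ m) * torus_inner (g j) (g l))"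
      unfolding sum_distrib_right
      by (subst sum.swap) (rule sum.cong[OF refl], rule sum.swap)
    finally show "(\<Sum>j\<le>L. \<Sum>l\<le>L. ((\<Sum>m<M. (w ^ j * cnj (w ^ l)) ^ m) / of_nat M) * torus_inner (g j) (g l))
      = complex_of_real ((\<Sum>m<M. torus_sq (\<lambda>\<theta>. \<Sum>j\<le>L. w ^ (m * j) * g j \<theta>)) / M)"
      by (simp only: times_divide_eq_left sum_divide_distrib[symmetric])
  qed
  finally show ?thesis unfolding tendsto_of_real_iff .
qed

text \<open>
  The test function is a sum of translates of \<open>\<phi>\<close> times a character, with coefficients \<open>f\<close>. Varying the
  character multiplies the translates by independent phases, so \<open>phase_averages_orthogonalise\<close>
  decouples them, and a translation of each term leaves
  \<open>\<integral> \<phi>\<^sup>2 \<Delta> \<le> 0\<close>, where \<open>\<Delta>(\<theta>)\<close> is the difference of the two sides of the claim. The choice \<open>\<phi> = max(0, \<Delta>)\<close>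
  localises this to \<open>\<Delta> \<le> 0\<close> everywhere. As \<open>F(\<theta> + \<beta>)\<close> moves the
  indices down by one, \<open>f 0 = 0\<close> ensures that no term of index -1 arises.
\<close>

lemma orbit_lower_bound:
  fixes a :: "real ^ 'd \<Rightarrow> complex" and f :: "nat \<Rightarrow> complex"
  assumes a: "torus_continuous a" and \<beta>: "totally_irrational \<beta>"
    and K: "\<And>F. torus_continuous F \<Longrightarrow> torus_sq F \<le> K * torus_sq (\<lambda>\<theta>. a \<theta> * F \<theta> + b * F (\<theta> + \<beta>))"
    and f: "f 0 = 0" "f (Suc L) = 0"
  shows "(\<Sum>j\<le>L. (cmod (f j))\<^sup>2) \<le> K * (\<Sum>j\<le>L. (cmod (a (\<theta> + of_nat j *\<^sub>R \<beta>) * f j + b * f (Suc j)))\<^sup>2)"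
proof -
  define \<Delta> where "\<Delta> \<theta> = (\<Sum>j\<le>L. (cmod (f j))\<^sup>2) - K * (\<Sum>j\<le>L. (cmod (a (\<theta> + of_nat j *\<^sub>R \<beta>) * f j + b * f (Suc j)))\<^sup>2)" for \<theta>
  have \<Delta>: "torus_continuous \<Delta>" unfolding \<Delta>_def by (intro torus_continuous_intros a)
  define \<phi> where "\<phi> \<theta> = max 0 (\<Delta> \<theta>)" for \<theta>
  have \<phi>: "torus_continuous \<phi>" unfolding \<phi>_def by (intro torus_continuous_intros \<Delta>)
  define k :: "nat \<Rightarrow> int ^ 'd" where "k m = (\<chi> i. int m)" for m
  define w where "w = torus_char (k 1) (- \<beta>)"
  have k: "torus_char (k m) \<theta> = torus_char (k 1) \<theta> ^ m" for m \<theta>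
  proof (induction m)
    case 0
    have "k 0 = 0" by (simp add: k_def vec_eq_iff)
    then show ?case by simp
  next
    case (Suc m)
    have "k (Suc m) = k 1 + k m" by (simp add: k_def vec_eq_iff)
    then show ?case using Suc by (simp add: torus_char_add_left)
  qed
  have w: "cmod w = 1" "w ^ j \<noteq> 1" if "j > 0" for j
  proof -
    show "cmod w = 1" by (simp add: w_def)
    have "k j \<noteq> 0" using that by (simp add: k_def vec_eq_iff)
    then show "w ^ j \<noteq> 1" using totally_irrational_uminus[OF \<beta>]
      unfolding totally_irrational_def w_def k[symmetric] by blast
  qed
  define \<psi> where "\<psi> j \<theta> = complex_of_real (\<phi> (\<theta> + - (of_nat j *\<^sub>R \<beta>)))" for j :: nat and \<theta>
  have \<psi>: "torus_continuous (\<psi> j)" for j unfolding \<psi>_def by (intro torus_continuous_intros \<phi>)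
  have \<psi>_Suc: "\<psi> (Suc j) (\<theta> + \<beta>) = \<psi> j \<theta>" for j \<theta> by (simp add: \<psi>_def algebra_simps)
  define g where "g j \<theta> = f j * \<psi> j \<theta>" for j \<theta>
  define h where "h j \<theta> = (a \<theta> * f j + b * f (Suc j)) * \<psi> j \<theta>" for j \<theta>
  have g: "torus_continuous (g j)" for j unfolding g_def by (intro torus_continuous_intros \<psi>)
  have h: "torus_continuous (h j)" for j unfolding h_def by (intro torus_continuous_intros \<psi> a)
  have each: "torus_sq (\<lambda>\<theta>. \<Sum>j\<le>L. w ^ (m * j) * g j \<theta>) \<le> K * torus_sq (\<lambda>\<theta>. \<Sum>j\<le>L. w ^ (m * j) * h j \<theta>)" for m
  proof -
    define F where "F \<theta> = torus_char (k m) \<theta> * (\<Sum>j\<le>L. w ^ (m * j) * g j \<theta>)" for \<theta>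
    have F: "torus_continuous F" unfolding F_def by (intro torus_continuous_intros g)
    have wk: "torus_char (k m) \<beta> * w ^ m = 1"
      unfolding w_def k[symmetric] torus_char_add_right[symmetric] by simp
    have "a \<theta> * F \<theta> + b * F (\<theta> + \<beta>) = torus_char (k m) \<theta> * (\<Sum>j\<le>L. w ^ (m * j) * h j \<theta>)" for \<theta>
    proof -
      have "(\<Sum>j\<le>L. w ^ (m * j) * g j (\<theta> + \<beta>)) = (\<Sum>j\<le>Suc L. w ^ (m * j) * g j (\<theta> + \<beta>))"
        by (simp add: g_def f(2))
      also have "\<dots> = (\<Sum>j\<le>L. w ^ (m * Suc j) * g (Suc j) (\<theta> + \<beta>))"
        unfolding sum.atMost_Suc_shift by (simp add: g_def f(1))
      also have "\<dots> = w ^ m * (\<Sum>j\<le>L. w ^ (m * j) * (f (Suc j) * \<psi> j \<theta>))"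
        unfolding sum_distrib_left by (intro sum.cong refl) (simp add: g_def \<psi>_Suc power_add mult_ac)
      finally have "F (\<theta> + \<beta>) = torus_char (k m) \<theta> * (torus_char (k m) \<beta> * w ^ m) * (\<Sum>j\<le>L. w ^ (m * j) * (f (Suc j) * \<psi> j \<theta>))"
        by (simp add: F_def torus_char_add_right mult_ac)
      then have Fs: "F (\<theta> + \<beta>) = torus_char (k m) \<theta> * (\<Sum>j\<le>L. w ^ (m * j) * (f (Suc j) * \<psi> j \<theta>))"
        unfolding wk by simp
      have "a \<theta> * F \<theta> + b * F (\<theta> + \<beta>)
        = torus_char (k m) \<theta> * ((\<Sum>j\<le>L. a \<theta> * (w ^ (m * j) * g j \<theta>)) + (\<Sum>j\<le>L. b * (w ^ (m * j) * (f (Suc j) * \<psi> j \<theta>))))"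
        unfolding Fs unfolding F_def by (simp add: sum_distrib_left[symmetric] algebra_simps)
      also have "(\<Sum>j\<le>L. a \<theta> * (w ^ (m * j) * g j \<theta>)) + (\<Sum>j\<le>L. b * (w ^ (m * j) * (f (Suc j) * \<psi> j \<theta>)))
        = (\<Sum>j\<le>L. w ^ (m * j) * h j \<theta>)"
        unfolding sum.distrib[symmetric] by (intro sum.cong refl) (simp add: g_def h_def algebra_simps)
      finally show ?thesis .
    qed
    then show ?thesis using K[OF F] by (simp add: F_def torus_sq_def norm_mult)
  qed
  have "(\<Sum>j\<le>L. torus_sq (g j)) \<le> K * (\<Sum>j\<le>L. torus_sq (h j))"
  proof (rule LIMSEQ_le)
    show "(\<lambda>M. (\<Sum>m<M. torus_sq (\<lambda>\<theta>. \<Sum>j\<le>L. w ^ (m * j) * g j \<theta>)) / M) \<longlonglongrightarrow> (\<Sum>j\<le>L. torus_sq (g j))"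
      by (intro phase_averages_orthogonalise g w) auto
    show "(\<lambda>M. K * ((\<Sum>m<M. torus_sq (\<lambda>\<theta>. \<Sum>j\<le>L. w ^ (m * j) * h j \<theta>)) / M)) \<longlonglongrightarrow> K * (\<Sum>j\<le>L. torus_sq (h j))"
      by (intro tendsto_mult tendsto_const phase_averages_orthogonalise h w) auto
    have "(\<Sum>m<M. torus_sq (\<lambda>\<theta>. \<Sum>j\<le>L. w ^ (m * j) * g j \<theta>)) / M
      \<le> K * ((\<Sum>m<M. torus_sq (\<lambda>\<theta>. \<Sum>j\<le>L. w ^ (m * j) * h j \<theta>)) / M)" for M :: nat
      unfolding times_divide_eq_right sum_distrib_left by (intro divide_right_mono sum_mono each) auto
    then show "\<exists>N. \<forall>M\<ge>N. (\<Sum>m<M. torus_sq (\<lambda>\<theta>. \<Sum>j\<le>L. w ^ (m * j) * g j \<theta>)) / M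
      \<le> K * ((\<Sum>m<M. torus_sq (\<lambda>\<theta>. \<Sum>j\<le>L. w ^ (m * j) * h j \<theta>)) / M)" by blast
  qed
  moreover have "torus_sq (g j) = torus_int (\<lambda>\<theta>. (\<phi> \<theta>)\<^sup>2 * (cmod (f j))\<^sup>2)" for j
  proof -
    have "torus_continuous (\<lambda>\<theta>. (cmod (g j \<theta>))\<^sup>2)" by (intro torus_continuous_intros g)
    from torus_int_shift_real[OF this, of "of_nat j *\<^sub>R \<beta>"] show ?thesis
      by (simp add: torus_sq_def g_def \<psi>_def norm_mult power_mult_distrib mult.commute)
  qed
  moreover have "torus_sq (h j) = torus_int (\<lambda>\<theta>. (\<phi> \<theta>)\<^sup>2 * (cmod (a (\<theta> + of_nat j *\<^sub>R \<beta>) * f j + b * f (Suc j)))\<^sup>2)" for j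
  proof -
    have "torus_continuous (\<lambda>\<theta>. (cmod (h j \<theta>))\<^sup>2)" by (intro torus_continuous_intros h)
    from torus_int_shift_real[OF this, of "of_nat j *\<^sub>R \<beta>"] show ?thesis
      by (simp add: torus_sq_def h_def \<psi>_def norm_mult power_mult_distrib mult.commute)
  qed
  ultimately have "torus_int (\<lambda>\<theta>. \<Sum>j\<le>L. (\<phi> \<theta>)\<^sup>2 * (cmod (f j))\<^sup>2)
      \<le> K * torus_int (\<lambda>\<theta>. \<Sum>j\<le>L. (\<phi> \<theta>)\<^sup>2 * (cmod (a (\<theta> + of_nat j *\<^sub>R \<beta>) * f j + b * f (Suc j)))\<^sup>2)"
    by (subst (1 2) torus_int_sum) (auto intro!: torus_continuous_intros \<phi> a)
  then have "torus_int (\<lambda>\<theta>. (\<Sum>j\<le>L. (\<phi> \<theta>)\<^sup>2 * (cmod (f j))\<^sup>2)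
      - K * (\<Sum>j\<le>L. (\<phi> \<theta>)\<^sup>2 * (cmod (a (\<theta> + of_nat j *\<^sub>R \<beta>) * f j + b * f (Suc j)))\<^sup>2)) \<le> 0"
    by (subst torus_int_add) (auto intro!: torus_continuous_intros \<phi> a simp: torus_int_mult)
  also have "(\<lambda>\<theta>. (\<Sum>j\<le>L. (\<phi> \<theta>)\<^sup>2 * (cmod (f j))\<^sup>2)
      - K * (\<Sum>j\<le>L. (\<phi> \<theta>)\<^sup>2 * (cmod (a (\<theta> + of_nat j *\<^sub>R \<beta>) * f j + b * f (Suc j)))\<^sup>2)) = (\<lambda>\<theta>. (\<phi> \<theta>) ^ 3)"
  proof
    fix \<theta>
    have "(\<Sum>j\<le>L. (\<phi> \<theta>)\<^sup>2 * (cmod (f j))\<^sup>2)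
      - K * (\<Sum>j\<le>L. (\<phi> \<theta>)\<^sup>2 * (cmod (a (\<theta> + of_nat j *\<^sub>R \<beta>) * f j + b * f (Suc j)))\<^sup>2) = (\<phi> \<theta>)\<^sup>2 * \<Delta> \<theta>"
      unfolding \<Delta>_def by (simp add: sum_distrib_left[symmetric] algebra_simps)
    also have "\<dots> = (\<phi> \<theta>) ^ 3" by (simp add: \<phi>_def max_def power2_eq_square power3_eq_cube)
    finally show "(\<Sum>j\<le>L. (\<phi> \<theta>)\<^sup>2 * (cmod (f j))\<^sup>2)
      - K * (\<Sum>j\<le>L. (\<phi> \<theta>)\<^sup>2 * (cmod (a (\<theta> + of_nat j *\<^sub>R \<beta>) * f j + b * f (Suc j)))\<^sup>2) = (\<phi> \<theta>) ^ 3" .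
  qed
  finally have "torus_int (\<lambda>\<theta>. (\<phi> \<theta>) ^ 3) \<le> 0" .
  moreover have "torus_continuous (\<lambda>\<theta>. (\<phi> \<theta>) ^ 3)" by (intro torus_continuous_intros \<phi>)
  ultimately have "(\<phi> \<theta>) ^ 3 = 0" by (intro torus_int_zero_imp_zero) (auto simp: \<phi>_def)
  then show ?thesis by (simp add: \<phi>_def \<Delta>_def max_def split: if_splits)
qed

section \<open>Zeros of the symbol\<close>

text \<open>
  The bound on the product of the \<open>N\<close> factors \<open>x\<^sub>l = \<bar>v(\<theta> + l\<alpha>)\<bar> / B \<le> 1\<close> passes to the product of the
  truncated factors, since \<open>\<Prod> max(t, x\<^sub>l) \<le> max(t, \<Prod> x\<^sub>l)\<close> for \<open>t \<le> 1\<close>: either no factor is truncated, or one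
  factor equals \<open>t\<close> and the others are at most 1. The logarithms of the truncated factors are
  continuous, and their means are translation invariant and at least \<open>G V z - ln B\<close>.
\<close>

lemma products_bounded_imp_G_le:
  fixes V :: "real ^ 'd \<Rightarrow> complex"
  assumes V: "torus_continuous V" and L1: "log_dist_in_L1 V z" and C: "C > 0" "r > 0"
    and bound: "\<And>N \<theta>. (\<Prod>l<N. cmod (V (\<theta> + of_nat l *\<^sub>R \<alpha>) - z)) \<le> C * r ^ N"
  shows "G V z \<le> ln r"
proof -
  define v where "v \<theta> = V \<theta> - z" for \<theta>
  have v: "torus_continuous v" unfolding v_def by (intro torus_continuous_intros V)
  obtain B where B: "B > 0" "\<And>\<theta>. cmod (v \<theta>) \<le> B" using torus_continuous_bounded[OF v] by blast
  have key: "N * (G V z - ln r) \<le> ln C" for N :: nat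
  proof -
    define q where "q = C * r ^ N / B ^ N"
    define t where "t = min q 1"
    have q: "q > 0" using C B by (simp add: q_def)
    have t: "0 < t" "t \<le> q" "t \<le> 1" using q by (auto simp: t_def)
    define x where "x \<theta> = cmod (v \<theta>) / B" for \<theta>
    have x: "0 \<le> x \<theta>" "x \<theta> \<le> 1" for \<theta> using B by (auto simp: x_def)
    define h where "h \<theta> = ln (max t (x \<theta>))" for \<theta>
    have h_eq: "h \<theta> = ln (max (t * B) (cmod (v \<theta>))) - ln B" for \<theta>
    proof -
      have "max t (x \<theta>) = max (t * B) (cmod (v \<theta>)) / B" using B(1) by (auto simp: x_def max_def field_simps)
      moreover have "max (t * B) (cmod (v \<theta>)) > 0" using t B by (simp add: less_max_iff_disj)
      ultimately show ?thesis using B by (simp add: h_def ln_div)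
    qed
    have lc: "torus_continuous (\<lambda>\<theta>. ln (max (t * B) (cmod (v \<theta>))))"
      using t B by (intro torus_continuous_ln_max v) simp
    have h: "torus_continuous h" unfolding h_eq[abs_def] by (intro torus_continuous_arith lc torus_continuous_const)
    have prod_max: "(\<Prod>l<n. max t (x (\<theta> + of_nat l *\<^sub>R \<alpha>))) \<le> max t (\<Prod>l<n. x (\<theta> + of_nat l *\<^sub>R \<alpha>))" for \<theta> n
    proof (cases "\<forall>l<n. t \<le> x (\<theta> + of_nat l *\<^sub>R \<alpha>)")
      case True
      then have "(\<Prod>l<n. max t (x (\<theta> + of_nat l *\<^sub>R \<alpha>))) = (\<Prod>l<n. x (\<theta> + of_nat l *\<^sub>R \<alpha>))"
        by (intro prod.cong) (auto simp: max_def)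
      then show ?thesis by simp
    next
      case False
      then obtain k where k: "k < n" "x (\<theta> + of_nat k *\<^sub>R \<alpha>) < t" by (auto simp: not_le)
      have "(\<Prod>l<n. max t (x (\<theta> + of_nat l *\<^sub>R \<alpha>)))
        = max t (x (\<theta> + of_nat k *\<^sub>R \<alpha>)) * (\<Prod>l\<in>{..<n} - {k}. max t (x (\<theta> + of_nat l *\<^sub>R \<alpha>)))"
        using k by (subst prod.remove[of _ k]) auto
      also have "\<dots> \<le> t * 1"
        using k t x by (intro mult_mono prod_le_1 prod_nonneg) (auto simp: le_max_iff_disj)
      finally show ?thesis by simp
    qed
    have "(\<Sum>l<N. h (\<theta> + of_nat l *\<^sub>R \<alpha>)) \<le> ln q" for \<theta>
    proof -
      have "(\<Sum>l<N. h (\<theta> + of_nat l *\<^sub>R \<alpha>)) = ln (\<Prod>l<N. max t (x (\<theta> + of_nat l *\<^sub>R \<alpha>)))"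
        unfolding h_def using t by (intro ln_prod[symmetric]) (auto simp: less_max_iff_disj)
      also have "\<dots> \<le> ln q"
      proof (rule ln_mono)
        show "0 < (\<Prod>l<N. max t (x (\<theta> + of_nat l *\<^sub>R \<alpha>)))" using t by (intro prod_pos) (auto simp: less_max_iff_disj)
        have "(\<Prod>l<N. x (\<theta> + of_nat l *\<^sub>R \<alpha>)) = (\<Prod>l<N. cmod (v (\<theta> + of_nat l *\<^sub>R \<alpha>))) / B ^ N"
          by (simp add: x_def prod_dividef)
        also have "\<dots> \<le> q" unfolding q_def v_def using B by (intro divide_right_mono bound) auto
        finally show "(\<Prod>l<N. max t (x (\<theta> + of_nat l *\<^sub>R \<alpha>))) \<le> q"
          using prod_max[of \<theta> N] t by linarith
      qed
      finally show ?thesis .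
    qed
    then have "torus_int (\<lambda>\<theta>. \<Sum>l<N. h (\<theta> + of_nat l *\<^sub>R \<alpha>)) \<le> torus_int (\<lambda>\<theta> :: real ^ 'd. ln q)"
      by (intro torus_int_mono torus_continuous_intros h)
    then have "N * torus_int h \<le> ln q"
      by (subst (asm) torus_int_sum) (auto intro!: torus_continuous_shift h simp: torus_int_shift_real[OF h] torus_int_const)
    also have "ln q = ln C + N * ln r - N * ln B"
      using C B by (simp add: q_def ln_div ln_mult ln_realpow)
    finally have "N * torus_int h \<le> ln C + N * ln r - N * ln B" .
    moreover have "G V z - ln B \<le> torus_int h"
      unfolding h_eq[abs_def] using G_le_truncated[OF V L1, of "t * B"] t B
      by (subst torus_int_add(2)[OF lc torus_continuous_const]) (simp add: torus_int_const v_def)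
    then have "N * (G V z - ln B) \<le> N * torus_int h" by (intro mult_left_mono) auto
    ultimately show ?thesis by (simp add: algebra_simps)
  qed
  show ?thesis
  proof (rule ccontr)
    assume "\<not> G V z \<le> ln r"
    then obtain N :: nat where "ln C < N * (G V z - ln r)"
      using reals_Archimedean3[of "G V z - ln r"] by auto
    then show False using key[of N] by simp
  qed
qed

text \<open>
  The averages along the orbit vanish, hence so does the mean.
\<close>

lemma vanishing_on_orbit_imp_zero:
  fixes h :: "real ^ 'd \<Rightarrow> real"
  assumes h: "torus_continuous h" "\<And>\<theta>. 0 \<le> h \<theta>" and \<alpha>: "totally_irrational \<alpha>"
    and orbit: "\<And>m. h (\<theta>\<^sub>0 + of_nat m *\<^sub>R \<alpha>) = 0"
  shows "h \<theta> = 0"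
proof -
  have "torus_int h \<le> 0 + \<eta>" if \<eta>: "\<eta> > 0" for \<eta>
  proof -
    obtain N where "\<And>n \<theta>. n \<ge> N \<Longrightarrow> \<bar>(\<Sum>j<n. h (\<theta> + of_nat j *\<^sub>R \<alpha>)) - n * torus_int h\<bar> \<le> n * \<eta>"
      using irrational_rotation_real_averages[OF h(1) \<alpha> \<eta>] by blast
    from this[of "Suc N" \<theta>\<^sub>0] have "\<bar>real (Suc N) * torus_int h\<bar> \<le> Suc N * \<eta>"
      by (simp only: orbit) simp
    then have "real (Suc N) * torus_int h \<le> Suc N * \<eta>" by linarith
    then show ?thesis by (simp only: mult_le_cancel_left_pos of_nat_0_less_iff zero_less_Suc add_0)
  qed
  then have "torus_int h \<le> 0" by (rule field_le_epsilon)
  then show ?thesis by (rule torus_int_zero_imp_zero[OF h])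
qed

text \<open>
  Along the orbit of the zero \<open>\<theta>\<^sub>0\<close>, with \<open>v\<^sub>l = v(\<theta>\<^sub>0 + l\<alpha>)\<close>, the adjoint acts as
  \<open>g \<mapsto> cnj v\<^sub>i g\<^sub>i + b g\<^sub>i\<^sub>-\<^sub>1\<close>. On \<open>0 \<le> i \<le> M\<close> take \<open>g\<^sub>i = (- b)\<^sup>i cnj v\<^sub>i\<^sub>+\<^sub>1 \<cdots> cnj v\<^sub>M\<close>. All entries of its image vanish, the one at
  \<open>i = 0\<close> because \<open>v\<^sub>0 = 0\<close>, except the one at \<open>M + 1\<close>, which has modulus \<open>\<bar>b\<bar>\<^sup>M\<^sup>+\<^sup>1\<close>. So the lower bound compares
  each \<open>\<bar>g\<^sub>m\<bar>\<close> with \<open>\<bar>b\<bar>\<^sup>M\<^sup>+\<^sup>1\<close>, which is the claim on the orbit. To get a rate strictly below \<open>\<bar>\<mu>\<bar>\<close>, the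
  bound is first transferred from \<open>cnj \<mu>\<close> to a slightly smaller \<open>b\<close>.
\<close>

lemma zero_of_symbol_imp_products_bounded:
  fixes v :: "real ^ 'd \<Rightarrow> complex"
  assumes v: "torus_continuous v" and \<alpha>: "totally_irrational \<alpha>" and \<mu>: "\<mu> \<noteq> 0"
    and K: "K > 0" "\<And>F. torus_continuous F \<Longrightarrow> torus_sq F \<le> K * torus_sq (\<lambda>\<theta>. cnj (v \<theta>) * F \<theta> + cnj \<mu> * F (\<theta> + - \<alpha>))"
    and zero: "v \<theta>\<^sub>0 = 0"
  obtains C r where "C > 0" "0 < r" "r < cmod \<mu>" "\<And>N \<theta>. (\<Prod>l<N. cmod (v (\<theta> + of_nat l *\<^sub>R \<alpha>))) \<le> C * r ^ N"
proof -
  note vc = torus_continuous_misc(2)[OF v]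
  define \<epsilon> where "\<epsilon> = min (1 / 2) (1 / (2 * sqrt K * cmod \<mu>))"
  have \<epsilon>: "0 < \<epsilon>" "\<epsilon> \<le> 1 / 2" "\<epsilon> \<le> 1 / (2 * sqrt K * cmod \<mu>)" using K(1) \<mu> by (auto simp: \<epsilon>_def)
  define b where "b = (1 - complex_of_real \<epsilon>) * cnj \<mu>"
  define r where "r = (1 - \<epsilon>) * cmod \<mu>"
  have r: "0 < r" "r < cmod \<mu>" using \<epsilon> \<mu> by (auto simp: r_def)
  have b: "cmod b = r"
  proof -
    have "cmod (1 - complex_of_real \<epsilon>) = 1 - \<epsilon>"
      using \<epsilon> norm_of_real[of "1 - \<epsilon>", where 'a = complex] by simp
    then show ?thesis by (simp add: b_def r_def norm_mult)
  qed
  have small: "2 * K * (cmod (cnj \<mu> - b))\<^sup>2 \<le> 1 / 2"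
  proof -
    have "cnj \<mu> - b = complex_of_real \<epsilon> * cnj \<mu>" by (simp add: b_def algebra_simps)
    then have "sqrt K * cmod (cnj \<mu> - b) = \<epsilon> * (sqrt K * cmod \<mu>)" using \<epsilon> by (simp add: norm_mult)
    also have "\<dots> \<le> 1 / 2" using \<epsilon>(3) K(1) \<mu> by (simp add: field_simps)
    finally have "(sqrt K * cmod (cnj \<mu> - b))\<^sup>2 \<le> (1 / 2)\<^sup>2" using K(1) by (intro power_mono) auto
    moreover have "(sqrt K * cmod (cnj \<mu> - b))\<^sup>2 = K * (cmod (cnj \<mu> - b))\<^sup>2"
      using K(1) by (simp add: power_mult_distrib)
    ultimately have "K * (cmod (cnj \<mu> - b))\<^sup>2 \<le> (1 / 2)\<^sup>2" by (simp only:)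
    then show ?thesis by (simp add: power2_eq_square)
  qed
  have orbit: "(\<Sum>j\<le>L. (cmod (f j))\<^sup>2) \<le> 4 * K * (\<Sum>j\<le>L. (cmod (cnj (v (\<theta> + of_nat j *\<^sub>R - \<alpha>)) * f j + b * f (Suc j)))\<^sup>2)"
    if f: "f 0 = 0" "f (Suc L) = 0" for f :: "nat \<Rightarrow> complex" and L \<theta>
  proof -
    define S where "S = (\<Sum>j\<le>L. (cmod (f j))\<^sup>2)"
    define T where "T = (\<Sum>j\<le>L. (cmod (cnj (v (\<theta> + of_nat j *\<^sub>R - \<alpha>)) * f j + b * f (Suc j)))\<^sup>2)"
    have "S \<le> K * (\<Sum>j\<le>L. (cmod (cnj (v (\<theta> + of_nat j *\<^sub>R - \<alpha>)) * f j + cnj \<mu> * f (Suc j)))\<^sup>2)"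
      unfolding S_def by (rule orbit_lower_bound[where a = "\<lambda>\<theta>. cnj (v \<theta>)", OF vc totally_irrational_uminus[OF \<alpha>] K(2)]) (use f in auto)
    also have "\<dots> \<le> K * (\<Sum>j\<le>L. 2 * (cmod (cnj (v (\<theta> + of_nat j *\<^sub>R - \<alpha>)) * f j + b * f (Suc j)))\<^sup>2
        + 2 * ((cmod (cnj \<mu> - b))\<^sup>2 * (cmod (f (Suc j)))\<^sup>2))"
    proof (intro mult_left_mono sum_mono)
      fix j
      have sq: "(cmod (x + y))\<^sup>2 \<le> 2 * (cmod x)\<^sup>2 + 2 * (cmod y)\<^sup>2" for x y
      proof -
        have "(cmod (x + y))\<^sup>2 \<le> (cmod x + cmod y)\<^sup>2" by (intro power_mono norm_triangle_ineq) auto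
        also have "\<dots> \<le> 2 * (cmod x)\<^sup>2 + 2 * (cmod y)\<^sup>2"
          using zero_le_power2[of "cmod x - cmod y"] by (simp add: power2_eq_square algebra_simps)
        finally show ?thesis .
      qed
      let ?v = "cnj (v (\<theta> + of_nat j *\<^sub>R - \<alpha>))"
      have "?v * f j + cnj \<mu> * f (Suc j) = (?v * f j + b * f (Suc j)) + (cnj \<mu> - b) * f (Suc j)"
        by (simp add: algebra_simps)
      then show "(cmod (?v * f j + cnj \<mu> * f (Suc j)))\<^sup>2
        \<le> 2 * (cmod (?v * f j + b * f (Suc j)))\<^sup>2 + 2 * ((cmod (cnj \<mu> - b))\<^sup>2 * (cmod (f (Suc j)))\<^sup>2)"
        using sq[of "?v * f j + b * f (Suc j)" "(cnj \<mu> - b) * f (Suc j)"]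
        by (simp only: norm_mult power_mult_distrib)
    qed (use K in auto)
    also have "\<dots> = 2 * K * T + 2 * K * (cmod (cnj \<mu> - b))\<^sup>2 * (\<Sum>j\<le>L. (cmod (f (Suc j)))\<^sup>2)"
      unfolding T_def by (simp add: sum.distrib sum_distrib_left[symmetric] distrib_left)
    also have "(\<Sum>j\<le>L. (cmod (f (Suc j)))\<^sup>2) = S"
      using sum.atMost_Suc_shift[of "\<lambda>j. (cmod (f j))\<^sup>2" L] f by (simp add: S_def)
    also have "2 * K * (cmod (cnj \<mu> - b))\<^sup>2 * S \<le> 1 / 2 * S"
      using small by (intro mult_right_mono) (auto simp: S_def sum_nonneg)
    finally have "S \<le> 4 * K * T" by simp
    then show ?thesis by (simp only: S_def T_def)
  qed
  define V where "V l = cnj (v (\<theta>\<^sub>0 + of_nat l *\<^sub>R \<alpha>))" for l :: nat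
  define C where "C = 2 * sqrt K * r"
  have C: "C > 0" using K(1) r by (simp add: C_def)
  have tail: "(\<Prod>l\<in>{m<..M}. cmod (V l)) * r ^ m \<le> 2 * sqrt K * r ^ Suc M" if "m \<le> M" for m M :: nat
  proof -
    \<comment> \<open>The translation is by \<open>- \<alpha>\<close>, hence \<open>f\<close> lists \<open>g\<close> backwards, with \<open>f 0 = 0\<close> in the place of \<open>g (M + 1)\<close>.\<close>
    define g where "g i = (- b) ^ i * (\<Prod>l\<in>{i<..M}. V l)" for i
    define f where "f j = (if j = 0 \<or> j > Suc M then 0 else g (Suc M - j))" for j
    have base: "cnj (v (\<theta>\<^sub>0 + of_nat (Suc M) *\<^sub>R \<alpha> + of_nat j *\<^sub>R - \<alpha>)) = V (Suc M - j)" if "j \<le> Suc M" for j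
    proof -
      have "of_nat (Suc M - j) *\<^sub>R \<alpha> = of_nat (Suc M) *\<^sub>R \<alpha> + of_nat j *\<^sub>R - \<alpha>"
        using that by (simp add: of_nat_diff algebra_simps)
      then show ?thesis unfolding V_def by (simp only: add.assoc)
    qed
    have res: "V (Suc M - j) * f j + b * f (Suc j) = (if j = 0 then b * g M else 0)" if j: "j \<le> Suc M" for j
    proof -
      consider "j = 0" | "j = Suc M" | "0 < j" "j < Suc M" using j by linarith
      then show ?thesis
      proof cases
        case 2
        then show ?thesis using zero by (simp add: f_def V_def)
      next
        case 3
        define i where "i = M - j"
        have i: "Suc M - j = Suc i" "Suc M - Suc j = i" "i < M" using 3 by (auto simp: i_def)
        have "{i<..M} = insert (Suc i) {Suc i<..M}" using i(3) by auto
        then have "g i = (- b) ^ i * (V (Suc i) * (\<Prod>l\<in>{Suc i<..M}. V l))" by (simp add: g_def)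
        then have "V (Suc i) * g (Suc i) + b * g i = 0" by (simp add: g_def)
        then show ?thesis using 3 by (simp only: f_def i) simp
      qed (simp add: f_def)
    qed
    have "(cmod (g m))\<^sup>2 = (cmod (f (Suc M - m)))\<^sup>2" using that by (simp add: f_def Suc_diff_le)
    also have "\<dots> \<le> (\<Sum>j\<le>Suc M. (cmod (f j))\<^sup>2)" by (rule member_le_sum) auto
    also have "\<dots> \<le> 4 * K * (\<Sum>j\<le>Suc M. (cmod (cnj (v (\<theta>\<^sub>0 + of_nat (Suc M) *\<^sub>R \<alpha> + of_nat j *\<^sub>R - \<alpha>)) * f j + b * f (Suc j)))\<^sup>2)"
      by (rule orbit) (auto simp: f_def)
    also have "(\<Sum>j\<le>Suc M. (cmod (cnj (v (\<theta>\<^sub>0 + of_nat (Suc M) *\<^sub>R \<alpha> + of_nat j *\<^sub>R - \<alpha>)) * f j + b * f (Suc j)))\<^sup>2)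
      = (\<Sum>j\<le>Suc M. if j = 0 then (cmod (b * g M))\<^sup>2 else 0)"
    proof (rule sum.cong[OF refl])
      fix j assume "j \<in> {..Suc M}"
      then have j: "j \<le> Suc M" by simp
      show "(cmod (cnj (v (\<theta>\<^sub>0 + of_nat (Suc M) *\<^sub>R \<alpha> + of_nat j *\<^sub>R - \<alpha>)) * f j + b * f (Suc j)))\<^sup>2
        = (if j = 0 then (cmod (b * g M))\<^sup>2 else 0)"
        unfolding base[OF j] res[OF j] by simp
    qed
    also have "\<dots> = (cmod (b * g M))\<^sup>2" by simp
    also have "cmod (b * g M) = r ^ Suc M" by (simp add: g_def norm_mult norm_power b)
    finally have "(cmod (g m))\<^sup>2 \<le> (2 * sqrt K * r ^ Suc M)\<^sup>2" using K(1) by (simp add: power_mult_distrib)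
    then have "cmod (g m) \<le> 2 * sqrt K * r ^ Suc M" 
      by (rule power2_le_imp_le) (use K(1) r in simp)
    then show ?thesis by (simp add: g_def norm_mult norm_power b prod_norm mult.commute)
  qed
  have on_orbit: "(\<Prod>l<N. cmod (v (\<theta>\<^sub>0 + \<alpha> + of_nat m *\<^sub>R \<alpha> + of_nat l *\<^sub>R \<alpha>))) \<le> C * r ^ N" for m N
  proof -
    have pt: "\<theta>\<^sub>0 + \<alpha> + of_nat m *\<^sub>R \<alpha> + of_nat l *\<^sub>R \<alpha> = \<theta>\<^sub>0 + of_nat (Suc m + l) *\<^sub>R \<alpha>" for l
      by (simp add: algebra_simps)
    have "(\<Prod>l<N. cmod (v (\<theta>\<^sub>0 + \<alpha> + of_nat m *\<^sub>R \<alpha> + of_nat l *\<^sub>R \<alpha>))) = (\<Prod>l<N. cmod (V (Suc m + l)))"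
      unfolding pt V_def by simp
    also have "\<dots> = (\<Prod>l\<in>{m<..m + N}. cmod (V l))"
      by (rule prod.reindex_bij_witness[of _ "\<lambda>l. l - Suc m" "\<lambda>l. Suc m + l"]) auto
    finally have eq: "(\<Prod>l<N. cmod (v (\<theta>\<^sub>0 + \<alpha> + of_nat m *\<^sub>R \<alpha> + of_nat l *\<^sub>R \<alpha>))) = (\<Prod>l\<in>{m<..m + N}. cmod (V l))" .
    have "2 * sqrt K * r ^ Suc (m + N) = (C * r ^ N) * r ^ m" by (simp add: C_def power_add)
    then have "(\<Prod>l\<in>{m<..m + N}. cmod (V l)) * r ^ m \<le> (C * r ^ N) * r ^ m"
      using tail[of m "m + N"] by simp
    then show ?thesis unfolding eq by (rule mult_right_le_imp_le) (use r in simp)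
  qed
  have "(\<Prod>l<N. cmod (v (\<theta> + of_nat l *\<^sub>R \<alpha>))) \<le> C * r ^ N" for N \<theta>
  proof -
    define h where "h \<theta> = max 0 ((\<Prod>l<N. cmod (v (\<theta> + of_nat l *\<^sub>R \<alpha>))) - C * r ^ N)" for \<theta>
    have h: "torus_continuous h" unfolding h_def by (intro torus_continuous_intros v)
    have "h \<theta> = 0"
      by (rule vanishing_on_orbit_imp_zero[OF h _ \<alpha>, of "\<theta>\<^sub>0 + \<alpha>"]) (use on_orbit in \<open>auto simp: h_def\<close>)
    then show ?thesis by (simp add: h_def max_def split: if_splits)
  qed
  then show ?thesis using that C r by blast
qed

lemma twisted_conv_not_invertible_at_zero:
  fixes V :: "real ^ 'd \<Rightarrow> complex"
  assumes V: "torus_continuous V" and L1: "log_dist_in_L1 V z" and \<alpha>: "totally_irrational \<alpha>"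
    and \<mu>: "\<mu> \<noteq> 0" "ln (cmod \<mu>) \<le> G V z" and z: "z \<in> range V"
  shows "\<not> ell2_invertible (twisted_conv (\<lambda>\<theta>. V \<theta> - z) \<mu> \<alpha>)"
proof
  assume inv: "ell2_invertible (twisted_conv (\<lambda>\<theta>. V \<theta> - z) \<mu> \<alpha>)"
  have v: "torus_continuous (\<lambda>\<theta>. V \<theta> - z)" by (intro torus_continuous_intros V)
  obtain K where K: "K > 0" "\<And>F. torus_continuous F \<Longrightarrow>
      torus_sq F \<le> K * torus_sq (\<lambda>\<theta>. cnj (V \<theta> - z) * F \<theta> + cnj \<mu> * F (\<theta> + - \<alpha>))"
    using adjoint_symbol_lower_bound[OF v inv] by blast
  obtain \<theta>\<^sub>0 where "V \<theta>\<^sub>0 - z = 0" using z by auto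
  from zero_of_symbol_imp_products_bounded[OF v \<alpha> \<mu>(1) K this] obtain C r
    where Cr: "C > 0" "0 < r" "r < cmod \<mu>" "\<And>N \<theta>. (\<Prod>l<N. cmod (V (\<theta> + of_nat l *\<^sub>R \<alpha>) - z)) \<le> C * r ^ N"
    by blast
  have "G V z \<le> ln r" by (rule products_bounded_imp_G_le[OF V L1 Cr(1,2,4)])
  also have "ln r < ln (cmod \<mu>)" using Cr(2,3) \<mu>(1) by (simp add: ln_less_cancel_iff)
  finally show False using \<mu>(2) by simp
qed

section \<open>The critical curve\<close>

text \<open>
  The sequence \<open>p\<close> stands for the moduli of a formal solution and \<open>\<kappa>\<close> for a cutoff. For
  \<open>\<kappa> j = exp(- \<delta> \<bar>j - N\<bar>)\<close> on \<open>1 \<le> j \<le> 2N\<close>, neighbouring values differ by a factor within \<open>exp(\<plusminus>\<delta>)\<close>, so the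
  right-hand side is at most half of the left-hand side, by the choice of \<open>\<delta>\<close>, plus the two boundary
  terms. These are exponentially smaller than the term at \<open>N\<close>, because \<open>p\<close> grows and decays at most
  with the rate \<open>\<eta> = \<delta> / 6\<close>; the fraction only has to be small enough for \<open>6\<eta> - 2\<delta> < 0\<close>, the worst exponent
  that occurs. The peak is put at \<open>N\<close>, and not at the origin, so that forward orbits suffice.
\<close>

lemma critical_orbit_contradiction:
  fixes p :: "nat \<Rightarrow> real"
  assumes p: "\<And>j. 0 < p j" and K: "K > 0"
    and growth: "\<And>\<eta>. \<eta> > 0 \<Longrightarrow> \<exists>N. \<forall>j\<ge>N. \<bar>ln (p j)\<bar> \<le> real j * \<eta>"
    and bound: "\<And>\<kappa> L. \<kappa> 0 = 0 \<Longrightarrow> \<kappa> (Suc L) = 0 \<Longrightarrow>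
       (\<Sum>j\<le>L. (\<kappa> j * p j)\<^sup>2) \<le> K * (\<Sum>j\<le>L. ((\<kappa> (Suc j) - \<kappa> j) * p (Suc j))\<^sup>2)"
  shows False
proof -
  define \<delta> where "\<delta> = ln (1 + 1 / (1 + 2 * K))"
  have "1 < 1 + 1 / (1 + 2 * K)" using K by simp
  from ln_gt_zero[OF this] exp_ln[OF less_trans[OF zero_less_one this]]
  have \<delta>: "\<delta> > 0" "exp \<delta> - 1 = 1 / (1 + 2 * K)" by (simp_all only: \<delta>_def)
  have small: "K * (exp \<delta> - 1)\<^sup>2 \<le> 1 / 2"
  proof -
    have "K * (exp \<delta> - 1)\<^sup>2 = (K / (1 + 2 * K)) * (1 / (1 + 2 * K))"
      unfolding \<delta>(2) by (simp add: power2_eq_square)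
    also have "\<dots> \<le> (1 / 2) * 1" using K by (intro mult_mono) (auto simp: field_simps)
    finally show ?thesis by simp
  qed
  define \<eta> where "\<eta> = \<delta> / 6"
  have \<eta>: "\<eta> > 0" using \<delta> by (simp add: \<eta>_def)
  obtain N0 where N0: "\<And>j. j \<ge> N0 \<Longrightarrow> \<bar>ln (p j)\<bar> \<le> j * \<eta>" using growth[OF \<eta>] by blast
  have up: "p j \<le> exp (j * \<eta>)" and lo: "exp (- (j * \<eta>)) \<le> p j" if "j \<ge> N0" for j
  proof -
    have "exp (ln (p j)) \<le> exp (j * \<eta>)" "exp (- (j * \<eta>)) \<le> exp (ln (p j))"
      using N0[OF that] by (simp_all add: abs_le_iff)
    then show "p j \<le> exp (j * \<eta>)" "exp (- (j * \<eta>)) \<le> p j" using p[of j] by simp_all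
  qed
  define c where "c = 2 * K * ((p 1)\<^sup>2 * exp (2 * \<delta>) + exp (2 * \<eta>))"
  have ineq: "1 \<le> c * exp (- \<delta>) ^ N" if "N > N0" for N :: nat
  proof -
    define \<kappa> where "\<kappa> j = (if j = 0 \<or> j > 2 * N then 0 else exp (- \<delta> * \<bar>real j - real N\<bar>))" for j :: nat
    define T where "T j = (\<kappa> j * p j)\<^sup>2" for j
    define S where "S = (\<Sum>j\<le>2 * N. T j)"
    have N: "N \<ge> 1" "N \<ge> N0" using that by auto
    have T0: "T 0 = 0" "T (Suc (2 * N)) = 0" by (simp_all add: T_def \<kappa>_def)
    have T1: "T 1 = (p 1)\<^sup>2 * exp (2 * \<delta>) * exp (- (2 * \<delta> * N))"
      using N by (simp add: T_def \<kappa>_def power_mult_distrib exp_double[symmetric] exp_add[symmetric] algebra_simps)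
    have step_le: "((\<kappa> (Suc j) - \<kappa> j) * p (Suc j))\<^sup>2
       \<le> (exp \<delta> - 1)\<^sup>2 * T (Suc j) + ((if j = 0 then T 1 else 0)
          + (if j = 2 * N then exp (- (2 * \<delta> * N)) * (p (Suc (2 * N)))\<^sup>2 else 0))" if j: "j \<le> 2 * N" for j
    proof -
      consider "j = 0" | "j = 2 * N" | "0 < j" "j < 2 * N" using j by linarith
      then show ?thesis
      proof cases
        case 1
        then show ?thesis using N by (simp add: T_def \<kappa>_def)
      next
        case 2
        have "\<kappa> (2 * N) = exp (- (\<delta> * N))" using N by (simp add: \<kappa>_def)
        then have "(\<kappa> (2 * N))\<^sup>2 = exp (- (2 * \<delta> * N))" by (simp add: exp_double[symmetric])
        moreover have "\<kappa> (Suc (2 * N)) = 0" by (simp add: \<kappa>_def)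
        ultimately show ?thesis using 2 N T0 by (simp add: power_mult_distrib)
      next
        case 3
        define e where "e = \<bar>real (Suc j) - real N\<bar> - \<bar>real j - real N\<bar>"
        have e: "\<bar>e\<bar> \<le> 1" by (simp add: e_def)
        have "\<kappa> j = exp (\<delta> * e) * \<kappa> (Suc j)"
          using 3 by (simp add: \<kappa>_def e_def exp_add[symmetric] algebra_simps)
        then have "(\<kappa> (Suc j) - \<kappa> j) * p (Suc j) = (1 - exp (\<delta> * e)) * (\<kappa> (Suc j) * p (Suc j))"
          by (simp add: algebra_simps)
        then have "((\<kappa> (Suc j) - \<kappa> j) * p (Suc j))\<^sup>2 = (1 - exp (\<delta> * e))\<^sup>2 * T (Suc j)"
          by (simp only: T_def power_mult_distrib[symmetric])
        also have "\<dots> \<le> (exp \<delta> - 1)\<^sup>2 * T (Suc j)"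
        proof (intro mult_right_mono)
          have "\<bar>\<delta> * e\<bar> \<le> \<delta>" using \<delta>(1) mult_left_mono[OF e, of \<delta>] by (simp add: abs_mult)
          then have "exp (\<delta> * e) \<le> exp \<delta>" "exp (- \<delta>) \<le> exp (\<delta> * e)" by (simp_all add: abs_le_iff)
          moreover have "1 - exp (- \<delta>) \<le> exp \<delta> - 1"
          proof -
            have "exp \<delta> * exp (- \<delta>) = 1" by (simp add: exp_minus)
            moreover have "0 \<le> (exp \<delta> - 1) * (1 - exp (- \<delta>))" using \<delta>(1) by (intro mult_nonneg_nonneg) simp_all
            ultimately show ?thesis by (simp add: algebra_simps)
          qed
          ultimately have "\<bar>1 - exp (\<delta> * e)\<bar> \<le> exp \<delta> - 1" by linarith
          from power_mono[OF this, of 2] show "(1 - exp (\<delta> * e))\<^sup>2 \<le> (exp \<delta> - 1)\<^sup>2" by simp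
        qed (simp add: T_def)
        finally show ?thesis using 3 by simp
      qed
    qed
    have "S \<le> K * (\<Sum>j\<le>2 * N. ((\<kappa> (Suc j) - \<kappa> j) * p (Suc j))\<^sup>2)"
      unfolding S_def T_def by (rule bound) (auto simp: \<kappa>_def)
    also have "\<dots> \<le> K * (\<Sum>j\<le>2 * N. (exp \<delta> - 1)\<^sup>2 * T (Suc j) + ((if j = 0 then T 1 else 0)
          + (if j = 2 * N then exp (- (2 * \<delta> * N)) * (p (Suc (2 * N)))\<^sup>2 else 0)))"
      using K by (intro mult_left_mono sum_mono step_le) auto
    also have "\<dots> = (K * (exp \<delta> - 1)\<^sup>2) * (\<Sum>j\<le>2 * N. T (Suc j)) + K * (T 1 + exp (- (2 * \<delta> * N)) * (p (Suc (2 * N)))\<^sup>2)"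
      by (simp add: sum.distrib sum_distrib_left[symmetric] distrib_left)
    also have "(\<Sum>j\<le>2 * N. T (Suc j)) = S"
      using sum.atMost_Suc_shift[of T "2 * N"] T0 by (simp add: S_def)
    also have "(K * (exp \<delta> - 1)\<^sup>2) * S \<le> 1 / 2 * S"
      by (intro mult_right_mono small) (simp add: S_def T_def sum_nonneg)
    finally have "S \<le> 2 * K * (T 1 + exp (- (2 * \<delta> * N)) * (p (Suc (2 * N)))\<^sup>2)" by simp
    moreover have "exp (- (2 * \<eta> * N)) \<le> S"
    proof -
      have "exp (- (2 * \<eta> * N)) = (exp (- (N * \<eta>)))\<^sup>2" by (simp add: exp_double[symmetric] mult_ac)
      also have "\<dots> \<le> (p N)\<^sup>2" by (intro power_mono lo N) auto
      also have "\<dots> = T N" using N by (simp add: T_def \<kappa>_def)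
      also have "\<dots> \<le> S" unfolding S_def by (rule member_le_sum) (auto simp: T_def)
      finally show ?thesis .
    qed
    moreover have "(p (Suc (2 * N)))\<^sup>2 \<le> exp (2 * \<eta>) * exp (4 * \<eta> * N)"
    proof -
      have "(p (Suc (2 * N)))\<^sup>2 \<le> (exp (Suc (2 * N) * \<eta>))\<^sup>2"
        using N by (intro power_mono up less_imp_le[OF p]) auto
      also have "\<dots> = exp (2 * \<eta>) * exp (4 * \<eta> * N)"
        by (simp add: exp_double[symmetric] exp_add[symmetric] algebra_simps)
      finally show ?thesis .
    qed
    ultimately have "exp (- (2 * \<eta> * N)) \<le> 2 * K * (T 1 + exp (- (2 * \<delta> * N)) * (exp (2 * \<eta>) * exp (4 * \<eta> * N)))"
      using K by (smt (verit) exp_gt_zero mult_left_mono)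
    then have "exp (2 * \<eta> * N) * exp (- (2 * \<eta> * N))
        \<le> exp (2 * \<eta> * N) * (2 * K * (T 1 + exp (- (2 * \<delta> * N)) * (exp (2 * \<eta>) * exp (4 * \<eta> * N))))"
      by (intro mult_left_mono) auto
    also have "exp (2 * \<eta> * N) * exp (- (2 * \<eta> * N)) = 1" by (simp add: exp_add[symmetric])
    also have "exp (2 * \<eta> * N) * (2 * K * (T 1 + exp (- (2 * \<delta> * N)) * (exp (2 * \<eta>) * exp (4 * \<eta> * N))))
      = 2 * K * ((p 1)\<^sup>2 * exp (2 * \<delta>) * exp ((2 * \<eta> - 2 * \<delta>) * N) + exp (2 * \<eta>) * exp ((6 * \<eta> - 2 * \<delta>) * N))"
      unfolding T1 by (simp add: algebra_simps exp_add exp_diff exp_minus) (simp add: exp_add[symmetric] field_simps)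
    also have "\<dots> \<le> 2 * K * ((p 1)\<^sup>2 * exp (2 * \<delta>) * exp (- \<delta> * N) + exp (2 * \<eta>) * exp (- \<delta> * N))"
      using K \<delta> by (intro mult_left_mono add_mono) (auto simp: \<eta>_def intro!: mult_right_mono)
    also have "\<dots> = c * exp (- \<delta> * N)" by (simp add: c_def algebra_simps)
    also have "exp (- \<delta> * N) = exp (- \<delta>) ^ N" by (simp add: exp_of_nat_mult[symmetric] mult.commute)
    finally show ?thesis .
  qed
  have "(\<lambda>N. c * exp (- \<delta>) ^ N) \<longlonglongrightarrow> c * 0"
    using \<delta> by (intro tendsto_intros LIMSEQ_power_zero) simp
  then have "1 \<le> c * 0"
    by (rule LIMSEQ_le_const) (use ineq in \<open>auto intro!: exI[of _ "Suc N0"]\<close>)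
  then show False by simp
qed

lemma twisted_conv_not_invertible_critical:
  fixes V :: "real ^ 'd \<Rightarrow> complex"
  assumes V: "torus_continuous V" and L1: "log_dist_in_L1 V z" and \<alpha>: "totally_irrational \<alpha>"
    and \<mu>: "\<mu> \<noteq> 0" "G V z = ln (cmod \<mu>)" and z: "z \<notin> range V"
  shows "\<not> ell2_invertible (twisted_conv (\<lambda>\<theta>. V \<theta> - z) \<mu> \<alpha>)"
proof
  assume inv: "ell2_invertible (twisted_conv (\<lambda>\<theta>. V \<theta> - z) \<mu> \<alpha>)"
  define v where "v \<theta> = V \<theta> - z" for \<theta>
  have v: "torus_continuous v" unfolding v_def by (intro torus_continuous_intros V)
  have nz: "v \<theta> \<noteq> 0" for \<theta> using z by (auto simp: v_def)
  obtain K where K: "K > 0" "\<And>F. torus_continuous F \<Longrightarrow>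
      torus_sq F \<le> K * torus_sq (\<lambda>\<theta>. v \<theta> * F \<theta> + \<mu> * F (\<theta> + \<alpha>))"
    using symbol_lower_bound[OF v, of \<mu> \<alpha>] inv by (auto simp: v_def[abs_def])
  define y :: "nat \<Rightarrow> real ^ 'd" where "y j = of_nat j *\<^sub>R \<alpha>" for j
  define q where "q j = (\<Prod>l<j. - v (y l) / \<mu>)" for j
  have q_Suc: "\<mu> * q (Suc j) = - v (y j) * q j" for j using \<mu>(1) by (simp add: q_def)
  have q_nz: "q j \<noteq> 0" for j using nz \<mu>(1) by (simp add: q_def)
  define h where "h \<theta> = ln (cmod (v \<theta>))" for \<theta>
  have h: "torus_continuous h" unfolding h_def using nz by (intro torus_continuous_intros v) auto
  have int: "torus_int h = ln (cmod \<mu>)"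
    using \<mu>(2) log_dist_in_L1D(3)[OF L1] by (simp add: h_def[abs_def] v_def)
  have ln_q: "ln (cmod (q j)) = (\<Sum>l<j. h (0 + of_nat l *\<^sub>R \<alpha>)) - j * torus_int h" for j
  proof -
    have "cmod (q j) = (\<Prod>l<j. cmod (v (y l)) / cmod \<mu>)" by (simp add: q_def prod_norm[symmetric] norm_divide)
    also have "ln \<dots> = (\<Sum>l<j. ln (cmod (v (y l)) / cmod \<mu>))" using nz \<mu>(1) by (intro ln_prod) auto
    also have "\<dots> = (\<Sum>l<j. h (0 + of_nat l *\<^sub>R \<alpha>) - torus_int h)"
      unfolding int using nz \<mu>(1) by (intro sum.cong refl) (simp add: ln_div h_def y_def)
    finally show ?thesis by (simp add: sum_subtractf)
  qed
  show False
  proof (rule critical_orbit_contradiction[where p = "\<lambda>j. cmod (q j)" and K = "K * (cmod \<mu>)\<^sup>2"])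
    show "0 < cmod (q j)" for j using q_nz by simp
    show "K * (cmod \<mu>)\<^sup>2 > 0" using K(1) \<mu>(1) by simp
    show "\<exists>N. \<forall>j\<ge>N. \<bar>ln (cmod (q j))\<bar> \<le> real j * \<eta>" if "\<eta> > 0" for \<eta>
      unfolding ln_q using irrational_rotation_real_averages[OF h \<alpha> that] by metis
  next
    fix \<kappa> :: "nat \<Rightarrow> real" and L :: nat
    assume \<kappa>: "\<kappa> 0 = 0" "\<kappa> (Suc L) = 0"
    have "(\<Sum>j\<le>L. (cmod (\<kappa> j * q j))\<^sup>2)
      \<le> K * (\<Sum>j\<le>L. (cmod (v (0 + of_nat j *\<^sub>R \<alpha>) * (\<kappa> j * q j) + \<mu> * (\<kappa> (Suc j) * q (Suc j))))\<^sup>2)"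
      by (rule orbit_lower_bound[OF v \<alpha> K(2)]) (auto simp: \<kappa>)
    also have "(\<Sum>j\<le>L. (cmod (v (0 + of_nat j *\<^sub>R \<alpha>) * (\<kappa> j * q j) + \<mu> * (\<kappa> (Suc j) * q (Suc j))))\<^sup>2)
      = (\<Sum>j\<le>L. (cmod \<mu>)\<^sup>2 * ((\<kappa> (Suc j) - \<kappa> j) * cmod (q (Suc j)))\<^sup>2)"
    proof (intro sum.cong refl)
      fix j
      have "v (y j) * (\<kappa> j * q j) + \<mu> * (\<kappa> (Suc j) * q (Suc j))
        = \<kappa> (Suc j) * (\<mu> * q (Suc j)) - \<kappa> j * (- v (y j) * q j)" by (simp add: algebra_simps)
      also have "\<dots> = \<mu> * complex_of_real (\<kappa> (Suc j) - \<kappa> j) * q (Suc j)"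
        unfolding q_Suc[symmetric] by (simp add: algebra_simps)
      finally show "(cmod (v (0 + of_nat j *\<^sub>R \<alpha>) * (\<kappa> j * q j) + \<mu> * (\<kappa> (Suc j) * q (Suc j))))\<^sup>2
        = (cmod \<mu>)\<^sup>2 * ((\<kappa> (Suc j) - \<kappa> j) * cmod (q (Suc j)))\<^sup>2"
        by (simp add: y_def norm_mult power_mult_distrib del: of_real_diff)
    qed
    finally show "(\<Sum>j\<le>L. (\<kappa> j * cmod (q j))\<^sup>2)
      \<le> K * (cmod \<mu>)\<^sup>2 * (\<Sum>j\<le>L. ((\<kappa> (Suc j) - \<kappa> j) * cmod (q (Suc j)))\<^sup>2)"
      by (simp add: norm_mult power_mult_distrib sum_distrib_left[symmetric] mult.assoc)
  qed
qed

section \<open>The spectrum\<close>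

text \<open>
  Without the translation only multiplication by \<open>V - z\<close> is left; that a zero is an obstruction is
  again seen on a single orbit, with \<open>f\<close> concentrated at the zero.
\<close>

lemma twisted_conv_zero_invertible_iff:
  fixes V :: "real ^ 'd \<Rightarrow> complex"
  assumes V: "torus_continuous V" and \<alpha>: "totally_irrational \<alpha>"
  shows "ell2_invertible (twisted_conv (\<lambda>\<theta>. V \<theta> - z) 0 \<alpha>) \<longleftrightarrow> z \<notin> range V"
proof
  have v: "torus_continuous (\<lambda>\<theta>. V \<theta> - z)" by (intro torus_continuous_intros V)
  {
    assume "z \<notin> range V"
    then have "V \<theta> - z \<noteq> 0" for \<theta> by auto
    from conv_op_invertible[OF v this] show "ell2_invertible (twisted_conv (\<lambda>\<theta>. V \<theta> - z) 0 \<alpha>)"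
      by (simp add: twisted_conv_def[abs_def])
  next
    assume inv: "ell2_invertible (twisted_conv (\<lambda>\<theta>. V \<theta> - z) 0 \<alpha>)"
    obtain K where K: "K > 0" "\<And>F. torus_continuous F \<Longrightarrow>
        torus_sq F \<le> K * torus_sq (\<lambda>\<theta>. (V \<theta> - z) * F \<theta> + 0 * F (\<theta> + \<alpha>))"
      using symbol_lower_bound[OF v inv] by blast
    show "z \<notin> range V"
    proof
      assume "z \<in> range V"
      then obtain \<theta>\<^sub>0 where \<theta>\<^sub>0: "V \<theta>\<^sub>0 = z" by auto
      define f :: "nat \<Rightarrow> complex" where "f j = (if j = 1 then 1 else 0)" for j
      have "(\<Sum>j\<le>1. (cmod (f j))\<^sup>2)
        \<le> K * (\<Sum>j\<le>1. (cmod ((V (\<theta>\<^sub>0 - \<alpha> + of_nat j *\<^sub>R \<alpha>) - z) * f j + 0 * f (Suc j)))\<^sup>2)"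
        by (rule orbit_lower_bound[OF v \<alpha> K(2)]) (auto simp: f_def)
      then show False by (simp add: f_def \<theta>\<^sub>0)
    qed
  }
qed

lemma rationally_independent_imp_totally_irrational:
  assumes "rationally_independent \<alpha>" shows "totally_irrational \<alpha>"
  unfolding totally_irrational_def
proof (intro allI impI notI)
  fix k assume "k \<noteq> 0" "torus_char k \<alpha> = 1"
  then obtain m where "pairing k \<alpha> = of_int m" by (auto simp: torus_char_eq_1_iff elim: Ints_cases)
  then have "of_rat (of_int (- m)) * 1 + (\<Sum>i\<in>UNIV. of_rat (of_int (k $ i)) * \<alpha> $ i) = 0"
    by (simp add: pairing_def of_rat_minus)
  then have "\<forall>i. (of_int (k $ i) :: rat) = 0"
    using assms unfolding rationally_independent_def
    by (elim allE[of _ "of_int (- m)"] allE[of _ "\<lambda>i. of_int (k $ i)"]) simp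
  then show False using \<open>k \<noteq> 0\<close> by (simp add: vec_eq_iff)
qed

theorem theorem1p2:
  fixes V :: "real ^ 'd \<Rightarrow> complex"
    and \<alpha> :: "real ^ 'd"
    and lam :: complex
  assumes "rationally_independent \<alpha>"
    and "torus_periodic V"
    and "continuous_on UNIV V"
    and "hoelder_continuous V"
    and "\<And>z. log_dist_in_L1 V z"
  shows "\<forall>\<omega> :: real. ell2_spectrum (H_op V \<alpha> lam \<omega>) = S_set V lam"
proof
  fix \<omega> :: real
  define \<mu> where "\<mu> = lam * exp (2 * of_real pi * \<i> * of_real \<omega>)"
  have \<mu>: "cmod \<mu> = cmod lam" "\<mu> = 0 \<longleftrightarrow> lam = 0" by (auto simp: \<mu>_def norm_mult norm_exp_eq_Re)
  have V: "torus_continuous V" using assms(2,3) by (simp add: torus_continuous_def)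
  note \<alpha> = rationally_independent_imp_totally_irrational[OF assms(1)]
  have "z \<in> ell2_spectrum (H_op V \<alpha> lam \<omega>) \<longleftrightarrow> \<not> ell2_invertible (twisted_conv (\<lambda>\<theta>. V \<theta> - z) \<mu> \<alpha>)" for z
  proof -
    have "(\<lambda>n. H_op V \<alpha> lam \<omega> u n - z * u n) = twisted_conv (\<lambda>\<theta>. V \<theta> - z) \<mu> \<alpha> u" if "u \<in> ell2" for u
      unfolding \<mu>_def using H_op_minus_eq_twisted_conv[OF V that] by blast
    from ell2_invertible_cong[where A = "\<lambda>u n. H_op V \<alpha> lam \<omega> u n - z * u n", OF this]
    show ?thesis unfolding ell2_spectrum_iff by simp
  qed
  moreover have "\<not> ell2_invertible (twisted_conv (\<lambda>\<theta>. V \<theta> - z) \<mu> \<alpha>) \<longleftrightarrow> z \<in> S_set V lam" for z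
  proof (cases "lam = 0")
    case True
    then show ?thesis using twisted_conv_zero_invertible_iff[OF V \<alpha>, of z] \<mu>(2) by (simp add: S_set_def)
  next
    case False
    then have nz: "\<mu> \<noteq> 0" using \<mu>(2) by simp
    have S: "z \<in> S_set V lam \<longleftrightarrow> G V z = ln (cmod \<mu>) \<or> (G V z > ln (cmod \<mu>) \<and> z \<in> range V)"
      using False by (auto simp: S_set_def P_set_def C_set_def \<mu>(1))
    show ?thesis unfolding S
      using twisted_conv_invertible_subcritical[OF V assms(5) \<alpha> nz, of z]
        twisted_conv_invertible_supercritical[OF V assms(5) \<alpha> nz, of z]
        twisted_conv_not_invertible_at_zero[OF V assms(5) \<alpha> nz, of z]
        twisted_conv_not_invertible_critical[OF V assms(5) \<alpha> nz, of z] by fastforce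
  qed
  ultimately show "ell2_spectrum (H_op V \<alpha> lam \<omega>) = S_set V lam" by blast
qed

end
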